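(* Let $\mathcal A(r)$ denote the minimum of the area among all planar convex bodies of constant width $1$ and inradius $r$. Then the map $r\mapsto\mathcal A(r)$ is continuous on $[1-1/\sqrt3,1/2]$. Moreover, if for each $r$ one chooses as minimizer for $\mathcal A(r)$ the optimal Reuleaux polygon $\Omega(r)$ described in the context, then the map $r\mapsto\Omega(r)$ is continuous with respect to the Hausdorff distance $d_{\mathcal H}$, up to rigid motions; that is, for every $\epsilon>0$ there exists $\delta>0$ such that whenever $|r_1-r_2|<\delta$ one has $d_{\mathcal H}(\Omega(r_1),\Omega(r_2))<\epsilon$ for some representatives of $\Omega(r_1)$ and $\Omega(r_2)$ up to rigid motion.
   Context: A convex body is a compact convex set with nonempty interior. It has constant width $1$ if the distance between its two supporting lines orthogonal to any given direction is $1$; its inradius is the largest radius of a disk it contains. For a planar body of constant width $1$ and inradius $r$, the incircle (radius $r$) and the outercircle, i.e. smallest enclosing circle (radius $1-r$), are concentric; the annulus is the region between them. A Reuleaux polygon of width $1$ is a planar convex body of constant width $1$ whose boundary consists of a finite (necessarily odd) number of arcs of circles of radius $1$, called its sides; it is regular if all arcs have equal length. Each side is centered at a vertex $P$ of the polygon; the two sides opposite to it are those having $P$ as an endpoint. For $N\ge1$ let $r_{2N+1}=1-\frac{1}{2\cos(\pi/(2(2N+1)))}$, the inradius of the regular Reuleaux $(2N+1)$-gon of width $1$; the sequence increases from $1-1/\sqrt3$ (at $N=1$) to the limit $1/2$ (not attained). The shape $\Omega(r)$, $r\in[1-1/\sqrt3,1/2)$, is defined up to rigid motion as follows. If $r=r_{2N+1}$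 with $N\ge1$, $\Omega(r)$ is the regular Reuleaux $(2N+1)$-gon of width $1$. If $r_{2N-1}<r<r_{2N+1}$ with $N\ge2$, set $\ell=2\arctan(\sqrt{4(1-r)^2-1})$ and $h=\frac\pi2-\frac{2N-1}{2}\ell$; then $\Omega(r)$ is the Reuleaux polygon of width $1$ and inradius $r$ with $2N+1$ sides, all but one tangent to the incircle, such that: the non-tangent side has both endpoints on the outercircle and length $a=2\arcsin((1-r)\sin h)$; its two opposite sides each have one endpoint on the outercircle, meet at a point in the interior of the annulus, and have length $b=h+\frac{\ell-a}{2}$; the other $2N-2$ sides are tangent to the incircle, have both endpoints on the outercircle, and have length $\ell$. These $\Omega(r)$ are minimizers for $\mathcal A(r)$. *)

theory Defs
  imports "HOL-Analysis.Analysis"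
begin

section \<open>Planar convex bodies of constant width\<close>

definition convex_body :: "(real^2) set \<Rightarrow> bool" where
  "convex_body K \<longleftrightarrow> compact K \<and> convex K \<and> interior K \<noteq> {}"

text \<open>For a unit vector \<open>u\<close>, the supporting lines of \<open>K\<close> orthogonal to \<open>u\<close> are the level lines of
  \<open>x \<mapsto> x \<bullet> u\<close> at its supremum and infimum over \<open>K\<close>; \<open>width K u\<close> is their distance.\<close>

definition width :: "(real^2) set \<Rightarrow> real^2 \<Rightarrow> real" where
  "width K u = (SUP x\<in>K. x \<bullet> u) - (INF x\<in>K. x \<bullet> u)"

definition constant_width_one :: "(real^2) set \<Rightarrow> bool" where
  "constant_width_one K \<longleftrightarrow> convex_body K \<and> (\<forall>u. norm u = 1 \<longrightarrow> width K u = 1)"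

definition inradius :: "(real^2) set \<Rightarrow> real" where
  "inradius K = Sup {\<rho>. 0 \<le> \<rho> \<and> (\<exists>c. cball c \<rho> \<subseteq> K)}"

definition is_incircle :: "(real^2) set \<Rightarrow> real^2 \<Rightarrow> real \<Rightarrow> bool" where
  "is_incircle K c \<rho> \<longleftrightarrow> 0 \<le> \<rho> \<and> cball c \<rho> \<subseteq> K \<and> (\<forall>c' \<rho>'. cball c' \<rho>' \<subseteq> K \<longrightarrow> \<rho>' \<le> \<rho>)"

definition is_outercircle :: "(real^2) set \<Rightarrow> real^2 \<Rightarrow> real \<Rightarrow> bool" where
  "is_outercircle K c \<rho> \<longleftrightarrow> K \<subseteq> cball c \<rho> \<and> (\<forall>c' \<rho>'. K \<subseteq> cball c' \<rho>' \<longrightarrow> \<rho> \<le> \<rho>')"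

definition cw_bodies :: "real \<Rightarrow> (real^2) set set" where
  "cw_bodies r = {K. constant_width_one K \<and> inradius K = r}"

text \<open>The value \<open>\<A>(r)\<close>, written as an infimum; that it is attained (so that it is a minimum) is
  part of the theorem.\<close>

definition min_area :: "real \<Rightarrow> real" where
  "min_area r = (INF K\<in>cw_bodies r. measure lebesgue K)"


section \<open>Rigid motions and the Hausdorff distance\<close>

text \<open>Rigid motions are taken to preserve orientation.\<close>

definition rigid_motion :: "(real^2 \<Rightarrow> real^2) \<Rightarrow> bool" where
  "rigid_motion f \<longleftrightarrow> (\<exists>A b. rotation_matrix A \<and> f = (\<lambda>x. A *v x + b))"

definition hausdorff_dist :: "(real^2) set \<Rightarrow> (real^2) set \<Rightarrow> real" where
  "hausdorff_dist A B = max (SUP x\<in>A. infdist x B) (SUP y\<in>B. infdist y A)"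


section \<open>Reuleaux polygons of width 1\<close>

definition unit_dir :: "real \<Rightarrow> real^2" where
  "unit_dir t = vector [cos t, sin t]"

text \<open>The arc of the unit circle about \<open>p\<close> that starts at angle \<open>t\<close> and has length \<open>l\<close>.\<close>

definition unit_arc :: "real^2 \<Rightarrow> real \<Rightarrow> real \<Rightarrow> (real^2) set" where
  "unit_arc p t l = (\<lambda>s. p + unit_dir s) ` {t..t + l}"

definition arc_ends :: "real^2 \<Rightarrow> real \<Rightarrow> real \<Rightarrow> (real^2) set" where
  "arc_ends p t l = {p + unit_dir t, p + unit_dir (t + l)}"

text \<open>\<open>K\<close> is a Reuleaux polygon of width 1 whose \<open>n\<close> sides are the arcs with centres \<open>p i\<close>, initial
  angles \<open>t i\<close> and lengths \<open>l i\<close>, for \<open>i < n\<close>; the numbering of the sides is arbitrary, not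
  necessarily cyclic. Injectivity of \<open>p\<close> says that sides are maximal arcs: an arc subdivided into
  consecutive pieces on the same circle counts as one side only.\<close>

definition reuleaux_polygon ::
    "(real^2) set \<Rightarrow> nat \<Rightarrow> (nat \<Rightarrow> real^2) \<Rightarrow> (nat \<Rightarrow> real) \<Rightarrow> (nat \<Rightarrow> real) \<Rightarrow> bool" where
  "reuleaux_polygon K n p t l \<longleftrightarrow>
     constant_width_one K \<and>
     (\<forall>i<n. 0 < l i \<and> l i < 2 * pi) \<and>
     frontier K = (\<Union>i<n. unit_arc (p i) (t i) (l i)) \<and>
     (\<forall>i<n. \<forall>j<n. i \<noteq> j \<longrightarrow>
        unit_arc (p i) (t i) (l i) \<inter> unit_arc (p j) (t j) (l j)
          \<subseteq> arc_ends (p i) (t i) (l i) \<inter> arc_ends (p j) (t j) (l j)) \<and>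
     inj_on p {..<n} \<and>
     (\<forall>i<n. \<exists>j<n. p i \<in> arc_ends (p j) (t j) (l j))"

definition regular_reuleaux_polygon :: "(real^2) set \<Rightarrow> nat \<Rightarrow> bool" where
  "regular_reuleaux_polygon K n \<longleftrightarrow>
     (\<exists>p t l. reuleaux_polygon K n p t l \<and> (\<forall>i<n. \<forall>j<n. l i = l j))"

text \<open>A unit arc about \<open>p\<close> and the circle of radius \<open>\<rho>\<close> about \<open>c\<close> are tangent at a common point \<open>x\<close>
  when their radii at \<open>x\<close> are parallel.\<close>

definition tangent_arc_circle ::
    "real^2 \<Rightarrow> real \<Rightarrow> real \<Rightarrow> real^2 \<Rightarrow> real \<Rightarrow> bool" where
  "tangent_arc_circle p t l c \<rho> \<longleftrightarrow> (\<exists>x \<in> unit_arc p t l \<inter> sphere c \<rho>. collinear {p, c, x})"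


section \<open>The shapes \<open>\<Omega>(r)\<close>\<close>

text \<open>\<open>reuleaux_inradius n\<close> is \<open>r\<^sub>n\<close>, the inradius of the regular Reuleaux \<open>n\<close>-gon of width 1, \<open>n\<close> odd.\<close>

definition reuleaux_inradius :: "nat \<Rightarrow> real" where
  "reuleaux_inradius n = 1 - 1 / (2 * cos (pi / (2 * real n)))"

definition omega_l :: "real \<Rightarrow> real" where
  "omega_l r = 2 * arctan (sqrt (4 * (1 - r)\<^sup>2 - 1))"

definition omega_h :: "nat \<Rightarrow> real \<Rightarrow> real" where
  "omega_h N r = pi / 2 - (2 * real N - 1) / 2 * omega_l r"

definition omega_a :: "nat \<Rightarrow> real \<Rightarrow> real" where
  "omega_a N r = 2 * arcsin ((1 - r) * sin (omega_h N r))"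

definition omega_b :: "nat \<Rightarrow> real \<Rightarrow> real" where
  "omega_b N r = omega_h N r + (omega_l r - omega_a N r) / 2"

text \<open>The shape for \<open>r\<^sub>2\<^sub>N\<^sub>-\<^sub>1 < r < r\<^sub>2\<^sub>N\<^sub>+\<^sub>1\<close>: \<open>k\<close> is the side not tangent to the incircle, \<open>i\<close> and \<open>j\<close> are the two
  sides opposite to it, and \<open>c\<close> is the common centre of the incircle and the outercircle.\<close>

definition intermediate_omega :: "nat \<Rightarrow> real \<Rightarrow> (real^2) set \<Rightarrow> bool" where
  "intermediate_omega N r K \<longleftrightarrow>
     (\<exists>p t l c. reuleaux_polygon K (2 * N + 1) p t l \<and>
        is_incircle K c r \<and> is_outercircle K c (1 - r) \<and>
        (\<exists>k i j. k < 2 * N + 1 \<and> i \<noteq> j \<and>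
           {m. m < 2 * N + 1 \<and> p k \<in> arc_ends (p m) (t m) (l m)} = {i, j} \<and>
           \<not> tangent_arc_circle (p k) (t k) (l k) c r \<and>
           arc_ends (p k) (t k) (l k) \<subseteq> sphere c (1 - r) \<and>
           l k = omega_a N r \<and>
           (\<forall>m\<in>{i, j}. card (arc_ends (p m) (t m) (l m) \<inter> sphere c (1 - r)) = 1 \<and>
              l m = omega_b N r) \<and>
           (\<exists>x. unit_arc (p i) (t i) (l i) \<inter> unit_arc (p j) (t j) (l j) = {x} \<and>
              r < dist c x \<and> dist c x < 1 - r) \<and>
           (\<forall>m<2 * N + 1. m \<noteq> k \<longrightarrow> tangent_arc_circle (p m) (t m) (l m) c r) \<and>
           (\<forall>m<2 * N + 1. m \<notin> {k, i, j} \<longrightarrow>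
              arc_ends (p m) (t m) (l m) \<subseteq> sphere c (1 - r) \<and> l m = omega_l r)))"

text \<open>\<open>is_Omega r K\<close> says that \<open>K\<close> is a representative of \<open>\<Omega>(r)\<close>, which is only defined up to rigid
  motion.\<close>

definition is_Omega :: "real \<Rightarrow> (real^2) set \<Rightarrow> bool" where
  "is_Omega r K \<longleftrightarrow>
     (\<exists>N\<ge>1. r = reuleaux_inradius (2 * N + 1) \<and> regular_reuleaux_polygon K (2 * N + 1)) \<or>
     (\<exists>N\<ge>2. reuleaux_inradius (2 * N - 1) < r \<and> r < reuleaux_inradius (2 * N + 1) \<and>
        intermediate_omega N r K)"

end

theory Submission
  imports Defs "HOL-Complex_Analysis.Great_Picard"
begin

text \<open>
  Continuity of the minimal area. Constant-width bodies of inradius \<open>r\<close> form, up to translation, a compact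
  family for the Hausdorff distance (Blaschke selection), on which inradius and area are continuous; this gives
  minimizers and lower semicontinuity of \<open>\<A>\<close>. For upper semicontinuity a minimizer \<open>K\<close> of \<open>\<A>(r)\<close> has to be
  approximated by constant-width bodies of any nearby inradius, and these are found on Minkowski segments
  \<open>(1 - t) K + t L\<close>. To increase the inradius take \<open>L\<close> a disk. To decrease it, note that the centre of \<open>K\<close> is a
  convex combination \<open>\<Sum> m\<^sub>i x\<^sub>i\<close> of contact points \<open>x\<^sub>i\<close> with the outercircle, in directions \<open>v\<^sub>i\<close>, so that
  \<open>\<Sum> m\<^sub>i h(v\<^sub>i)\<close> bounds the circumradius of every body with support function \<open>h\<close> from below, with equality for
  \<open>K\<close>; and unless \<open>K\<close> has the inradius of the Reuleaux triangle, a suitably placed Reuleaux triangle \<open>L\<close> has a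
  larger value of this average than \<open>K\<close>.

  Continuity of \<open>\<Omega>\<close>. In a Reuleaux polygon the normal directions of the sides tile the circle of directions
  modulo \<open>\<pi>\<close>, and consecutive tiles belong to sides the centre of one of which is an endpoint of the other.
  Hence the cyclic sequence of side lengths determines the polygon up to a rigid motion, and continuously so.
  For \<open>\<Omega>(r)\<close> this sequence is \<open>a, b, \<ell>, \<dots>, \<ell>, b\<close>, which depends continuously on \<open>r\<close>; at the endpoints of the
  parameter intervals it becomes the sequence of a regular polygon, with \<open>a = 0\<close> at the left endpoint. As
  \<open>r \<rightarrow> 1/2\<close> all shapes converge to the disk, so pointwise continuity on a compact interval is uniform.
\<close>

section \<open>Unit directions\<close>

text \<open>Upper semicontinuity needs competitors whose inradius is prescribed exactly, so
  approximating a minimizer in the Hausdorff sense is not enough. Minkowski segments supply them: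
  they preserve constant width, support functions are affine along them, and the inradius is
  continuous along them, so the intermediate value theorem hits the prescribed value. The bound
  \<open>1 - 1 / sqrt 3\<close> enters twice: it keeps inradii away from 0, so that Hausdorff
  closeness controls area, and \<open>R < 1 / sqrt 3\<close> for \<open>R = 1 - r\<close> rules out
  an equilateral contact triangle of side 1, for which turning a Reuleaux triangle would gain
  nothing. For \<Omega> the definition lists the sides in arbitrary order and fixes only local data,
  so the cyclic order has to be recovered from the frontier before two such bodies can be compared;
  existence is a separate explicit construction. The length sequence reads the same in both
  orientations, so motions preserving orientation suffice. Infinitely many parameter intervals
  accumulate at 1/2, where no shape exists; the disk fills this gap and makes the parameter range
  compact.\<close>

lemma inner_real2: "(x::real^2) \<bullet> y = x $ 1 * y $ 1 + x $ 2 * y $ 2"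
  by (simp add: inner_vec_def sum_2)

lemma vec2_eqI: "x $ 1 = y $ 1 \<Longrightarrow> x $ 2 = y $ 2 \<Longrightarrow> x = (y::'a^2)"
  by (simp add: vec_eq_iff forall_2)

lemma unit_dir_nth [simp]: "unit_dir t $ 1 = cos t" "unit_dir t $ 2 = sin t"
  by (simp_all add: unit_dir_def)

lemma unit_dir_inner: "unit_dir s \<bullet> unit_dir t = cos (s - t)"
  by (simp add: inner_real2 cos_diff)

lemma norm_unit_dir [simp]: "norm (unit_dir t) = 1"
  by (simp add: norm_eq_sqrt_inner unit_dir_inner)

lemma unit_dir_add_pi: "unit_dir (t + pi) = - unit_dir t"
  by (rule vec2_eqI) auto

lemma unit_dir_eq_iff: "unit_dir s = unit_dir t \<longleftrightarrow> (\<exists>k::int. s = t + 2 * pi * k)"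
proof -
  have "unit_dir s = unit_dir t \<longleftrightarrow> sin s = sin t \<and> cos s = cos t"
    by (auto simp: vec_eq_iff forall_2)
  then show ?thesis using sin_cos_eq_iff[of s t] by (auto simp: mult_ac)
qed

lemma unit_dir_add_2pi_int [simp]: "unit_dir (t + 2 * pi * of_int k) = unit_dir t"
  using unit_dir_eq_iff by blast

lemma unit_dir_add_nat_pi: "unit_dir (t + real m * pi) = (-1) ^ m *\<^sub>R unit_dir t"
proof (induction m)
  case (Suc m)
  have "unit_dir (t + real (Suc m) * pi) = unit_dir ((t + real m * pi) + pi)"
    by (simp add: algebra_simps)
  then show ?case using Suc unit_dir_add_pi by simp
qed simp

lemma ex_unit_dir:
  assumes "norm (u::real^2) = 1"
  obtains t where "a \<le> t" "t < a + 2 * pi" "u = unit_dir t"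
proof -
  have "(u $ 1)\<^sup>2 + (u $ 2)\<^sup>2 = 1"
    using assms by (simp add: norm_eq_sqrt_inner inner_real2 power2_eq_square)
  then obtain s where "u $ 1 = cos s" "u $ 2 = sin s" using sincos_total_2pi_le by blast
  then have us: "u = unit_dir s" by (intro vec2_eqI) auto
  define k where "k = \<lfloor>(s - a) / (2 * pi)\<rfloor>"
  define t where "t = s + 2 * pi * of_int (- k)"
  have "of_int k \<le> (s - a) / (2 * pi)" "(s - a) / (2 * pi) < of_int k + 1"
    unfolding k_def by linarith+
  then have "of_int k * (2 * pi) \<le> s - a" "s - a < (of_int k + 1) * (2 * pi)"
    by (simp_all add: pos_le_divide_eq pos_divide_less_eq)
  then have "a \<le> t" "t < a + 2 * pi" by (simp_all add: t_def algebra_simps)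
  moreover have "u = unit_dir t" unfolding t_def us by (rule unit_dir_add_2pi_int[symmetric])
  ultimately show thesis using that by blast
qed

text \<open>The chord equals \<open>2 * \<bar>sin ((s - t) / 2)\<bar>\<close>, hence is no longer
  than the arc. This bound later turns changes of side lengths into changes of vertices.\<close>

lemma dist_unit_dir_le: "dist (unit_dir s) (unit_dir t) \<le> \<bar>s - t\<bar>"
proof -
  have "(dist (unit_dir s) (unit_dir t))\<^sup>2 = 2 - 2 * cos (s - t)"
    by (simp add: dist_norm power2_norm_eq_inner inner_diff unit_dir_inner inner_commute cos_diff)
  also have "\<dots> = 4 * (sin ((s - t) / 2))\<^sup>2"
    using cos_double_sin[of "(s - t) / 2"] by (simp add: diff_divide_distrib)
  also have "\<dots> \<le> 4 * ((s - t) / 2)\<^sup>2"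
    using abs_sin_x_le_abs_x[of "(s - t) / 2"] by (simp add: abs_le_square_iff[symmetric])
  also have "\<dots> = (s - t)\<^sup>2" by (simp add: power2_eq_square)
  finally show ?thesis using abs_le_square_iff[of "dist (unit_dir s) (unit_dir t)" "s - t"] by simp
qed

lemma continuous_on_unit_dir: "continuous_on S unit_dir"
proof (rule continuous_onI)
  fix x e assume "(0::real) < e"
  then show "\<exists>d>0. \<forall>x'\<in>S. dist x' x < d \<longrightarrow> dist (unit_dir x') (unit_dir x) \<le> e"
    by (intro exI[of _ e] conjI ballI impI) (auto simp: dist_real_def intro: order_trans[OF dist_unit_dir_le])
qed

lemma compact_unit_arc: "compact (unit_arc p t l)"
  unfolding unit_arc_def by (intro compact_continuous_image continuous_intros continuous_on_unit_dir) auto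


section \<open>The support function\<close>

definition hsup :: "(real^2) set \<Rightarrow> real^2 \<Rightarrow> real" where
  "hsup K u = (SUP x\<in>K. x \<bullet> u)"

lemma bdd_above_inner: "compact K \<Longrightarrow> bdd_above ((\<lambda>x. x \<bullet> u) ` (K :: (real^2) set))"
  by (intro bounded_imp_bdd_above compact_imp_bounded compact_continuous_image continuous_intros)

lemma hsup_ge: "compact K \<Longrightarrow> x \<in> K \<Longrightarrow> x \<bullet> u \<le> hsup K u"
  unfolding hsup_def by (intro cSUP_upper bdd_above_inner)

lemma hsup_attained:
  assumes "compact K" "K \<noteq> {}"
  obtains x where "x \<in> K" "x \<bullet> u = hsup K u"
proof -
  have "\<exists>x\<in>K. \<forall>y\<in>K. y \<bullet> u \<le> x \<bullet> u"
    by (intro continuous_attains_sup assms continuous_intros)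
  then obtain x where x: "x \<in> K" "\<forall>y\<in>K. y \<bullet> u \<le> x \<bullet> u" by blast
  then have "hsup K u = x \<bullet> u" unfolding hsup_def by (intro cSup_eq_maximum) auto
  then show thesis using that x by simp
qed

lemma hsup_le_iff:
  assumes "compact K" "K \<noteq> {}"
  shows "hsup K u \<le> b \<longleftrightarrow> (\<forall>x\<in>K. x \<bullet> u \<le> b)"
  by (metis assms hsup_attained hsup_ge order_trans)

lemma hsup_eqI:
  assumes "compact K" "x \<in> K" "\<And>y. y \<in> K \<Longrightarrow> y \<bullet> u \<le> x \<bullet> u"
  shows "hsup K u = x \<bullet> u"
  using assms hsup_le_iff[of K u "x \<bullet> u"] hsup_ge[of K x u] by force

lemma width_eq_hsup:
  assumes "compact K" "K \<noteq> {}"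
  shows "width K u = hsup K u + hsup K (- u)"
proof -
  obtain x where x: "x \<in> K" "x \<bullet> (- u) = hsup K (- u)" using hsup_attained[OF assms, of "- u"] by blast
  have "x \<bullet> u \<le> y \<bullet> u" if "y \<in> K" for y
    using hsup_ge[OF assms(1) that, of "- u"] x by simp
  then have "(INF y\<in>K. y \<bullet> u) = x \<bullet> u" using x by (intro cInf_eq_minimum) auto
  then show ?thesis using x by (simp add: width_def hsup_def)
qed

text \<open>A compact convex set is the intersection of its supporting half-planes: a point outside
  violates the one found by separation.\<close>

lemma mem_iff_hsup:
  assumes "compact K" "convex K" "K \<noteq> {}"
  shows "x \<in> K \<longleftrightarrow> (\<forall>u. norm u = 1 \<longrightarrow> x \<bullet> u \<le> hsup K u)"
proof (intro iffI allI impI)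
  fix u assume "x \<in> K" then show "x \<bullet> u \<le> hsup K u" using hsup_ge assms by blast
next
  assume *: "\<forall>u. norm u = 1 \<longrightarrow> x \<bullet> u \<le> hsup K u"
  show "x \<in> K"
  proof (rule ccontr)
    assume "x \<notin> K"
    then obtain a b where ab: "a \<bullet> x < b" "\<forall>y\<in>K. a \<bullet> y > b"
      using separating_hyperplane_closed_point[of K x] assms compact_imp_closed by blast
    have "a \<noteq> 0" using ab assms by force
    \<comment> \<open>Separation puts \<open>K\<close> on the side where the product with
      \<open>a\<close> is large, so the outer normal is \<open>- a\<close>, normalised.\<close>
    define u where "u = (- 1 / norm a) *\<^sub>R a"
    have "norm u = 1" using \<open>a \<noteq> 0\<close> by (simp add: u_def)
    obtain y where y: "y \<in> K" "y \<bullet> u = hsup K u" using hsup_attained[OF assms(1,3), of u] by blast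
    have "x \<bullet> u \<le> y \<bullet> u" using * \<open>norm u = 1\<close> y by simp
    then have "a \<bullet> y \<le> a \<bullet> x" using \<open>a \<noteq> 0\<close> by (simp add: u_def inner_commute divide_le_cancel)
    then show False using ab y by force
  qed
qed

text \<open>The support function of the disk is \<open>c \<bullet> u + \<rho>\<close> at unit
  vectors, so inclusion of bodies becomes comparison of support functions.\<close>

lemma cball_subset_iff_hsup:
  assumes "compact K" "convex K" "K \<noteq> {}" "0 \<le> \<rho>"
  shows "cball c \<rho> \<subseteq> K \<longleftrightarrow> (\<forall>u. norm u = 1 \<longrightarrow> c \<bullet> u + \<rho> \<le> hsup K u)"
proof (intro iffI allI impI)
  fix u :: "real^2" assume "cball c \<rho> \<subseteq> K" "norm u = 1"
  moreover have "c + \<rho> *\<^sub>R u \<in> cball c \<rho>" using \<open>norm u = 1\<close> assms by (simp add: dist_norm)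
  ultimately have "(c + \<rho> *\<^sub>R u) \<bullet> u \<le> hsup K u" using hsup_ge assms by blast
  then show "c \<bullet> u + \<rho> \<le> hsup K u"
    using \<open>norm u = 1\<close> by (simp add: inner_add_left norm_eq_1)
next
  assume *: "\<forall>u. norm u = 1 \<longrightarrow> c \<bullet> u + \<rho> \<le> hsup K u"
  show "cball c \<rho> \<subseteq> K"
  proof
    fix x assume x: "x \<in> cball c \<rho>"
    have "x \<bullet> u \<le> hsup K u" if "norm u = 1" for u
    proof -
      have "(x - c) \<bullet> u \<le> norm (x - c)" using norm_cauchy_schwarz[of "x - c" u] that by simp
      also have "\<dots> \<le> \<rho>" using x by (simp add: dist_norm norm_minus_commute)
      finally show ?thesis using *[rule_format, OF that] by (simp add: inner_diff_left)
    qed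
    then show "x \<in> K" using mem_iff_hsup assms by blast
  qed
qed

lemma subset_cball_iff_hsup:
  assumes "compact K" "K \<noteq> {}" "0 \<le> \<rho>"
  shows "K \<subseteq> cball c \<rho> \<longleftrightarrow> (\<forall>u. norm u = 1 \<longrightarrow> hsup K u \<le> c \<bullet> u + \<rho>)"
proof (intro iffI allI impI)
  fix u :: "real^2" assume K: "K \<subseteq> cball c \<rho>" "norm u = 1"
  have "x \<bullet> u \<le> c \<bullet> u + \<rho>" if "x \<in> K" for x
  proof -
    have "(x - c) \<bullet> u \<le> norm (x - c)" using norm_cauchy_schwarz[of "x - c" u] K by simp
    also have "\<dots> \<le> \<rho>" using K that by (force simp: dist_norm norm_minus_commute)
    finally show ?thesis by (simp add: inner_diff_left)
  qed
  then show "hsup K u \<le> c \<bullet> u + \<rho>" using hsup_le_iff assms by blast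
next
  assume *: "\<forall>u. norm u = 1 \<longrightarrow> hsup K u \<le> c \<bullet> u + \<rho>"
  show "K \<subseteq> cball c \<rho>"
  proof
    fix x assume x: "x \<in> K"
    show "x \<in> cball c \<rho>"
    proof (cases "x = c")
      case False
      define u where "u = (1 / norm (x - c)) *\<^sub>R (x - c)"
      have u: "norm u = 1" using False by (simp add: u_def)
      have "x \<bullet> u \<le> c \<bullet> u + \<rho>" using * u hsup_ge[OF assms(1) x, of u] by force
      moreover have "(x - c) \<bullet> u = norm (x - c)"
        using False by (simp add: u_def dot_square_norm power2_eq_square)
      ultimately show ?thesis by (simp add: inner_diff_left dist_norm norm_minus_commute)
    qed (use assms in auto)
  qed
qed


section \<open>Bodies of constant width 1\<close>

lemma cwD:
  assumes "constant_width_one K"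
  shows "compact K" "convex K" "K \<noteq> {}"
  using assms unfolding constant_width_one_def convex_body_def by auto

lemma cw_hsup:
  assumes "constant_width_one K" "norm u = 1"
  shows "hsup K u + hsup K (- u) = 1"
  using assms width_eq_hsup cwD[OF assms(1)] unfolding constant_width_one_def by metis

text \<open>Nonempty interior is automatic: a convex set without interior lies in a line, and the
  normal of that line would be a direction of width 0.\<close>

lemma cwI:
  assumes "compact K" "convex K" "K \<noteq> {}"
    and "\<And>u. norm u = 1 \<Longrightarrow> hsup K u + hsup K (- u) = 1"
  shows "constant_width_one K"
proof -
  have "interior K \<noteq> {}"
  proof
    assume "interior K = {}"
    then obtain a b where ab: "a \<noteq> 0" "K \<subseteq> {x. a \<bullet> x = b}"
      using empty_interior_subset_hyperplane[OF assms(2)] by metis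
    define u where "u = (1 / norm a) *\<^sub>R a"
    have u: "norm u = 1" using ab by (simp add: u_def)
    have "hsup K u \<le> b / norm a" "hsup K (- u) \<le> - b / norm a"
      unfolding hsup_le_iff[OF assms(1,3)] using ab(2)
      by (auto simp: u_def inner_commute)
    then show False using assms(4)[OF u] by simp
  qed
  then show ?thesis
    using assms width_eq_hsup[OF assms(1,3)] unfolding constant_width_one_def convex_body_def by simp
qed

lemma cw_diam:
  assumes "constant_width_one K" "x \<in> K" "y \<in> K"
  shows "dist x y \<le> 1"
proof (cases "x = y")
  case False
  define u where "u = (1 / norm (x - y)) *\<^sub>R (x - y)"
  have u: "norm u = 1" using False by (simp add: u_def)
  have "x \<bullet> u + y \<bullet> (- u) \<le> 1"
    using cw_hsup[OF assms(1) u] hsup_ge[OF cwD(1)[OF assms(1)]] assms(2,3) by (metis add_mono)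
  moreover have "(x - y) \<bullet> u = norm (x - y)"
    using False by (simp add: u_def dot_square_norm power2_eq_square)
  ultimately show ?thesis by (simp add: inner_diff_left dist_norm)
qed simp

text \<open>Equality case of Cauchy-Schwarz. It converts tight width estimates into equalities of
  points.\<close>

lemma norm_le_1_inner_eq_1:
  assumes "norm (x::'a::real_inner) \<le> 1" "norm u = 1" "x \<bullet> u \<ge> 1"
  shows "x = u"
proof -
  have "(norm (x - u))\<^sup>2 = (norm x)\<^sup>2 + 1 - 2 * (x \<bullet> u)"
    using assms(2) by (simp add: power2_norm_eq_inner inner_diff inner_commute norm_eq_1)
  moreover have "(norm x)\<^sup>2 \<le> 1" using assms(1) by (simp add: power_le_one)
  ultimately have "(norm (x - u))\<^sup>2 \<le> 0" using assms(3) by linarith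
  then show ?thesis by simp
qed

text \<open>Contact points on two parallel supporting lines differ by a vector of norm at most 1
  whose component along \<open>u\<close> is 1, so the difference is \<open>u\<close> itself.\<close>

lemma cw_antipode:
  assumes K: "constant_width_one K" and u: "norm u = 1" and x: "x \<in> K" "x \<bullet> u = hsup K u"
  shows "x - u \<in> K" "(x - u) \<bullet> (- u) = hsup K (- u)"
proof -
  obtain z where z: "z \<in> K" "z \<bullet> (- u) = hsup K (- u)"
    using hsup_attained[OF cwD(1)[OF K] cwD(3)[OF K], of "- u"] by blast
  have "(x - z) \<bullet> u = 1"
    unfolding inner_diff_left using cw_hsup[OF K u] x(2) z(2) unfolding inner_minus_right by linarith
  then have "x - z = u"
    using cw_diam[OF K x(1) z(1)] u by (rule_tac norm_le_1_inner_eq_1) (simp_all add: dist_norm)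
  then have "x - u = z" by (simp add: algebra_simps)
  then show "x - u \<in> K" "(x - u) \<bullet> (- u) = hsup K (- u)" using z by auto
qed

text \<open>Strict convexity: every point of the face is the unit step \<open>u\<close> away from
  the antipode of \<open>x\<close>.\<close>

lemma cw_face_unique:
  assumes K: "constant_width_one K" and u: "norm u = 1"
    and x: "x \<in> K" "x \<bullet> u = hsup K u" and y: "y \<in> K" "y \<bullet> u = hsup K u"
  shows "x = y"
proof -
  note a = cw_antipode[OF K u x]
  have "(y - (x - u)) \<bullet> u = 1"
    unfolding inner_diff_left[of y] using cw_hsup[OF K u] a(2) y(2) unfolding inner_minus_right by linarith
  then have "y - (x - u) = u"
    using cw_diam[OF K y(1) a(1)] u by (rule_tac norm_le_1_inner_eq_1) (simp_all add: dist_norm)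
  then show ?thesis by (simp add: algebra_simps)
qed

lemma cw_frontier_iff:
  assumes K: "constant_width_one K"
  shows "x \<in> frontier K \<longleftrightarrow> x \<in> K \<and> (\<exists>u. norm u = 1 \<and> x \<bullet> u = hsup K u)"
proof (intro iffI conjI)
  note c = cwD[OF K]
  assume x: "x \<in> frontier K"
  then show xK: "x \<in> K" using c(1) compact_imp_closed frontier_subset_closed by blast
  have ne: "interior K \<noteq> {}" using K unfolding constant_width_one_def convex_body_def by blast
  have "x \<notin> rel_interior K" using x ne rel_interior_nonempty_interior by (auto simp: frontier_def)
  then obtain a where a: "a \<noteq> 0" "\<And>y. y \<in> closure K \<Longrightarrow> a \<bullet> x \<le> a \<bullet> y"
    using supporting_hyperplane_relative_frontier[OF c(2)] xK closure_subset by (metis subsetD)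
  define u where "u = (- 1 / norm a) *\<^sub>R a"
  have u: "norm u = 1" using a by (simp add: u_def)
  have "y \<bullet> u \<le> x \<bullet> u" if "y \<in> K" for y
    using a(2)[of y] that closure_subset[of K] a(1)
    by (auto simp: u_def inner_commute divide_le_cancel)
  then have "x \<bullet> u = hsup K u" using hsup_eqI[OF c(1) xK] by simp
  then show "\<exists>u. norm u = 1 \<and> x \<bullet> u = hsup K u" using u by blast
next
  note c = cwD[OF K]
  assume "x \<in> K \<and> (\<exists>u. norm u = 1 \<and> x \<bullet> u = hsup K u)"
  then obtain u where x: "x \<in> K" and u: "norm u = 1" "x \<bullet> u = hsup K u" by blast
  have "x \<notin> interior K"
  proof
    assume "x \<in> interior K"
    then obtain e where e: "e > 0" "cball x e \<subseteq> K" using mem_interior_cball by blast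
    then show False using cball_subset_iff_hsup[OF c, of e x] u by force
  qed
  then show "x \<in> frontier K" using x closure_subset by (auto simp: frontier_def)
qed

text \<open>The identity \<open>hsup K u + hsup K (- u) = 1\<close> turns a lower bound at
  \<open>u\<close> into an upper bound at \<open>- u\<close>. This is why incircle and outercircle
  are concentric with radii adding up to 1.\<close>

lemma cw_cball_dual:
  assumes K: "constant_width_one K" and "0 \<le> \<rho>" "\<rho> \<le> 1"
  shows "cball c \<rho> \<subseteq> K \<longleftrightarrow> K \<subseteq> cball c (1 - \<rho>)"
proof -
  note c = cwD[OF K]
  have *: "c \<bullet> u + \<rho> \<le> hsup K u \<longleftrightarrow> hsup K (- u) \<le> c \<bullet> (- u) + (1 - \<rho>)" if "norm u = 1" for u
    using cw_hsup[OF K that] by (simp add: inner_minus_right) linarith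
  have "(\<forall>u. norm u = 1 \<longrightarrow> c \<bullet> u + \<rho> \<le> hsup K u) \<longleftrightarrow>
        (\<forall>u. norm u = 1 \<longrightarrow> hsup K u \<le> c \<bullet> u + (1 - \<rho>))" (is "?A \<longleftrightarrow> ?B")
  proof
    assume A: ?A
    show ?B
    proof (intro allI impI)
      fix u :: "real^2" assume "norm u = 1"
      then show "hsup K u \<le> c \<bullet> u + (1 - \<rho>)" using A[rule_format, of "- u"] *[of "- u"] by simp
    qed
  next
    assume B: ?B
    show ?A
    proof (intro allI impI)
      fix u :: "real^2" assume "norm u = 1"
      then show "c \<bullet> u + \<rho> \<le> hsup K u" using B[rule_format, of "- u"] *[of u] by simp
    qed
  qed
  then show ?thesis
    unfolding cball_subset_iff_hsup[OF c assms(2)]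
    using subset_cball_iff_hsup[OF c(1,3), of "1 - \<rho>" c] assms(3) by simp
qed

lemma cw_cball_radius_le:
  assumes K: "constant_width_one K" and "cball c \<rho> \<subseteq> K"
  shows "\<rho> \<le> 1 / 2"
proof (rule ccontr)
  assume "\<not> \<rho> \<le> 1 / 2"
  then have \<rho>: "0 \<le> \<rho>" by simp
  define u :: "real^2" where "u = unit_dir 0"
  have "c \<bullet> u + \<rho> \<le> hsup K u" "c \<bullet> (- u) + \<rho> \<le> hsup K (- u)"
    using assms(2)[unfolded cball_subset_iff_hsup[OF cwD[OF K] \<rho>]] by (simp_all only: u_def norm_unit_dir norm_minus_cancel)
  then show False using cw_hsup[OF K, of u] \<open>\<not> \<rho> \<le> 1 / 2\<close> by (simp add: u_def)
qed

lemma inradius_eqI: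
  assumes "is_incircle K c \<rho>"
  shows "inradius K = \<rho>"
  unfolding inradius_def using assms unfolding is_incircle_def
  by (intro cSup_eq_maximum) auto

lemma cw_incircle_exists:
  assumes K: "constant_width_one K"
  obtains c where "is_incircle K c (inradius K)"
proof -
  note k = cwD[OF K]
  \<comment> \<open>Inscribed disks as pairs of centre and radius. The cut-off at radius 1 makes the
    set compact and loses nothing, since no inscribed disk has radius above 1/2.\<close>
  define A where "A = (K \<times> {0..1}) \<inter> (\<Inter>u\<in>sphere 0 1. {z. fst z \<bullet> u + snd z \<le> hsup K u})"
  have "closed (\<Inter>u\<in>sphere 0 1. {z::(real^2)\<times>real. fst z \<bullet> u + snd z \<le> hsup K u})"
    by (intro closed_INT ballI closed_Collect_le continuous_intros)
  then have "compact A"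
    unfolding A_def by (intro compact_Int_closed compact_Times k) auto
  have memA: "(c, \<rho>) \<in> A \<longleftrightarrow> 0 \<le> \<rho> \<and> cball c \<rho> \<subseteq> K" for c \<rho>
  proof
    assume "(c, \<rho>) \<in> A"
    then show "0 \<le> \<rho> \<and> cball c \<rho> \<subseteq> K"
      using cball_subset_iff_hsup[OF k, of \<rho> c] by (auto simp: A_def)
  next
    assume *: "0 \<le> \<rho> \<and> cball c \<rho> \<subseteq> K"
    then have "\<rho> \<le> 1" "c \<in> K" using cw_cball_radius_le[OF K, of c \<rho>] by auto
    then show "(c, \<rho>) \<in> A" using cball_subset_iff_hsup[OF k, of \<rho> c] * by (auto simp: A_def)
  qed
  obtain x where "x \<in> K" using k by blast
  then have "(x, 0) \<in> A" using memA by auto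
  then obtain z where z: "z \<in> A" "\<forall>w\<in>A. snd w \<le> snd z"
    using continuous_attains_sup[OF \<open>compact A\<close>, of snd] continuous_on_snd[OF continuous_on_id] by blast
  obtain c \<rho> where zz: "z = (c, \<rho>)" by (cases z)
  have "is_incircle K c \<rho>" unfolding is_incircle_def
  proof (intro conjI allI impI)
    show "0 \<le> \<rho>" "cball c \<rho> \<subseteq> K" using z memA zz by auto
    fix c' \<rho>' assume "cball c' \<rho>' \<subseteq> K"
    then show "\<rho>' \<le> \<rho>" using z(2) memA[of c' \<rho>'] \<open>0 \<le> \<rho>\<close> zz by (cases "0 \<le> \<rho>'") auto
  qed
  then show thesis using that inradius_eqI by blast
qed


section \<open>Rigid motions\<close>

lemma rigid_motion_dist:
  assumes "rigid_motion f"
  shows "dist (f x) (f y) = dist x y"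
proof -
  obtain A b where A: "rotation_matrix A" "f = (\<lambda>x. A *v x + b)"
    using assms unfolding rigid_motion_def by blast
  have "orthogonal_transformation ((*v) A)"
    using A(1) unfolding rotation_matrix_def orthogonal_transformation_matrix by auto
  then have "norm (A *v (x - y)) = norm (x - y)" by (simp add: orthogonal_transformation_norm)
  then show ?thesis by (simp add: A(2) dist_norm matrix_vector_mult_diff_distrib)
qed

lemma rigid_motion_compose:
  assumes "rigid_motion f" "rigid_motion g"
  shows "rigid_motion (f \<circ> g)"
proof -
  obtain A b where A: "rotation_matrix A" "f = (\<lambda>x. A *v x + b)"
    using assms unfolding rigid_motion_def by blast
  obtain B c where B: "rotation_matrix B" "g = (\<lambda>x. B *v x + c)"
    using assms unfolding rigid_motion_def by blast
  have "rotation_matrix (A ** B)"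
    using A(1) B(1) by (simp add: rotation_matrix_def orthogonal_matrix_mul det_mul)
  moreover have "f \<circ> g = (\<lambda>x. (A ** B) *v x + (A *v c + b))"
    by (simp add: A B fun_eq_iff matrix_vector_right_distrib matrix_vector_mul_assoc)
  ultimately show ?thesis unfolding rigid_motion_def by blast
qed

lemma rigid_motion_inverse:
  assumes "rigid_motion f"
  obtains g where "rigid_motion g" "\<And>x. g (f x) = x" "\<And>x. f (g x) = x"
proof -
  obtain A b where A: "rotation_matrix A" "f = (\<lambda>x. A *v x + b)"
    using assms unfolding rigid_motion_def by blast
  have o: "transpose A ** A = mat 1" "A ** transpose A = mat 1"
    using A(1) by (auto simp: rotation_matrix_def orthogonal_matrix_def)
  have r: "rotation_matrix (transpose A)"
    using A(1) by (simp add: rotation_matrix_def orthogonal_matrix_transpose)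
  define g where "g = (\<lambda>x. transpose A *v x + - (transpose A *v b))"
  have "rigid_motion g" using r unfolding rigid_motion_def g_def by blast
  moreover have "g (f x) = x" for x
    by (simp add: g_def A(2) matrix_vector_right_distrib matrix_vector_mul_assoc o del: transpose_matrix_vector)
  moreover have "f (g x) = x" for x
    by (simp add: g_def A(2) matrix_vector_mult_diff_distrib matrix_vector_mul_assoc o del: transpose_matrix_vector)
  ultimately show thesis using that by blast
qed

lemma rigid_motion_left_inverse:
  assumes "rigid_motion f"
  shows "\<exists>g. rigid_motion g \<and> (\<forall>x. g (f x) = x)"
proof (rule rigid_motion_inverse[OF assms])
  fix g assume "rigid_motion g" "\<And>x. g (f x) = x"
  then show ?thesis by blast
qed

lemma rigid_motion_translation: "rigid_motion (\<lambda>x. x + a)"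
  unfolding rigid_motion_def
  by (intro exI[of _ "mat 1"] exI[of _ a])
    (simp add: rotation_matrix_def orthogonal_matrix_id)

definition rot :: "real \<Rightarrow> real^2 \<Rightarrow> real^2" where
  "rot t x = vector [cos t * x $ 1 - sin t * x $ 2, sin t * x $ 1 + cos t * x $ 2]"

lemma rot_nth [simp]:
  "rot t x $ 1 = cos t * x $ 1 - sin t * x $ 2" "rot t x $ 2 = sin t * x $ 1 + cos t * x $ 2"
  by (simp_all add: rot_def)

lemma rot_unit_dir [simp]: "rot t (unit_dir s) = unit_dir (s + t)"
  by (rule vec2_eqI) (auto simp: cos_add sin_add algebra_simps)

lemma rot_linear [simp]: "rot t (x + y) = rot t x + rot t y" "rot t (c *\<^sub>R x) = c *\<^sub>R rot t x"
  "rot t (x - y) = rot t x - rot t y"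
  by (rule vec2_eqI; simp add: algebra_simps)+

lemma rigid_motion_rot: "rigid_motion (\<lambda>x. rot t x + b)"
proof -
  define A :: "real^2^2" where "A = vector [vector [cos t, - sin t], vector [sin t, cos t]]"
  have "rotation_matrix A"
    using sin_cos_squared_add3[of t]
    by (simp add: rotation_matrix_def orthogonal_matrix A_def det_2 vec_eq_iff forall_2
        matrix_matrix_mult_def sum_2 transpose_def mat_def algebra_simps)
  moreover have "A *v x = rot t x" for x
    by (rule vec2_eqI) (auto simp: A_def matrix_vector_mult_def sum_2)
  ultimately show ?thesis unfolding rigid_motion_def by metis
qed

lemma rigid_motion_convex_hull:
  assumes "rigid_motion f"
  shows "f ` (convex hull S) = convex hull (f ` S)"
proof -
  obtain A b where A: "rotation_matrix A" "f = (\<lambda>x. A *v x + b)"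
    using assms unfolding rigid_motion_def by blast
  have "f ` (convex hull S) = (+) b ` ((*v) A ` (convex hull S))"
    by (auto simp: A(2) image_image add.commute)
  also have "\<dots> = convex hull ((+) b ` ((*v) A ` S))"
    by (simp add: convex_hull_linear_image convex_hull_translation)
  also have "\<dots> = convex hull (f ` S)"
    by (simp add: A(2) image_image add.commute)
  finally show ?thesis .
qed

text \<open>The matrix \<open>A\<close> acts on support functions through
  \<open>transpose A\<close>, which sends opposite unit vectors to opposite unit vectors; the
  contributions of the translation cancel in the sum.\<close>

lemma rigid_motion_cw:
  assumes f: "rigid_motion f" and K: "constant_width_one K"
  shows "constant_width_one (f ` K)"
proof -
  obtain A b where A: "rotation_matrix A" "f = (\<lambda>x. A *v x + b)"
    using f unfolding rigid_motion_def by blast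
  note k = cwD[OF K]
  have cont: "continuous_on K f" unfolding A(2)
    by (intro continuous_intros linear_continuous_on matrix_vector_mul_bounded_linear)
  have comp: "compact (f ` K)" using compact_continuous_image[OF cont k(1)] .
  have "convex (f ` K)"
    using rigid_motion_convex_hull[OF f, of K] k(2) by (metis convex_convex_hull convex_hull_eq)
  moreover have h: "hsup (f ` K) u = hsup K (transpose A *v u) + b \<bullet> u" for u
  proof -
    have e: "f x \<bullet> u = x \<bullet> (transpose A *v u) + b \<bullet> u" for x
      by (simp add: A(2) inner_add_left dot_lmul_matrix[symmetric] del: transpose_matrix_vector)
    obtain x where x: "x \<in> K" "x \<bullet> (transpose A *v u) = hsup K (transpose A *v u)"
      using hsup_attained[OF k(1,3)] by blast
    have "hsup (f ` K) u = f x \<bullet> u"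
      using x hsup_ge[OF k(1)] by (intro hsup_eqI[OF comp]) (auto simp: e)
    then show ?thesis using e x by simp
  qed
  have "hsup (f ` K) u + hsup (f ` K) (- u) = 1" if "norm u = 1" for u
  proof -
    have "orthogonal_transformation ((*v) (transpose A))"
      using A(1) unfolding rotation_matrix_def orthogonal_transformation_matrix
      by (auto simp: orthogonal_matrix_transpose)
    then have "norm (transpose A *v u) = 1"
      using that by (simp add: orthogonal_transformation_norm del: transpose_matrix_vector)
    moreover have "transpose A *v (- u) = - (transpose A *v u)"
      using matrix_vector_mult_diff_distrib[of "transpose A" 0 u] by simp
    ultimately show ?thesis using cw_hsup[OF K] by (simp add: h)
  qed
  ultimately show ?thesis using cwI[OF comp] k(3) by blast
qed

lemma rigid_motion_cball:
  assumes f: "rigid_motion f"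
  shows "f ` cball c \<rho> = cball (f c) \<rho>"
proof -
  obtain g where g: "rigid_motion g" "\<And>x. g (f x) = x" "\<And>x. f (g x) = x"
    using rigid_motion_inverse[OF f] by blast
  have "x \<in> f ` cball c \<rho>" if "x \<in> cball (f c) \<rho>" for x
  proof
    show "x = f (g x)" using g by simp
    show "g x \<in> cball c \<rho>" using that rigid_motion_dist[OF g(1), of "f c" x] g by simp
  qed
  then show ?thesis using rigid_motion_dist[OF f] by auto
qed

section \<open>Translations of incircles and areas\<close>

lemma translation_incircle:
  assumes "is_incircle K c \<rho>"
  shows "is_incircle ((\<lambda>x. x + a) ` K) (c + a) \<rho>"
  unfolding is_incircle_def
proof (intro conjI allI impI)
  have "(\<lambda>x. x + a) ` cball c \<rho> = cball (c + a) \<rho>"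
    using rigid_motion_cball[OF rigid_motion_translation] by blast
  then show "0 \<le> \<rho>" "cball (c + a) \<rho> \<subseteq> (\<lambda>x. x + a) ` K"
    using assms image_mono[of "cball c \<rho>" K "\<lambda>x. x + a"] unfolding is_incircle_def by auto
next
  fix c' \<rho>' assume "cball c' \<rho>' \<subseteq> (\<lambda>x. x + a) ` K"
  then have "(\<lambda>x. x + - a) ` cball c' \<rho>' \<subseteq> (\<lambda>x. x + - a) ` (\<lambda>x. x + a) ` K"
    by (rule image_mono)
  then have "cball (c' + - a) \<rho>' \<subseteq> K"
    using rigid_motion_cball[OF rigid_motion_translation, of "- a" c' \<rho>'] by (simp add: image_image)
  then show "\<rho>' \<le> \<rho>" using assms unfolding is_incircle_def by blast
qed

lemma translation_cw_bodies:
  assumes "K \<in> cw_bodies r"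
  shows "(\<lambda>x. x + a) ` K \<in> cw_bodies r"
    "measure lebesgue ((\<lambda>x. x + a) ` K) = measure lebesgue K"
proof -
  have K: "constant_width_one K" "inradius K = r" using assms by (auto simp: cw_bodies_def)
  obtain c where "is_incircle K c r" using cw_incircle_exists[OF K(1)] K(2) by blast
  then have "inradius ((\<lambda>x. x + a) ` K) = r" by (rule inradius_eqI[OF translation_incircle])
  then show "(\<lambda>x. x + a) ` K \<in> cw_bodies r"
    using rigid_motion_cw[OF rigid_motion_translation K(1)] by (simp add: cw_bodies_def)
  show "measure lebesgue ((\<lambda>x. x + a) ` K) = measure lebesgue K"
    using measure_translation[of a K] by (simp add: add.commute)
qed


section \<open>Hausdorff closeness\<close>

text \<open>A form of "Hausdorff distance at most \<open>e\<close>" in which near points are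
  required to exist. Without suprema it passes easily through images, convex hulls and the triangle
  inequality.\<close>

definition hclose :: "real \<Rightarrow> 'a::metric_space set \<Rightarrow> 'a set \<Rightarrow> bool" where
  "hclose e A B \<longleftrightarrow> (\<forall>x\<in>A. \<exists>y\<in>B. dist x y \<le> e) \<and> (\<forall>y\<in>B. \<exists>x\<in>A. dist x y \<le> e)"

lemma hclose_sym: "hclose e A B \<Longrightarrow> hclose e B A"
  unfolding hclose_def by (metis dist_commute)

lemma hclose_trans: "hclose d A B \<Longrightarrow> hclose e B C \<Longrightarrow> hclose (d + e) A C"
  unfolding hclose_def by (meson add_mono dist_triangle order_trans)

lemma hclose_mono: "hclose d A B \<Longrightarrow> d \<le> e \<Longrightarrow> hclose e A B"
  unfolding hclose_def by (meson order_trans)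

lemma hclose_image:
  assumes "\<And>x y. dist (f x) (f y) = dist x y" "hclose e A B"
  shows "hclose e (f ` A) (f ` B)"
  using assms unfolding hclose_def by auto

lemma hclose_hausdorff_dist:
  assumes "A \<noteq> {}" "B \<noteq> {}" "hclose e A B"
  shows "hausdorff_dist A B \<le> e"
  unfolding hausdorff_dist_def
proof (rule max.boundedI)
  show "(SUP x\<in>A. infdist x B) \<le> e"
    using assms by (intro cSUP_least) (auto simp: hclose_def intro: infdist_le2)
  show "(SUP y\<in>B. infdist y A) \<le> e"
    using assms by (intro cSUP_least) (auto simp: hclose_def dist_commute intro: infdist_le2)
qed

text \<open>The \<open>e\<close>-neighbourhood of a convex hull is a Minkowski sum of convex sets,
  hence convex, so it contains the hull of \<open>A\<close> as soon as it contains
  \<open>A\<close>.\<close>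

lemma hclose_convex_hull:
  fixes A B :: "'a::euclidean_space set"
  assumes "hclose e A B"
  shows "hclose e (convex hull A) (convex hull B)"
proof -
  have *: "\<forall>x\<in>convex hull A. \<exists>y\<in>convex hull B. dist x y \<le> e"
    if AB: "\<forall>x\<in>A. \<exists>y\<in>B. dist x y \<le> e" for A B :: "'a set"
  proof -
    define N where "N = (\<Union>x\<in>convex hull B. \<Union>y\<in>cball 0 e. {x + y})"
    have "convex N" unfolding N_def by (intro convex_sums convex_convex_hull convex_cball)
    moreover have "A \<subseteq> N"
    proof
      fix x assume "x \<in> A"
      then obtain y where y: "y \<in> B" "dist x y \<le> e" using AB by blast
      then have "x = y + (x - y)" "y \<in> convex hull B" "x - y \<in> cball 0 e"
        by (auto simp: hull_inc dist_norm norm_minus_commute)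
      then show "x \<in> N" unfolding N_def by blast
    qed
    ultimately have "convex hull A \<subseteq> N" by (simp add: hull_minimal)
    moreover have "\<exists>y\<in>convex hull B. dist x y \<le> e" if "x \<in> N" for x
      using that by (force simp: N_def dist_norm)
    ultimately show ?thesis by blast
  qed
  show ?thesis unfolding hclose_def
  proof (intro conjI)
    show "\<forall>x\<in>convex hull A. \<exists>y\<in>convex hull B. dist x y \<le> e"
      using * assms by (auto simp: hclose_def)
    have "\<forall>x\<in>convex hull B. \<exists>y\<in>convex hull A. dist x y \<le> e"
      using * assms by (auto simp: hclose_def dist_commute)
    then show "\<forall>y\<in>convex hull B. \<exists>x\<in>convex hull A. dist x y \<le> e" by (simp add: dist_commute)
  qed
qed

lemma hclose_hsup:
  assumes "compact K" "K \<noteq> {}" "compact L" "L \<noteq> {}" "hclose e K L" "norm u = 1"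
  shows "\<bar>hsup K u - hsup L u\<bar> \<le> e"
proof -
  have *: "hsup A u \<le> hsup B u + e"
    if A: "compact A" "A \<noteq> {}" and B: "compact B" and AB: "hclose e A B" for A B
    unfolding hsup_le_iff[OF A]
  proof
    fix x assume "x \<in> A"
    then obtain y where y: "y \<in> B" "dist x y \<le> e" using AB by (auto simp: hclose_def)
    have "(x - y) \<bullet> u \<le> norm (x - y)" using norm_cauchy_schwarz[of "x - y" u] assms(6) by simp
    then show "x \<bullet> u \<le> hsup B u + e"
      using hsup_ge[OF B y(1), of u] y(2) by (simp add: inner_diff_left dist_norm)
  qed
  show ?thesis using *[of K L] *[of L K] assms hclose_sym by fastforce
qed

lemma hclose_inradius:
  assumes K: "constant_width_one K" and L: "constant_width_one L" and "hclose e K L"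
  shows "\<bar>inradius K - inradius L\<bar> \<le> e"
proof -
  have *: "inradius A \<le> inradius B + e"
    if A: "constant_width_one A" and B: "constant_width_one B" and c: "hclose e A B" for A B
  proof -
    obtain p where p: "is_incircle A p (inradius A)" using cw_incircle_exists[OF A] by blast
    obtain q where q: "is_incircle B q (inradius B)" using cw_incircle_exists[OF B] by blast
    \<comment> \<open>The incircle shrunk by \<open>e\<close> still fits below the other support
      function. If \<open>e\<close> exceeds its radius, the claim holds because inradii are
      nonnegative.\<close>
    show ?thesis
    proof (cases "inradius A - e \<ge> 0")
      case True
      have "p \<bullet> u + inradius A \<le> hsup A u" if "norm u = 1" for u
        using p cball_subset_iff_hsup[OF cwD[OF A], of "inradius A" p] that
        unfolding is_incircle_def by blast
      then have "p \<bullet> u + (inradius A - e) \<le> hsup B u" if "norm u = 1" for u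
        using hclose_hsup[OF cwD(1,3)[OF A] cwD(1,3)[OF B] c that] that by fastforce
      then have "cball p (inradius A - e) \<subseteq> B"
        using cball_subset_iff_hsup[OF cwD[OF B] True] by blast
      then show ?thesis using q unfolding is_incircle_def by force
    next
      case False
      then show ?thesis using q unfolding is_incircle_def by simp
    qed
  qed
  show ?thesis using *[OF K L assms(3)] *[OF L K hclose_sym[OF assms(3)]] by linarith
qed

text \<open>If \<open>L\<close> contains a ball of radius \<rho> about \<open>c\<close>, then its
  \<open>e\<close>-neighbourhood lies in the dilation of \<open>L\<close> about \<open>c\<close> by
  the factor \<open>1 + e / \<rho>\<close>, and dilations scale the measure.\<close>

lemma measure_le_of_neighbourhood:
  fixes K L :: "'a::euclidean_space set"
  assumes K: "compact K" and L: "compact L" "convex L" and c: "cball c \<rho> \<subseteq> L" "0 < \<rho>" and e: "0 \<le> e"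
    and *: "\<forall>x\<in>K. \<exists>y\<in>L. dist x y \<le> e"
  shows "measure lebesgue K \<le> (1 + e / \<rho>) ^ DIM('a) * measure lebesgue L"
proof -
  define s where "s = 1 + e / \<rho>"
  have s: "s \<ge> 1" using c e by (simp add: s_def)
  define T where "T = (\<lambda>x. s *\<^sub>R x + (1 - s) *\<^sub>R c) ` L"
  have "K \<subseteq> T"
  proof
    fix x assume "x \<in> K"
    then obtain y where y: "y \<in> L" "dist x y \<le> e" using * by blast
    show "x \<in> T"
    proof (cases "e = 0")
      case True
      then have "x = y" using y by simp
      then show ?thesis using y True by (auto simp: T_def s_def)
    next
      case False
      then have e0: "e > 0" using e by simp
      \<comment> \<open>The displacement \<open>x - y\<close>, rescaled to length at most \<rho>,
        stays in the inscribed ball. Combining \<open>y\<close> and \<open>w\<close> with weights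
        proportional to \<rho> and \<open>e\<close> gives the preimage \<open>z\<close> of
        \<open>x\<close> under the dilation.\<close>
      define w where "w = c + (\<rho> / e) *\<^sub>R (x - y)"
      have "norm ((\<rho> / e) *\<^sub>R (x - y)) = \<rho> / e * norm (x - y)"
        unfolding norm_scaleR using e0 c by simp
      also have "\<dots> \<le> \<rho> / e * e" using y(2) e0 c by (intro mult_left_mono) (auto simp: dist_norm)
      finally have "norm ((\<rho> / e) *\<^sub>R (x - y)) \<le> \<rho>" using e0 by simp
      then have "w \<in> L" using c by (auto simp: w_def dist_norm)
      define z where "z = (1 / s) *\<^sub>R y + (1 - 1 / s) *\<^sub>R w"
      have "z \<in> L" unfolding z_def
        using s L(2) \<open>w \<in> L\<close> y(1) convexD_alt[of L y w "1 - 1 / s"] by simp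
      moreover have "x = s *\<^sub>R z + (1 - s) *\<^sub>R c"
      proof -
        have "s *\<^sub>R z = y + (s - 1) *\<^sub>R w"
          using s by (simp add: z_def scaleR_right_distrib right_diff_distrib)
        also have "\<dots> = y + (s - 1) *\<^sub>R c + (x - y)"
          using e0 c by (simp add: w_def s_def scaleR_right_distrib)
        finally show ?thesis by (simp add: algebra_simps)
      qed
      ultimately show ?thesis by (auto simp: T_def)
    qed
  qed
  moreover have "compact T" unfolding T_def
    by (intro compact_continuous_image L continuous_intros)
  ultimately have "measure lebesgue K \<le> measure lebesgue T"
    using K by (intro measure_mono_fmeasurable) (auto simp: lmeasurable_compact fmeasurableD)
  also have "\<dots> = \<bar>s\<bar> ^ DIM('a) * measure lebesgue L"
    unfolding T_def by (rule measure_lebesgue_affine)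
  finally show ?thesis using s by (simp add: s_def)
qed

text \<open>A body of diameter at most 1 has at most the area of a unit disk, which makes the
  estimate uniform over all bodies of inradius at least \<rho>.\<close>

lemma hclose_measure:
  assumes K: "constant_width_one K" "\<rho> \<le> inradius K" and L: "constant_width_one L" "\<rho> \<le> inradius L"
    and "0 < \<rho>" "0 \<le> e" "hclose e K L"
  shows "\<bar>measure lebesgue K - measure lebesgue L\<bar> \<le> ((1 + e / \<rho>)\<^sup>2 - 1) * measure lebesgue (cball (0::real^2) 1)"
proof -
  have *: "measure lebesgue A \<le> measure lebesgue B + ((1 + e / \<rho>)\<^sup>2 - 1) * measure lebesgue (cball (0::real^2) 1)"
    if A: "constant_width_one A" and B: "constant_width_one B" "\<rho> \<le> inradius B" and c: "hclose e A B" for A B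
  proof -
    obtain p where p: "is_incircle B p (inradius B)" using cw_incircle_exists[OF B(1)] by blast
    then have "cball p \<rho> \<subseteq> B"
      unfolding is_incircle_def using B(2) subset_cball[of \<rho> "inradius B" p] by blast
    then have 1: "measure lebesgue A \<le> (1 + e / \<rho>)\<^sup>2 * measure lebesgue B"
      using measure_le_of_neighbourhood[OF cwD(1)[OF A] cwD(1,2)[OF B(1)] _ assms(5,6)] c
      by (simp add: hclose_def)
    obtain x where x: "x \<in> B" using cwD[OF B(1)] by blast
    then have "B \<subseteq> cball x 1" using cw_diam[OF B(1)] by auto
    then have "measure lebesgue B \<le> measure lebesgue (cball x 1)"
      using cwD[OF B(1)] by (intro measure_mono_fmeasurable) (auto simp: lmeasurable_compact fmeasurableD)
    also have "cball x 1 = (+) x ` cball 0 1" by simp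
    also have "measure lebesgue \<dots> = measure lebesgue (cball (0::real^2) 1)" by (rule measure_translation)
    finally have "((1 + e / \<rho>)\<^sup>2 - 1) * measure lebesgue B \<le> ((1 + e / \<rho>)\<^sup>2 - 1) * measure lebesgue (cball (0::real^2) 1)"
      using assms(5,6) by (intro mult_left_mono) auto
    then show ?thesis using 1 by (simp add: algebra_simps)
  qed
  show ?thesis using *[OF K(1) L assms(7)] *[OF L(1) K hclose_sym[OF assms(7)]] by linarith
qed

text \<open>Blaschke selection; the limit body is the zero set of the limit of the distance functions.\<close>

lemma cw_selection:
  assumes F: "\<And>n::nat. constant_width_one (F n)" "\<And>n. F n \<subseteq> cball 0 1"
  obtains k K where "strict_mono (k :: nat \<Rightarrow> nat)" "constant_width_one K"
    "\<And>e. 0 < e \<Longrightarrow> \<exists>N. \<forall>n\<ge>N. hclose e (F (k n)) K"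
proof -
  define S :: "(real^2) set" where "S = cball 0 1"
  have S: "compact S" "convex S" by (auto simp: S_def)
  note c = cwD[OF F(1)]
  have bound: "norm (infdist x (F n)) \<le> 2" if "x \<in> S" for n x
  proof -
    obtain y where y: "y \<in> F n" using c(3) by blast
    then have "infdist x (F n) \<le> dist x y" by (rule infdist_le)
    moreover have "norm y \<le> 1" using F(2)[of n] y by auto
    moreover have "dist x y \<le> norm x + norm y" using norm_triangle_ineq4 by (simp add: dist_norm)
    ultimately show ?thesis using that by (simp add: S_def infdist_nonneg)
  qed
  \<comment> \<open>Distance functions are 1-Lipschitz, so \<open>d = e\<close> serves the whole
    family at once.\<close>
  have equi: "\<exists>d. 0 < d \<and> (\<forall>n y. y \<in> S \<and> norm (x - y) < d \<longrightarrow> norm (infdist x (F n) - infdist y (F n)) < e)"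
    if "x \<in> S" "0 < e" for x e
  proof (intro exI conjI allI impI)
    fix n y assume y: "y \<in> S \<and> norm (x - y) < e"
    have "infdist x (F n) \<le> infdist y (F n) + dist x y" "infdist y (F n) \<le> infdist x (F n) + dist y x"
      by (rule infdist_triangle)+
    then have "\<bar>infdist x (F n) - infdist y (F n)\<bar> \<le> dist x y" by (simp add: dist_commute)
    then show "norm (infdist x (F n) - infdist y (F n)) < e" using y by (simp add: dist_norm)
  qed (use that in auto)
  have "\<exists>g k. continuous_on S g \<and> strict_mono (k :: nat \<Rightarrow> nat) \<and>
      (\<forall>e>0. \<exists>N. \<forall>n x. n \<ge> N \<and> x \<in> S \<longrightarrow> norm (infdist x (F (k n)) - g x) < e)"
  proof (rule Arzela_Ascoli[OF S(1) bound equi])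
    fix g and k :: "nat \<Rightarrow> nat"
    assume *: "continuous_on S g" "strict_mono k"
      "\<And>e. 0 < e \<Longrightarrow> \<exists>N. \<forall>n x. n \<ge> N \<and> x \<in> S \<longrightarrow> norm (infdist x (F (k n)) - g x) < e"
    show ?thesis by (intro exI[of _ g] exI[of _ k] conjI allI impI *)
  qed
  then obtain g and k :: "nat \<Rightarrow> nat" where gk: "continuous_on S g \<and> strict_mono k \<and>
      (\<forall>e>0. \<exists>N. \<forall>n x. n \<ge> N \<and> x \<in> S \<longrightarrow> norm (infdist x (F (k n)) - g x) < e)"
    by (elim exE) (erule that)
  then have g: "continuous_on S g" "strict_mono k" by simp_all
  have unif: "\<exists>N. \<forall>n x. n \<ge> N \<and> x \<in> S \<longrightarrow> norm (infdist x (F (k n)) - g x) < e" if "0 < e" for e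
    by (rule gk[THEN conjunct2, THEN conjunct2, THEN spec, THEN mp, OF that])
  define K where "K = {x \<in> S. g x \<le> 0}"
  have proj: "\<exists>y\<in>F n. infdist x (F n) = dist x y" for n x
    using infdist_attains_inf[OF compact_imp_closed[OF c(1)] c(3), of n x] by blast
  have "K = S \<inter> g -` {..0}" by (auto simp: K_def)
  moreover have "closed (S \<inter> g -` {..0})"
    by (rule continuous_closed_preimage[OF g(1) compact_imp_closed[OF S(1)] closed_atMost])
  ultimately have "closed K" by simp
  moreover have "S \<inter> K = K" by (auto simp: K_def)
  ultimately have "compact K" using compact_Int_closed[OF S(1), of K] by simp
  have "convex K"
  proof (rule convexI)
    fix x y and u v :: real assume a: "x \<in> K" "y \<in> K" "0 \<le> u" "0 \<le> v" "u + v = 1"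
    define z where "z = u *\<^sub>R x + v *\<^sub>R y"
    have z: "z \<in> S" using convexD[OF S(2)] a unfolding z_def K_def by blast
    \<comment> \<open>Distance to a convex set is a convex function; this is used for one member of
      the sequence that approximates \<open>g\<close> up to \<open>e / 2\<close>.\<close>
    have "g z \<le> 0 + e" if "e > 0" for e
    proof -
      obtain N where N: "\<And>n x. n \<ge> N \<Longrightarrow> x \<in> S \<Longrightarrow> norm (infdist x (F (k n)) - g x) < e / 2"
        using unif[of "e / 2"] \<open>e > 0\<close> by auto
      let ?F = "F (k N)"
      obtain p q where p: "p \<in> ?F" "infdist x ?F = dist x p" and q: "q \<in> ?F" "infdist y ?F = dist y q"
        using proj by meson
      have S': "x \<in> S" "y \<in> S" "g x \<le> 0" "g y \<le> 0" using a by (simp_all add: K_def)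
      have "infdist x ?F < e / 2" "infdist y ?F < e / 2"
        using N[OF order_refl S'(1)] N[OF order_refl S'(2)] S'(3,4) unfolding real_norm_def by linarith+
      then have d: "norm (x - p) \<le> e / 2" "norm (y - q) \<le> e / 2" using p q by (auto simp: dist_norm)
      have "u *\<^sub>R p + v *\<^sub>R q \<in> ?F" using convexD[OF c(2)] p q a by blast
      then have "infdist z ?F \<le> dist z (u *\<^sub>R p + v *\<^sub>R q)" by (rule infdist_le)
      also have "\<dots> = norm (u *\<^sub>R (x - p) + v *\<^sub>R (y - q))"
        by (simp add: z_def dist_norm algebra_simps)
      also have "\<dots> \<le> u * norm (x - p) + v * norm (y - q)"
        using norm_triangle_ineq[of "u *\<^sub>R (x - p)" "v *\<^sub>R (y - q)"] a by simp
      also have "\<dots> \<le> e / 2" using convex_bound_le[OF d] a by simp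
      finally show ?thesis using N[OF order_refl z] unfolding real_norm_def by linarith
    qed
    then have "g z \<le> 0" by (rule field_le_epsilon)
    then show "u *\<^sub>R x + v *\<^sub>R y \<in> K" using z unfolding K_def z_def by simp
  qed
  \<comment> \<open>The zero set is also large enough: the points of the bodies nearest to
    \<open>y\<close> have a cluster point, which lies in \<open>K\<close> and has distance
    \<open>g y\<close> from \<open>y\<close>.\<close>
  have near: "\<exists>x\<in>K. dist x y \<le> g y" if y: "y \<in> S" for y
  proof -
    define w where "w n = (SOME z. z \<in> F (k n) \<and> infdist y (F (k n)) = dist y z)" for n
    have w: "w n \<in> F (k n)" "infdist y (F (k n)) = dist y (w n)" for n
      using someI_ex[of "\<lambda>z. z \<in> F (k n) \<and> infdist y (F (k n)) = dist y z"] proj unfolding w_def by blast+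
    have wS: "\<forall>n. w n \<in> S" using w F(2) unfolding S_def by blast
    obtain z s where z: "z \<in> S" "strict_mono (s :: nat \<Rightarrow> nat)" "(w \<circ> s) \<longlonglongrightarrow> z"
      using seq_compactE[OF S(1)[unfolded compact_eq_seq_compact_metric] wS] by blast
    have uni: "(\<lambda>n. infdist (v n) (F (k n)) - g (v n)) \<longlonglongrightarrow> 0" if "\<And>n. v n \<in> S" for v
    proof (rule LIMSEQ_I)
      fix e :: real assume "0 < e"
      then obtain N where "\<forall>n x. n \<ge> N \<and> x \<in> S \<longrightarrow> norm (infdist x (F (k n)) - g x) < e"
        using unif by blast
      then show "\<exists>N. \<forall>n\<ge>N. norm (infdist (v n) (F (k n)) - g (v n) - 0) < e"
        using that by auto
    qed
    have "(\<lambda>n. g (w n)) \<longlonglongrightarrow> 0"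
      using tendsto_minus[OF uni[of w]] wS w(1) by simp
    then have "((\<lambda>n. g (w n)) \<circ> s) \<longlonglongrightarrow> 0" using z(2) by (rule LIMSEQ_subseq_LIMSEQ)
    moreover have "(\<lambda>n. g ((w \<circ> s) n)) \<longlonglongrightarrow> g z"
      by (rule continuous_on_tendsto_compose[OF g(1) z(3,1)]) (use wS in auto)
    ultimately have "g z = 0" using LIMSEQ_unique by (fastforce simp: o_def)
    moreover have "(\<lambda>n. dist y (w n)) \<longlonglongrightarrow> g y"
      using LIM_zero_cancel[OF uni[of "\<lambda>_. y"]] y w(2) by simp
    then have "((\<lambda>n. dist y (w n)) \<circ> s) \<longlonglongrightarrow> g y" using z(2) by (rule LIMSEQ_subseq_LIMSEQ)
    moreover have "(\<lambda>n. dist y ((w \<circ> s) n)) \<longlonglongrightarrow> dist y z"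
      using tendsto_dist[OF tendsto_const z(3)] .
    ultimately have "dist y z = g y" "z \<in> K"
      using LIMSEQ_unique z(1) by (fastforce simp: o_def K_def)+
    then show ?thesis by (intro bexI[of _ z]) (simp_all add: dist_commute)
  qed
  have close: "\<exists>N. \<forall>n\<ge>N. hclose e (F (k n)) K" if e0: "0 < e" for e
  proof -
    obtain N where N': "\<forall>n x. n \<ge> N \<and> x \<in> S \<longrightarrow> norm (infdist x (F (k n)) - g x) < e"
      using unif[OF e0] by (elim exE) (erule that)
    have N: "\<bar>infdist x (F (k n)) - g x\<bar> < e" if "n \<ge> N" "x \<in> S" for n x
      using N' that by simp
    have "hclose e (F (k n)) K" if "n \<ge> N" for n
      unfolding hclose_def
    proof (intro conjI ballI)
      fix y assume y: "y \<in> F (k n)"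
      then have "y \<in> S" using F(2) unfolding S_def by blast
      then have "g y \<le> e" using N[OF that, of y] y by (simp add: abs_less_iff)
      then show "\<exists>x\<in>K. dist y x \<le> e"
        using near[OF \<open>y \<in> S\<close>] by (metis dist_commute order_trans)
    next
      fix x assume "x \<in> K"
      then have "infdist x (F (k n)) < e" using N[OF that, of x] by (auto simp: K_def abs_less_iff)
      then show "\<exists>y\<in>F (k n). dist y x \<le> e"
        using proj[of "k n" x] by (metis dist_commute less_imp_le)
    qed
    then show ?thesis by blast
  qed
  have "K \<noteq> {}"
  proof -
    obtain y where "y \<in> F 0" using c(3) by blast
    then show ?thesis using near[of y] F(2)[of 0] unfolding S_def by blast
  qed
  have "hsup K u + hsup K (- u) = 1" if u: "norm u = 1" for u
  proof -
    have "\<bar>hsup K u + hsup K (- u) - 1\<bar> \<le> 0 + e" if "e > 0" for e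
    proof -
      obtain N where N: "hclose (e / 2) (F (k N)) K"
        using close[OF half_gt_zero[OF \<open>e > 0\<close>]] by blast
      have "\<bar>hsup (F (k N)) u - hsup K u\<bar> \<le> e / 2" "\<bar>hsup (F (k N)) (- u) - hsup K (- u)\<bar> \<le> e / 2"
        using hclose_hsup[OF c(1,3) \<open>compact K\<close> \<open>K \<noteq> {}\<close> N] u by auto
      then show ?thesis using cw_hsup[OF F(1) u, of "k N"] by linarith
    qed
    then have "\<bar>hsup K u + hsup K (- u) - 1\<bar> \<le> 0" by (rule field_le_epsilon)
    then show ?thesis by simp
  qed
  then have "constant_width_one K"
    using cwI \<open>compact K\<close> \<open>convex K\<close> \<open>K \<noteq> {}\<close> by blast
  then show thesis using that g(2) close by blast
qed


section \<open>Minkowski combinations\<close>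

definition mix :: "real \<Rightarrow> (real^2) set \<Rightarrow> (real^2) set \<Rightarrow> (real^2) set" where
  "mix t K L = (\<lambda>(x, y). (1 - t) *\<^sub>R x + t *\<^sub>R y) ` (K \<times> L)"

lemma mix_0: "L \<noteq> {} \<Longrightarrow> mix 0 K L = K"
  by (force simp: mix_def)

text \<open>The two terms of a Minkowski sum are maximised independently, so the support function is
  affine in \<open>t\<close>.\<close>

lemma hsup_mix:
  assumes "compact K" "K \<noteq> {}" "compact L" "L \<noteq> {}" "0 \<le> t" "t \<le> 1"
  shows "compact (mix t K L)" "hsup (mix t K L) u = (1 - t) * hsup K u + t * hsup L u"
proof -
  show c: "compact (mix t K L)"
    unfolding mix_def case_prod_unfold by (intro compact_continuous_image compact_Times assms continuous_intros)
  obtain x where x: "x \<in> K" "x \<bullet> u = hsup K u" using hsup_attained[OF assms(1,2)] by blast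
  obtain y where y: "y \<in> L" "y \<bullet> u = hsup L u" using hsup_attained[OF assms(3,4)] by blast
  have "hsup (mix t K L) u = ((1 - t) *\<^sub>R x + t *\<^sub>R y) \<bullet> u"
  proof (rule hsup_eqI[OF c])
    show "(1 - t) *\<^sub>R x + t *\<^sub>R y \<in> mix t K L" using x y by (auto simp: mix_def)
    fix z assume "z \<in> mix t K L"
    then obtain x' y' where z: "x' \<in> K" "y' \<in> L" "z = (1 - t) *\<^sub>R x' + t *\<^sub>R y'"
      by (auto simp: mix_def)
    show "z \<bullet> u \<le> ((1 - t) *\<^sub>R x + t *\<^sub>R y) \<bullet> u"
      using hsup_ge[OF assms(1) z(1), of u] hsup_ge[OF assms(3) z(2), of u] x y assms(5,6)
      by (simp add: z(3) inner_add_left add_mono mult_left_mono)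
  qed
  then show "hsup (mix t K L) u = (1 - t) * hsup K u + t * hsup L u"
    using x y by (simp add: inner_add_left)
qed

lemma mix_cw:
  assumes K: "constant_width_one K" and L: "constant_width_one L" and t: "0 \<le> t" "t \<le> 1"
  shows "constant_width_one (mix t K L)"
proof (rule cwI)
  note h = hsup_mix[OF cwD(1,3)[OF K] cwD(1,3)[OF L] t]
  show "compact (mix t K L)" by (rule h)
  have "mix t K L = (\<Union>x\<in>(*\<^sub>R) (1 - t) ` K. \<Union>y\<in>(*\<^sub>R) t ` L. {x + y})"
    by (auto simp: mix_def)
  then show "convex (mix t K L)"
    using convex_sums[OF convex_scaling[OF cwD(2)[OF K]] convex_scaling[OF cwD(2)[OF L]]] by simp
  show "mix t K L \<noteq> {}" using cwD(3)[OF K] cwD(3)[OF L] by (auto simp: mix_def)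
  fix u :: "real^2" assume u: "norm u = 1"
  have "hsup (mix t K L) u + hsup (mix t K L) (- u) =
      (1 - t) * (hsup K u + hsup K (- u)) + t * (hsup L u + hsup L (- u))"
    by (simp add: h algebra_simps)
  then show "hsup (mix t K L) u + hsup (mix t K L) (- u) = 1"
    by (simp add: cw_hsup[OF K u] cw_hsup[OF L u])
qed

lemma mix_hclose:
  assumes "\<And>x y. x \<in> K \<Longrightarrow> y \<in> L \<Longrightarrow> dist x y \<le> D"
  shows "hclose (\<bar>s - t\<bar> * D) (mix s K L) (mix t K L)"
proof -
  have *: "dist ((1 - s) *\<^sub>R x + s *\<^sub>R y) ((1 - t) *\<^sub>R x + t *\<^sub>R y) \<le> \<bar>s - t\<bar> * D"
    if "x \<in> K" "y \<in> L" for x y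
  proof -
    have "((1 - s) *\<^sub>R x + s *\<^sub>R y) - ((1 - t) *\<^sub>R x + t *\<^sub>R y) = (t - s) *\<^sub>R (x - y)"
      by (simp add: algebra_simps)
    then have "dist ((1 - s) *\<^sub>R x + s *\<^sub>R y) ((1 - t) *\<^sub>R x + t *\<^sub>R y) = \<bar>t - s\<bar> * dist x y"
      by (simp add: dist_norm)
    then show ?thesis using assms[OF that] by (simp add: abs_minus_commute mult_left_mono)
  qed
  show ?thesis unfolding hclose_def mix_def using * by fastforce
qed


section \<open>Reuleaux polygons from alternating directions\<close>

text \<open>Inside an arc contained in \<open>K\<close>, the height in direction \<open>v\<close>
  has a local maximum at \<open>s\<close>, so its derivative \<open>- sin (s - v)\<close> vanishes
  and \<open>v\<close> is the radial direction or its opposite. It remains to exclude the opposite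
  one.\<close>

lemma arc_interior_normal:
  assumes K: "constant_width_one K" and arc: "\<And>s. s \<in> {a..b} \<Longrightarrow> p + unit_dir s \<in> K"
    and s: "a < s" "s < b" and N: "(p + unit_dir s) \<bullet> unit_dir v = hsup K (unit_dir v)"
  shows "unit_dir v = unit_dir s"
proof -
  have le: "cos (x - v) \<le> cos (s - v)" if "x \<in> {a..b}" for x
    using hsup_ge[OF cwD(1)[OF K] arc[OF that], of "unit_dir v"] N
    by (simp add: inner_add_left unit_dir_inner)
  have "((\<lambda>x. cos (x - v)) has_real_derivative - sin (s - v)) (at s)"
    by (auto intro!: derivative_eq_intros)
  then have "- sin (s - v) = 0"
  proof (rule DERIV_local_max)
    show "0 < min (s - a) (b - s)" using s by simp
    show "\<forall>y. \<bar>s - y\<bar> < min (s - a) (b - s) \<longrightarrow> cos (y - v) \<le> cos (s - v)"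
      using le by (auto simp: abs_if split: if_splits)
  qed
  then have sin0: "sin (s - v) = 0" by simp
  then have "cos (s - v) = 1 \<or> cos (s - v) = - 1"
    using sin_cos_squared_add[of "s - v"] by (simp add: power2_eq_1_iff)
  then show ?thesis
  proof
    assume "cos (s - v) = 1"
    then have "unit_dir v \<bullet> unit_dir s = 1" by (simp add: unit_dir_inner cos_diff mult.commute)
    then show ?thesis by (intro norm_le_1_inner_eq_1[where u = "unit_dir s"]) auto
  next
    \<comment> \<open>Now \<open>cos (x - v)\<close> is at its minimum at \<open>x = s\<close>, and
      a small step along the arc increases it strictly, against maximality.\<close>
    assume c: "cos (s - v) = - 1"
    define d where "d = min pi (b - s) / 2"
    have d: "0 < d" "d < pi" using s pi_gt_zero by (simp_all add: d_def min_def)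
    moreover have "2 * d \<le> b - s" by (simp add: d_def)
    ultimately have sd: "s + d \<in> {a..b}" using s by simp
    have "cos (s + d - v) = cos (s - v) * cos d - sin (s - v) * sin d"
      using cos_add[of "s - v" d] by (simp add: algebra_simps)
    also have "\<dots> = - cos d" by (simp add: c sin0)
    finally have "1 \<le> cos d" using le[OF sd] c by simp
    moreover have "cos d < 1" using cos_monotone_0_pi[of 0 d] d by simp
    ultimately show ?thesis by simp
  qed
qed

lemma hsup_convex_hull_eqI:
  assumes "compact A" "x \<in> A" "\<And>y. y \<in> A \<Longrightarrow> y \<bullet> u \<le> x \<bullet> u"
  shows "hsup (convex hull A) u = x \<bullet> u"
proof (rule hsup_eqI)
  show "compact (convex hull A)" using assms(1) by (rule compact_convex_hull)
  show "x \<in> convex hull A" using assms(2) by (rule hull_inc)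
  fix y assume "y \<in> convex hull A"
  moreover have "convex hull A \<subseteq> {y. u \<bullet> y \<le> x \<bullet> u}"
    using assms(3) by (intro hull_minimal convex_halfspace_le) (auto simp: inner_commute)
  ultimately show "y \<bullet> u \<le> x \<bullet> u" by (auto simp: inner_commute)
qed

text \<open>The directions \<open>T 0 < T 1 < \<dots> < T n = T 0 + \<pi>\<close>, taken modulo \<open>\<pi>\<close>, are those of the edges of
  the star polygon \<open>P 0, P 1, \<dots>, P n = P 0\<close> with unit sides; all indices are continued periodically.\<close>

locale star_polygon =
  fixes n :: nat and T :: "nat \<Rightarrow> real" and P :: "nat \<Rightarrow> real^2"
  assumes odd_n: "odd n"
    and T_less: "\<And>m. T m < T (Suc m)"
    and T_shift: "\<And>m. T (m + n) = T m + pi"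
    and P_Suc: "\<And>m. P (Suc m) = P m + (-1) ^ m *\<^sub>R unit_dir (T (Suc m))"
    and P_shift: "\<And>m. P (m + n) = P m"
begin

text \<open>The shift by \<open>real m * pi\<close> encodes the sign \<open>(-1) ^ m\<close>:
  consecutive sides face opposite ways.\<close>

definition side :: "nat \<Rightarrow> (real^2) set" where
  "side m = unit_arc (P m) (T m + real m * pi) (T (Suc m) - T m)"

definition body :: "(real^2) set" where
  "body = convex hull (\<Union>m<n. side m)"

lemma n_pos: "0 < n" using odd_n by (auto intro: Nat.gr0I)

lemma T_strict_mono: "strict_mono T" using T_less by (rule strict_monoI_Suc)

lemma T_le: "i \<le> j \<Longrightarrow> T i \<le> T j" using T_strict_mono by (simp add: strict_mono_less_eq)

lemma side_eq: "side m = (\<lambda>s. P m + (-1) ^ m *\<^sub>R unit_dir s) ` {T m..T (Suc m)}"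
proof -
  have "{T m + real m * pi..T m + real m * pi + (T (Suc m) - T m)} =
      (\<lambda>s. s + real m * pi) ` {T m..T (Suc m)}"
    by (simp add: algebra_simps)
  then show ?thesis
    unfolding side_def unit_arc_def by (simp only: image_image unit_dir_add_nat_pi)
qed

text \<open>As \<open>n\<close> is odd, the half turn gained by \<open>T\<close> and the sign gained
  by \<open>(-1) ^ n\<close> cancel.\<close>

lemma side_shift: "side (m + n) = side m"
proof -
  have T: "{T (m + n)..T (Suc (m + n))} = (\<lambda>s. s + pi) ` {T m..T (Suc m)}"
    using T_shift[of m] T_shift[of "Suc m"] by simp
  show ?thesis
    unfolding side_eq P_shift T image_image unit_dir_add_pi by (simp add: power_add odd_n)
qed

lemma side_mod: "side m = side (m mod n)"
proof (induction m rule: less_induct)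
  case (less m)
  show ?case
  proof (cases "m < n")
    case False
    then have "side m = side (m - n)" using side_shift[of "m - n"] by simp
    also have "\<dots> = side ((m - n) mod n)" using False n_pos by (intro less) auto
    finally show ?thesis using False by (simp add: le_mod_geq)
  qed simp
qed

lemma side_subset: "side m \<subseteq> (\<Union>m<n. side m)"
  using side_mod[of m] n_pos mod_less_divisor by blast

lemma compact_sides: "compact (\<Union>m<n. side m)"
  unfolding side_def by (intro compact_UN finite_lessThan compact_unit_arc)

lemma P_Suc_in_side: "P (Suc m) \<in> side m"
  unfolding side_eq P_Suc using T_less[of m] by (intro imageI) auto

lemma P_in_sides: "P m \<in> (\<Union>m<n. side m)"
proof -
  have "P m = P (Suc (m + n - 1))" using P_shift n_pos by simp
  then have "P m \<in> side (m + n - 1)" using P_Suc_in_side[of "m + n - 1"] by (simp only:)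
  then show ?thesis using side_subset by blast
qed

text \<open>The boundary curve, parametrised by the angle of the outer normal.\<close>

definition curve :: "nat \<Rightarrow> real \<Rightarrow> real^2" where
  "curve m s = (if even m then P m + unit_dir s else P m)"

text \<open>While the normal runs through piece \<open>m\<close>, the curve sweeps side
  \<open>m\<close> if \<open>m\<close> is even and rests at the vertex \<open>P m\<close> if
  \<open>m\<close> is odd. At a breakpoint two pieces apply; \<open>LEAST\<close> takes the earlier
  one, and \<open>curve_Suc\<close> makes the choice immaterial.\<close>

definition bdry :: "real \<Rightarrow> real^2" where
  "bdry s = curve (LEAST m. s \<le> T (Suc m)) s"

lemma ex_T_ge: "\<exists>m. s \<le> T (Suc m)"
proof -
  have T: "T (j * n) = T 0 + real j * pi" for j
  proof (induction j)
    case (Suc j)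
    then show ?case using T_shift[of "j * n"] by (simp add: algebra_simps)
  qed simp
  obtain j :: nat where "(s - T 0) / pi < real j" using reals_Archimedean2 by blast
  then have "s < T (j * n)" by (simp add: T field_simps)
  then show ?thesis using T_less[of "j * n"] less_imp_le less_trans by blast
qed

lemma ex_piece:
  assumes "T 0 \<le> s"
  obtains m where "T m \<le> s" "s \<le> T (Suc m)"
proof -
  define k where "k = (LEAST m. s \<le> T (Suc m))"
  have k: "s \<le> T (Suc k)" unfolding k_def by (rule LeastI_ex[OF ex_T_ge])
  have "T k \<le> s"
  proof (cases k)
    case (Suc j)
    then have "\<not> s \<le> T (Suc j)" using not_less_Least[of j "\<lambda>m. s \<le> T (Suc m)"] k_def by simp
    then show ?thesis using Suc by simp
  qed (use assms in simp)
  then show thesis using that k by blast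
qed

lemma curve_Suc: "curve (Suc m) (T (Suc m)) = curve m (T (Suc m))"
  by (simp add: curve_def P_Suc)

lemma bdry_eq:
  assumes "T m \<le> s" "s \<le> T (Suc m)"
  shows "bdry s = curve m s"
proof -
  define k where "k = (LEAST m. s \<le> T (Suc m))"
  have k: "s \<le> T (Suc k)" unfolding k_def by (rule LeastI_ex[OF ex_T_ge])
  have "k \<le> m" unfolding k_def by (rule Least_le) (rule assms)
  show ?thesis
  proof (cases "k = m")
    case False
    then have "Suc k \<le> m" using \<open>k \<le> m\<close> by simp
    then have "T (Suc k) = s" "T m = s" using T_le[of "Suc k" m] k assms by linarith+
    then have "m = Suc k" using T_strict_mono by (metis strict_mono_eq)
    then show ?thesis using curve_Suc[of k] \<open>T (Suc k) = s\<close> by (simp add: bdry_def k_def[symmetric])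
  qed (simp add: bdry_def k_def)
qed

text \<open>Since \<open>n\<close> is odd, passing from piece \<open>m\<close> to piece
  \<open>m + n\<close> changes parity and so exchanges an arc with its centre. This is constant
  width in terms of the curve.\<close>

lemma bdry_antipode:
  assumes "T 0 \<le> s"
  shows "bdry (s + pi) = bdry s - unit_dir s"
proof -
  obtain m where m: "T m \<le> s" "s \<le> T (Suc m)" using ex_piece[OF assms] by blast
  have "bdry (s + pi) = curve (m + n) (s + pi)"
    using m T_shift[of m] T_shift[of "Suc m"] by (intro bdry_eq) auto
  then show ?thesis
    using bdry_eq[OF m] odd_n P_shift by (auto simp: curve_def unit_dir_add_pi)
qed

lemma bdry_periodic:
  assumes "T 0 \<le> s"
  shows "bdry (s + 2 * pi) = bdry s"
proof -
  have "bdry (s + 2 * pi) = bdry ((s + pi) + pi)" by (simp add: add.assoc)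
  also have "\<dots> = bdry s - unit_dir s - unit_dir (s + pi)"
    using bdry_antipode[of "s + pi"] bdry_antipode[OF assms] assms pi_gt_zero by simp
  finally show ?thesis by (simp add: unit_dir_add_pi)
qed

lemma bdry_in_sides:
  assumes "T 0 \<le> s"
  shows "bdry s \<in> (\<Union>m<n. side m)"
proof -
  obtain m where m: "T m \<le> s" "s \<le> T (Suc m)" using ex_piece[OF assms] by blast
  show ?thesis
  proof (cases "even m")
    case True
    then have "bdry s \<in> side m" using m bdry_eq[OF m] by (auto simp: side_eq curve_def)
    then show ?thesis using side_subset by blast
  next
    case False
    then show ?thesis using bdry_eq[OF m] P_in_sides by (simp add: curve_def)
  qed
qed

text \<open>An odd side faces away from its own angular range and is swept half a turn later, by
  piece \<open>m + n\<close>.\<close>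

lemma side_point_eq_bdry:
  assumes "T m \<le> s" "s \<le> T (Suc m)"
  shows "P m + (-1) ^ m *\<^sub>R unit_dir s = bdry (if even m then s else s + pi)"
proof (cases "even m")
  case True
  then show ?thesis using bdry_eq[OF assms] by (simp add: curve_def)
next
  case False
  then show ?thesis using bdry_antipode[of s] bdry_eq[OF assms] assms T_le[of 0 m]
    by (simp add: curve_def)
qed

lemma sides_eq_bdry: "(\<Union>m<n. side m) = bdry ` {T 0..T 0 + 2 * pi}"
proof
  show "(\<Union>m<n. side m) \<subseteq> bdry ` {T 0..T 0 + 2 * pi}"
  proof
    fix x assume "x \<in> (\<Union>m<n. side m)"
    then obtain m s where m: "m < n" "T m \<le> s" "s \<le> T (Suc m)"
      and x: "x = P m + (-1) ^ m *\<^sub>R unit_dir s" by (auto simp: side_eq)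
    have "T 0 \<le> s" "s \<le> T 0 + pi"
      using T_le[of 0 m] T_le[of "Suc m" n] T_shift[of 0] m by auto
    then show "x \<in> bdry ` {T 0..T 0 + 2 * pi}"
      unfolding x side_point_eq_bdry[OF m(2,3)] by (intro imageI) auto
  qed
  show "bdry ` {T 0..T 0 + 2 * pi} \<subseteq> (\<Union>m<n. side m)" using bdry_in_sides by auto
qed

text \<open>Monotonicity is glued across the breakpoints by induction on an index whose breakpoint
  bounds the right end.\<close>

lemma piecewise_antimono:
  fixes f :: "real \<Rightarrow> real"
  assumes pc: "\<And>m s s'. T m \<le> s \<Longrightarrow> s \<le> s' \<Longrightarrow> s' \<le> T (Suc m) \<Longrightarrow> a \<le> s \<Longrightarrow> s' \<le> b \<Longrightarrow> f s' \<le> f s"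
    and "T 0 \<le> a" "a \<le> s" "s \<le> s'" "s' \<le> b"
  shows "f s' \<le> f s"
proof -
  have "f s' \<le> f s" if "a \<le> s" "s \<le> s'" "s' \<le> b" "s' \<le> T m" for m s s'
    using that
  proof (induction m arbitrary: s s')
    case 0
    then have "s = s'" using assms(2) by simp
    then show ?case by simp
  next
    case (Suc m)
    consider "s' \<le> T m" | "T m \<le> s" | "s \<le> T m" "T m \<le> s'" by linarith
    then show ?case
    proof cases
      case 1 then show ?thesis using Suc by blast
    next
      case 2 then show ?thesis using pc Suc by blast
    next
      case 3
      have "f s' \<le> f (T m)" using pc[of m "T m" s'] 3 Suc by auto
      also have "f (T m) \<le> f s" using Suc 3 by auto
      finally show ?thesis .
    qed
  qed
  moreover obtain m where "s' \<le> T m" using ex_T_ge by blast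
  ultimately show ?thesis using assms by blast
qed

text \<open>Along an arc the height in direction \<open>u\<close> is a constant plus
  \<open>cos (s - u)\<close>, and at a vertex it does not change, so it falls during the half turn
  after \<open>u\<close>. This yields the supporting lines without any prior knowledge of convexity
  of the curve.\<close>

lemma bdry_inner_antimono:
  assumes "T 0 \<le> u" "u \<le> s" "s \<le> s'" "s' \<le> u + pi"
  shows "bdry s' \<bullet> unit_dir u \<le> bdry s \<bullet> unit_dir u"
proof (rule piecewise_antimono[where f = "\<lambda>s. bdry s \<bullet> unit_dir u" and a = u and b = "u + pi"])
  fix m s s' assume m: "T m \<le> s" "s \<le> s'" "s' \<le> T (Suc m)" "u \<le> s" "s' \<le> u + pi"
  have "cos (s' - u) \<le> cos (s - u)" using m by (intro cos_monotone_0_pi_le) auto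
  then show "bdry s' \<bullet> unit_dir u \<le> bdry s \<bullet> unit_dir u"
    using bdry_eq[of m s] bdry_eq[of m s'] m
    by (simp add: curve_def inner_add_left unit_dir_inner)
qed (use assms in auto)

lemma bdry_inner_mono:
  assumes "T 0 \<le> u" "u + pi \<le> s" "s \<le> s'" "s' \<le> u + 2 * pi"
  shows "bdry s \<bullet> unit_dir u \<le> bdry s' \<bullet> unit_dir u"
proof -
  have "- (bdry s' \<bullet> unit_dir u) \<le> - (bdry s \<bullet> unit_dir u)"
  proof (rule piecewise_antimono[where f = "\<lambda>s. - (bdry s \<bullet> unit_dir u)" and a = "u + pi" and b = "u + 2 * pi"])
    fix m s s' assume m: "T m \<le> s" "s \<le> s'" "s' \<le> T (Suc m)" "u + pi \<le> s" "s' \<le> u + 2 * pi"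
    have "cos (2 * pi - (s - u)) \<le> cos (2 * pi - (s' - u))"
      using m by (intro cos_monotone_0_pi_le) auto
    then have "cos (s - u) \<le> cos (s' - u)" by (simp add: cos_diff)
    then show "- (bdry s' \<bullet> unit_dir u) \<le> - (bdry s \<bullet> unit_dir u)"
      using bdry_eq[of m s] bdry_eq[of m s'] m
      by (simp add: curve_def inner_add_left unit_dir_inner)
  next
    show "T 0 \<le> u + pi" using assms(1) pi_gt_zero by linarith
  qed (use assms in auto)
  then show ?thesis by simp
qed

text \<open>By periodicity the parameter of \<open>x\<close> may be taken in the full turn following
  \<open>u\<close>, which splits into a falling and a rising half.\<close>

lemma bdry_inner_bounds:
  assumes u: "T 0 \<le> u" "u \<le> T 0 + 2 * pi" and x: "x \<in> (\<Union>m<n. side m)"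
  shows "x \<bullet> unit_dir u \<le> bdry u \<bullet> unit_dir u" "bdry (u + pi) \<bullet> unit_dir u \<le> x \<bullet> unit_dir u"
proof -
  obtain s0 where s0: "T 0 \<le> s0" "s0 \<le> T 0 + 2 * pi" "x = bdry s0"
    using x unfolding sides_eq_bdry by auto
  obtain s where s: "u \<le> s" "s \<le> u + 2 * pi" "x = bdry s"
  proof (cases "u \<le> s0")
    case True
    then show ?thesis using that[of s0] s0 u by simp
  next
    case False
    then show ?thesis using that[of "s0 + 2 * pi"] s0 u bdry_periodic by simp
  qed
  have "x \<bullet> unit_dir u \<le> bdry u \<bullet> unit_dir u \<and> bdry (u + pi) \<bullet> unit_dir u \<le> x \<bullet> unit_dir u"
  proof (cases "s \<le> u + pi")
    case True
    then show ?thesis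
      using bdry_inner_antimono[of u u s] bdry_inner_antimono[of u s "u + pi"] u s by simp
  next
    case False
    then show ?thesis
      using bdry_inner_mono[of u "u + pi" s] bdry_inner_mono[of u s "u + 2 * pi"] u s
        bdry_periodic[of u] pi_gt_zero by simp
  qed
  then show "x \<bullet> unit_dir u \<le> bdry u \<bullet> unit_dir u" "bdry (u + pi) \<bullet> unit_dir u \<le> x \<bullet> unit_dir u"
    by auto
qed

lemma hsup_body:
  assumes "T 0 \<le> u" "u \<le> T 0 + 2 * pi"
  shows "hsup body (unit_dir u) = bdry u \<bullet> unit_dir u"
    "hsup body (- unit_dir u) = bdry (u + pi) \<bullet> (- unit_dir u)"
proof -
  have "T 0 \<le> u + pi" using assms(1) pi_gt_zero by linarith
  then show "hsup body (- unit_dir u) = bdry (u + pi) \<bullet> (- unit_dir u)"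
    unfolding body_def using bdry_inner_bounds(2)[OF assms]
    by (intro hsup_convex_hull_eqI compact_sides bdry_in_sides) simp_all
  show "hsup body (unit_dir u) = bdry u \<bullet> unit_dir u"
    unfolding body_def using bdry_inner_bounds(1)[OF assms]
    by (intro hsup_convex_hull_eqI compact_sides bdry_in_sides assms)
qed

lemma cw_body: "constant_width_one body"
proof (rule cwI)
  show "compact body" unfolding body_def by (intro compact_convex_hull compact_sides)
  show "convex body" by (simp add: body_def)
  show "body \<noteq> {}" using P_in_sides[of 0] unfolding body_def by (metis empty_iff hull_inc)
  fix v :: "real^2" assume "norm v = 1"
  then obtain u where u: "T 0 \<le> u" "u < T 0 + 2 * pi" "v = unit_dir u" using ex_unit_dir by metis
  have "hsup body v + hsup body (- v) = (bdry u - bdry (u + pi)) \<bullet> unit_dir u"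
    using hsup_body[of u] u by (simp add: inner_diff_left)
  also have "\<dots> = 1" using bdry_antipode[OF u(1)] by (simp add: unit_dir_inner)
  finally show "hsup body v + hsup body (- v) = 1" .
qed

lemma sides_subset_body: "(\<Union>m<n. side m) \<subseteq> body"
  unfolding body_def by (rule hull_subset)

text \<open>A frontier point is the only point of some face, and every face contains a point of the
  curve.\<close>

lemma frontier_body: "frontier body = (\<Union>m<n. side m)"
proof (intro equalityI subsetI)
  fix x assume "x \<in> frontier body"
  then obtain v where v: "x \<in> body" "norm v = 1" "x \<bullet> v = hsup body v"
    using cw_frontier_iff[OF cw_body] by blast
  obtain u where u: "T 0 \<le> u" "u < T 0 + 2 * pi" "v = unit_dir u"
    using v(2) ex_unit_dir by metis
  have "x = bdry u"
    using cw_face_unique[OF cw_body v(2,1,3), of "bdry u"] hsup_body(1)[of u] u bdry_in_sides[OF u(1)]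
      sides_subset_body by auto
  then show "x \<in> (\<Union>m<n. side m)" using bdry_in_sides[OF u(1)] by simp
next
  fix x assume x: "x \<in> (\<Union>m<n. side m)"
  then obtain u where "T 0 \<le> u" "u \<le> T 0 + 2 * pi" "x = bdry u" unfolding sides_eq_bdry by auto
  then have "x \<in> body" "x \<bullet> unit_dir u = hsup body (unit_dir u)"
    using x sides_subset_body hsup_body(1)[of u] by auto
  then show "x \<in> frontier body" using cw_frontier_iff[OF cw_body] norm_unit_dir by blast
qed

lemma hsup_side:
  assumes "m < n" "T m \<le> s" "s \<le> T (Suc m)"
  shows "hsup body ((-1) ^ m *\<^sub>R unit_dir s) = P m \<bullet> ((-1) ^ m *\<^sub>R unit_dir s) + 1"
proof -
  define u where "u = (if even m then s else s + pi)"
  have "T 0 \<le> s" "s \<le> T 0 + pi"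
    using T_le[of 0 m] T_le[of "Suc m" n] T_shift[of 0] assms by auto
  then have "T 0 \<le> u" "u \<le> T 0 + 2 * pi" using pi_gt_zero by (auto simp: u_def)
  then have "hsup body (unit_dir u) = bdry u \<bullet> unit_dir u" by (rule hsup_body)
  moreover have d: "(-1) ^ m *\<^sub>R unit_dir s = unit_dir u" by (simp add: u_def unit_dir_add_pi)
  moreover have "bdry u = P m + unit_dir u"
    using side_point_eq_bdry[OF assms(2,3)] unfolding d by (simp add: u_def)
  ultimately show ?thesis unfolding d by (simp add: inner_add_left unit_dir_inner)
qed

lemma arc_ends_side:
  "arc_ends (P m) (T m + real m * pi) (T (Suc m) - T m) =
    {P m + (-1) ^ m *\<^sub>R unit_dir (T m), P (Suc m)}"
  using unit_dir_add_nat_pi[of "T (Suc m)" m] unit_dir_add_nat_pi[of "T m" m]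
  by (simp add: arc_ends_def P_Suc algebra_simps)

lemma arc_ends_side_Suc:
  "arc_ends (P (Suc m)) (T (Suc m) + real (Suc m) * pi) (T (Suc (Suc m)) - T (Suc m)) =
    {P m, P (Suc (Suc m))}"
  using P_Suc[of m] unfolding arc_ends_side by simp

text \<open>The missing index before 0 is \<open>n - 1\<close>. As \<open>n\<close> is odd, the sign
  there is positive, and \<open>T n\<close> lies half a turn past \<open>T 0\<close>.\<close>

lemma arc_ends_side_0: "arc_ends (P 0) (T 0 + real 0 * pi) (T (Suc 0) - T 0) = {P (n - 1), P 1}"
proof -
  have "P n = P (n - 1) + (-1) ^ (n - 1) *\<^sub>R unit_dir (T n)" using P_Suc[of "n - 1"] n_pos by simp
  then have "P 0 = P (n - 1) - unit_dir (T 0)"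
    using odd_n P_shift[of 0] T_shift[of 0] n_pos by (simp add: unit_dir_add_pi)
  then show ?thesis unfolding arc_ends_side by simp
qed

lemma reuleaux_polygon_body:
  assumes inj: "inj_on P {..<n}"
  shows "reuleaux_polygon body n P (\<lambda>m. T m + real m * pi) (\<lambda>m. T (Suc m) - T m)"
  unfolding reuleaux_polygon_def
proof (intro conjI allI impI)
  show "constant_width_one body" by (rule cw_body)
  show "frontier body = (\<Union>i<n. unit_arc (P i) (T i + real i * pi) (T (Suc i) - T i))"
    using frontier_body by (simp add: side_def)
  show "inj_on P {..<n}" by (rule inj)
next
  fix i show "0 < T (Suc i) - T i" using T_less by simp
  have "T (Suc i) \<le> T i + pi" using T_shift[of i] T_le[of "Suc i" "i + n"] n_pos by simp
  then show "T (Suc i) - T i < 2 * pi" using pi_gt_zero by linarith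
next
  fix i assume i: "i < n"
  show "\<exists>j<n. P i \<in> arc_ends (P j) (T j + real j * pi) (T (Suc j) - T j)"
  proof (cases i)
    case 0
    then have "P i = P (Suc (n - 1))" using P_shift[of 0] n_pos by simp
    then show ?thesis using n_pos unfolding arc_ends_side by (intro exI[of _ "n - 1"]) simp
  next
    case (Suc j)
    then show ?thesis using i unfolding arc_ends_side by (intro exI[of _ j]) simp
  qed
next
  fix i j assume ij: "i < n" "j < n" "i \<noteq> j"
  \<comment> \<open>At a common point the radius of side \<open>j\<close> is an outer normal. If the
    point were inside side \<open>i\<close>, the radius of side \<open>i\<close> would be the only
    normal there, and equal radii at one point force equal centres.\<close>
  have *: "x \<in> arc_ends (P i) (T i + real i * pi) (T (Suc i) - T i)"
    if ij: "i < n" "j < n" "i \<noteq> j" and x: "x \<in> side i" "x \<in> side j" for i j x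
  proof -
    let ?a = "T i + real i * pi" and ?b = "T (Suc i) + real i * pi"
    obtain s where s: "?a \<le> s" "s \<le> ?b" "x = P i + unit_dir s"
      using x(1) unfolding side_def unit_arc_def by auto
    obtain v where v: "T j \<le> v" "v \<le> T (Suc j)" "x = P j + (-1) ^ j *\<^sub>R unit_dir v"
      using x(2) unfolding side_eq by auto
    define w where "w = v + real j * pi"
    have w: "unit_dir w = (-1) ^ j *\<^sub>R unit_dir v" by (simp add: w_def unit_dir_add_nat_pi)
    have N: "(P i + unit_dir s) \<bullet> unit_dir w = hsup body (unit_dir w)"
      unfolding s(3)[symmetric] using hsup_side[OF ij(2) v(1,2)] v(3)
      unfolding w[symmetric] by (simp add: inner_add_left unit_dir_inner)
    have arc: "P i + unit_dir t \<in> body" if "t \<in> {?a..?b}" for t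
    proof -
      have "P i + unit_dir t \<in> side i" unfolding side_def unit_arc_def using that by auto
      then show ?thesis using sides_subset_body ij(1) by blast
    qed
    have "s = ?a \<or> s = ?b"
    proof (rule ccontr)
      assume "\<not> (s = ?a \<or> s = ?b)"
      then have "unit_dir w = unit_dir s"
        using s by (intro arc_interior_normal[OF cw_body arc _ _ N]) auto
      then have "P i = P j" using s(3) v(3) w by simp
      then show False using inj ij by (auto simp: inj_on_def)
    qed
    then show ?thesis using s(3) by (auto simp: arc_ends_def algebra_simps)
  qed
  show "unit_arc (P i) (T i + real i * pi) (T (Suc i) - T i) \<inter>
      unit_arc (P j) (T j + real j * pi) (T (Suc j) - T j)
    \<subseteq> arc_ends (P i) (T i + real i * pi) (T (Suc i) - T i) \<inter>
      arc_ends (P j) (T j + real j * pi) (T (Suc j) - T j)"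
    using *[OF ij] *[OF ij(2,1)] ij(3) unfolding side_def by blast
qed

end

lemma star_polygon_extend:
  fixes T :: "nat \<Rightarrow> real" and P :: "nat \<Rightarrow> real^2"
  assumes n: "odd n" and T: "\<And>m. m < n \<Longrightarrow> T m < T (Suc m)" "T n = T 0 + pi"
    and P: "\<And>m. m < n \<Longrightarrow> P (Suc m) = P m + (-1) ^ m *\<^sub>R unit_dir (T (Suc m))" "P n = P 0"
  shows "star_polygon n (\<lambda>m. T (m mod n) + real (m div n) * pi) (\<lambda>m. P (m mod n))"
proof -
  have n0: "0 < n" using n by (auto intro: Nat.gr0I)
  have Suc_mod: "T (Suc m mod n) + real (Suc m div n) * pi = T (Suc (m mod n)) + real (m div n) * pi"
    "P (Suc m mod n) = P (Suc (m mod n))" for m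
    using T(2) P(2) n0 by (auto simp: mod_Suc div_Suc algebra_simps)
  show ?thesis
  proof
    fix m
    have i: "m mod n < n" using n0 by simp
    show "T (m mod n) + real (m div n) * pi < T (Suc m mod n) + real (Suc m div n) * pi"
      unfolding Suc_mod using T(1)[OF i] by simp
    show "P (Suc m mod n) = P (m mod n) +
        (-1) ^ m *\<^sub>R unit_dir (T (Suc m mod n) + real (Suc m div n) * pi)"
    proof -
      \<comment> \<open>As \<open>n\<close> is odd, each completed period contributes one sign
        change, which the summand \<open>real (m div n) * pi\<close> in the angle
        compensates.\<close>
      have "(-1 :: real) ^ m = (-1) ^ (m mod n + n * (m div n))" by simp
      also have "\<dots> = (-1) ^ (m mod n) * (-1) ^ (m div n)"
        unfolding power_add power_mult using n by simp
      finally have "(-1 :: real) ^ m * (-1) ^ (m div n) = (-1) ^ (m mod n)"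
        by (simp add: power_mult_distrib[symmetric] mult.assoc)
      then show ?thesis unfolding Suc_mod unit_dir_add_nat_pi using P(1)[OF i] by simp
    qed
  qed (use n n0 in \<open>auto simp: algebra_simps\<close>)
qed

lemma unit_dir_sum: "unit_dir (x + y) + unit_dir (x - y) = (2 * cos y) *\<^sub>R unit_dir x"
  by (rule vec2_eqI) (auto simp: cos_add cos_diff sin_add sin_diff)


section \<open>The shapes\<close>

text \<open>\<open>R\<close> is the outer radius, and the centres \<open>P 1\<close>, ...,
  \<open>P (2 * N)\<close> lie on the circle of radius \<open>R\<close> about 0. The condition
  \<open>2 * R * cos (l / 2) = 1\<close> says that points of this circle whose polar angles differ
  by \<open>pi + l\<close> have distance 1, and \<open>2 * h + (2 * real N - 1) * l = pi\<close>
  puts the first centre at angle \<open>h\<close> and the last at \<open>- h\<close>, modulo full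
  turns. The centre \<open>P 0\<close> lies on the symmetry axis at distance 1 from both and sees
  them under the angle \<open>a\<close>. The case \<open>h = l\<close> is the regular
  polygon.\<close>

locale omega_shape =
  fixes N :: nat and R l h a :: real
  assumes N: "1 \<le> N" and R: "1 / 2 < R" "R < 1" and l: "0 < l" "2 * R * cos (l / 2) = 1"
    and h_def: "2 * h + (2 * real N - 1) * l = pi" and h: "0 < h" "h \<le> l"
    and a: "0 < a" "a < pi" "sin (a / 2) = R * sin h"
begin

definition x0 :: real where "x0 = R * cos h - cos (a / 2)"

definition phi :: "nat \<Rightarrow> real" where "phi m = h + (real m - 1) * (pi + l)"

definition T0 :: "nat \<Rightarrow> real" where
  "T0 m = (if m = 0 then - a / 2 else if m = 1 then a / 2
    else if m \<le> 2 * N then h + (real m - 3 / 2) * l else pi - a / 2)"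

definition P0 :: "nat \<Rightarrow> real^2" where
  "P0 m = (if m = 0 \<or> m = 2 * N + 1 then x0 *\<^sub>R unit_dir 0 else R *\<^sub>R unit_dir (phi m))"

definition T :: "nat \<Rightarrow> real" where "T m = T0 (m mod (2 * N + 1)) + real (m div (2 * N + 1)) * pi"

definition P :: "nat \<Rightarrow> real^2" where "P m = P0 (m mod (2 * N + 1))"

lemma l_le: "l < pi" "h < pi / 2"
proof -
  have "l \<le> (2 * real N - 1) * l" using N l by simp
  then show "l < pi" "h < pi / 2" using h_def h l by linarith+
qed

lemma a_half_less: "a / 2 < h"
proof (rule ccontr)
  assume "\<not> a / 2 < h"
  then have "sin h \<le> sin (a / 2)" using a h l_le by (intro sin_monotone_2pi_le) auto
  moreover have "sin h > 0" using h l_le pi_gt_zero by (intro sin_gt_zero) linarith+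
  then have "R * sin h < 1 * sin h" using R by (intro mult_strict_right_mono) auto
  ultimately show False using a by simp
qed

lemma sin_diff_eq: "R * sin h - sin (h - l / 2) = R * sin (l - h)"
proof -
  have "2 * cos (l / 2) * sin (h - l / 2) = sin h + sin (h - l)"
    using sin_times_cos[of "h - l / 2" "l / 2"] by (simp add: algebra_simps)
  then have "R * (sin h + sin (h - l)) = (2 * R * cos (l / 2)) * sin (h - l / 2)" by simp
  also have "\<dots> = sin (h - l / 2)" unfolding l(2) by simp
  finally show ?thesis using sin_minus[of "h - l"] by (simp add: algebra_simps)
qed

text \<open>Sides 1 and \<open>2 * N\<close> extend by the angle \<open>h - a / 2\<close> from their
  tangency point towards \<open>P 0\<close>, and by \<open>l / 2\<close> in the other direction. The
  bound keeps them inside the outer circle; its strict form puts \<open>P 0\<close> strictly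
  inside.\<close>

lemma h_minus_a: "h - a / 2 \<le> l / 2" "h < l \<Longrightarrow> h - a / 2 < l / 2"
proof -
  have *: "sin (a / 2) - sin (h - l / 2) = R * sin (l - h)" using sin_diff_eq a by simp
  show "h - a / 2 \<le> l / 2"
  proof (rule ccontr)
    assume "\<not> h - a / 2 \<le> l / 2"
    then have "sin (a / 2) < sin (h - l / 2)" using a h l l_le by (intro sin_monotone_2pi) auto
    moreover have "sin (l - h) \<ge> 0" using h l_le by (intro sin_ge_zero) auto
    ultimately show False using * R mult_nonneg_nonneg[of R "sin (l - h)"] by linarith
  qed
  moreover assume "h < l"
  then have "sin (l - h) > 0" using h l_le by (intro sin_gt_zero) auto
  then have "sin (a / 2) \<noteq> sin (h - l / 2)" using * R by auto
  then have "a / 2 \<noteq> h - l / 2" by metis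
  ultimately show "h - a / 2 < l / 2" by linarith
qed

lemma P0_step:
  assumes "m < 2 * N + 1"
  shows "P0 (Suc m) = P0 m + (-1) ^ m *\<^sub>R unit_dir (T0 (Suc m))"
proof -
  consider "m = 0" | "1 \<le> m" "m < 2 * N" | "m = 2 * N" using assms by linarith
  then show ?thesis
  proof cases
    case 1
    then show ?thesis using N a by (intro vec2_eqI) (auto simp: P0_def T0_def phi_def x0_def)
  next
    case 2
    have "phi (Suc m) = phi m + l + pi" by (simp add: phi_def algebra_simps)
    then have 1: "P0 (Suc m) = - R *\<^sub>R unit_dir (phi m + l)"
      using 2 by (simp add: P0_def unit_dir_add_pi)
    have "phi m + l / 2 + pi = T0 (Suc m) + real m * pi"
      using 2 by (simp add: phi_def T0_def algebra_simps)
    then have 2: "(-1) ^ m *\<^sub>R unit_dir (T0 (Suc m)) = - unit_dir (phi m + l / 2)"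
      using unit_dir_add_nat_pi[of "T0 (Suc m)" m] unit_dir_add_pi[of "phi m + l / 2"] by simp
    have "unit_dir (phi m + l) + unit_dir (phi m) = (2 * cos (l / 2)) *\<^sub>R unit_dir (phi m + l / 2)"
      using unit_dir_sum[of "phi m + l / 2" "l / 2"] by (simp add: add.assoc)
    then have "R *\<^sub>R (unit_dir (phi m + l) + unit_dir (phi m)) = unit_dir (phi m + l / 2)"
      using l(2) by (simp add: mult_ac)
    then show ?thesis using 1 2 \<open>1 \<le> m\<close> \<open>m < 2 * N\<close>
      by (simp add: P0_def algebra_simps add_eq_0_iff)
  next
    case 3
    \<comment> \<open>The closing condition makes the last centre on the circle the mirror image of
      the first one.\<close>
    have "phi (2 * N) = - h + 2 * pi * of_int (int N)"
      using h_def by (simp add: phi_def algebra_simps)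
    then have "unit_dir (phi (2 * N)) = unit_dir (- h)" by (metis unit_dir_add_2pi_int)
    then show ?thesis using 3 N a by (intro vec2_eqI) (auto simp: P0_def T0_def x0_def)
  qed
qed

lemma T0_step:
  assumes "m < 2 * N + 1"
  shows "T0 m < T0 (Suc m)"
proof -
  consider "m = 0" | "m = 1" "1 < 2 * N" | "1 < m" "m < 2 * N" | "m = 2 * N" "1 < m" using assms N by linarith
  then show ?thesis
  proof cases
    case 1
    then show ?thesis using a by (simp add: T0_def)
  next
    case 2
    then show ?thesis using a_half_less l by (simp add: T0_def)
  next
    case 3
    then show ?thesis using l by (simp add: T0_def algebra_simps)
  next
    case 4
    have "h + (real m - 3 / 2) * l = pi - h - l / 2"
      using h_def 4 by (simp add: algebra_simps)
    then show ?thesis using 4 a_half_less l by (simp add: T0_def)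
  qed
qed

sublocale star_polygon "2 * N + 1" T P
proof -
  have "star_polygon (2 * N + 1) (\<lambda>m. T0 (m mod (2 * N + 1)) + real (m div (2 * N + 1)) * pi)
      (\<lambda>m. P0 (m mod (2 * N + 1)))"
    using N by (intro star_polygon_extend P0_step T0_step) (auto simp: T0_def P0_def)
  then show "star_polygon (2 * N + 1) T P" by (simp add: T_def[abs_def] P_def[abs_def])
qed

lemma T_eq: "m \<le> 2 * N + 1 \<Longrightarrow> T m = T0 m"
  using N by (cases "m = 2 * N + 1") (auto simp: T_def T0_def)

lemma P_eq: "m \<le> 2 * N + 1 \<Longrightarrow> P m = P0 m"
  by (cases "m = 2 * N + 1") (auto simp: P_def P0_def)

lemma P_eq': "1 \<le> m \<Longrightarrow> m \<le> 2 * N \<Longrightarrow> P m = R *\<^sub>R unit_dir (phi m)"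
  by (simp add: P_eq P0_def)

lemma P_0: "P 0 = x0 *\<^sub>R unit_dir 0"
  by (simp add: P_eq P0_def)

section \<open>Position of the body relative to the two circles\<close>

lemma x0_eq: "x0 * cos (a / 2) = R * cos (h - a / 2) - 1"
proof -
  have "x0 * cos (a / 2) = R * cos h * cos (a / 2) + (sin (a / 2))\<^sup>2 - 1"
    using sin_cos_squared_add[of "a / 2"] by (simp add: x0_def algebra_simps power2_eq_square)
  also have "(sin (a / 2))\<^sup>2 = R * sin h * sin (a / 2)" using a by (simp add: power2_eq_square)
  finally show ?thesis by (simp add: cos_diff algebra_simps)
qed

lemma cos_half_a: "0 < cos (a / 2)" "cos (a / 2) < 1"
  using a cos_gt_zero[of "a / 2"] cos_monotone_0_pi[of 0 "a / 2"] by auto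

lemma x0_bound: "x0 < - (1 - R)"
proof -
  have "x0 * cos (a / 2) \<le> R - 1" unfolding x0_eq using R by simp
  then have "x0 \<le> - (1 - R) / cos (a / 2)" using cos_half_a by (simp add: pos_le_divide_eq)
  moreover have "1 - R < (1 - R) / cos (a / 2)"
    using cos_half_a R by (simp add: pos_less_divide_eq)
  ultimately show ?thesis unfolding minus_divide_left[symmetric] by linarith
qed

text \<open>Law of cosines in the triangle with vertices 0, \<open>P 0\<close>, \<open>P 1\<close>,
  whose angle at \<open>P 1\<close> is \<open>h - a / 2\<close>.\<close>

lemma x0_square: "x0\<^sup>2 = R\<^sup>2 + 1 - 2 * R * cos (h - a / 2)"
proof -
  have "x0\<^sup>2 = R\<^sup>2 * (cos h)\<^sup>2 + (cos (a / 2))\<^sup>2 - 2 * R * cos h * cos (a / 2)"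
    by (simp add: x0_def power2_eq_square algebra_simps)
  also have "(cos h)\<^sup>2 = 1 - (sin h)\<^sup>2" by (simp add: cos_squared_eq)
  also have "(cos (a / 2))\<^sup>2 = 1 - (R * sin h)\<^sup>2" using a by (simp add: cos_squared_eq)
  also have "R\<^sup>2 * (1 - (sin h)\<^sup>2) + (1 - (R * sin h)\<^sup>2) - 2 * R * cos h * cos (a / 2) =
      R\<^sup>2 + 1 - 2 * R * (cos h * cos (a / 2) + sin h * (R * sin h))"
    by (simp add: power2_eq_square algebra_simps)
  finally show ?thesis unfolding cos_diff a(3) .
qed

lemma x0_gt: "- R \<le> x0" "h < l \<Longrightarrow> - R < x0"
proof -
  have *: "R\<^sup>2 - x0\<^sup>2 = 2 * R * (cos (h - a / 2) - cos (l / 2))"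
    using x0_square l(2) by (simp add: algebra_simps)
  have "cos (l / 2) \<le> cos (h - a / 2)"
    using h_minus_a a_half_less l_le by (intro cos_monotone_0_pi_le) auto
  then have "x0\<^sup>2 \<le> R\<^sup>2"
    using * R mult_nonneg_nonneg[of "2 * R" "cos (h - a / 2) - cos (l / 2)"] by linarith
  then show "- R \<le> x0" using R by (auto simp: abs_le_square_iff[symmetric])
  assume "h < l"
  then have "cos (l / 2) < cos (h - a / 2)"
    using h_minus_a(2) a_half_less l_le by (intro cos_monotone_0_pi) auto
  then have "x0\<^sup>2 < R\<^sup>2"
    using * R mult_pos_pos[of "2 * R" "cos (h - a / 2) - cos (l / 2)"] by linarith
  then show "- R < x0" using R power_mono[of R "- x0" 2] by force
qed

lemma norm_P: "1 \<le> m \<Longrightarrow> m \<le> 2 * N \<Longrightarrow> norm (P m) = R" "norm (P 0) = - x0"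
  using R x0_bound by (auto simp: P_eq' P_0)

text \<open>Angles on side \<open>m\<close> are measured from the direction opposite to its centre,
  in which the side meets the inner circle when \<open>1 \<le> m\<close>.\<close>

lemma unit_dir_side:
  "(-1) ^ m *\<^sub>R unit_dir s = - unit_dir (phi m + (s - (h + (real m - 1) * l)))"
proof -
  have "phi m + (s - (h + (real m - 1) * l)) + pi = s + real m * pi"
    by (simp add: phi_def algebra_simps)
  then show ?thesis
    using unit_dir_add_nat_pi[of s m] unit_dir_add_pi[of "phi m + (s - (h + (real m - 1) * l))"]
    by (simp only:)
qed

lemma side_angle:
  assumes "1 \<le> m" "m \<le> 2 * N" "T m \<le> s" "s \<le> T (Suc m)"
  shows "\<bar>s - (h + (real m - 1) * l)\<bar> \<le> l / 2"
proof -
  have "- (l / 2) \<le> T m - (h + (real m - 1) * l)"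
    using assms(1,2) h_minus_a(1) l by (auto simp: T_eq T0_def algebra_simps)
  moreover have "T (Suc m) - (h + (real m - 1) * l) \<le> l / 2"
  proof (cases "m = 2 * N")
    case True
    then have "T (Suc m) - (h + (real m - 1) * l) = h - a / 2"
      using h_def N by (simp add: T_eq T0_def algebra_simps)
    then show ?thesis using h_minus_a(1) by simp
  next
    case False
    then show ?thesis using assms(1,2) by (auto simp: T_eq T0_def algebra_simps)
  qed
  ultimately show ?thesis using assms(3,4) by linarith
qed

lemma side_mid:
  assumes "1 \<le> m" "m \<le> 2 * N"
  shows "T m \<le> h + (real m - 1) * l" "h + (real m - 1) * l \<le> T (Suc m)"
proof -
  show "T m \<le> h + (real m - 1) * l"
    using assms a_half_less l by (auto simp: T_eq T0_def algebra_simps)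
  show "h + (real m - 1) * l \<le> T (Suc m)"
  proof (cases "m = 2 * N")
    case True
    then have "T (Suc m) - (h + (real m - 1) * l) = h - a / 2"
      using h_def N by (simp add: T_eq T0_def algebra_simps)
    then show ?thesis using a_half_less by simp
  next
    case False
    then show ?thesis using assms l by (auto simp: T_eq T0_def algebra_simps)
  qed
qed

text \<open>By the law of cosines the norm along a side depends only on the cosine of the angle from
  its middle direction and is largest at the extreme angle. For side 0 this uses
  \<open>x0 < 0\<close>, and the bound \<open>R\<close> is the norm of its endpoints.\<close>

lemma side_subset_cball:
  assumes "m < 2 * N + 1"
  shows "side m \<subseteq> cball 0 R"
proof
  fix x assume "x \<in> side m"
  then obtain s where s: "T m \<le> s" "s \<le> T (Suc m)" "x = P m + (-1) ^ m *\<^sub>R unit_dir s"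
    by (auto simp: side_eq)
  have "(norm x)\<^sup>2 \<le> R\<^sup>2"
  proof (cases "m = 0")
    case True
    have "\<bar>s\<bar> \<le> a / 2" using s True by (auto simp: T_eq T0_def)
    then have c: "cos (a / 2) \<le> cos s" using a cos_monotone_0_pi_le[of "\<bar>s\<bar>" "a / 2"] by simp
    have "(norm x)\<^sup>2 = x0\<^sup>2 + 1 + 2 * x0 * cos s"
      unfolding power2_norm_eq_inner s(3) using True
      by (simp add: P_0 inner_add inner_diff unit_dir_inner power2_eq_square algebra_simps)
    also have "\<dots> \<le> x0\<^sup>2 + 1 + 2 * (x0 * cos (a / 2))"
      using x0_bound R c by (simp add: mult_left_mono_neg)
    also have "\<dots> = R\<^sup>2 + 1 - 2 * R * cos (h - a / 2) + 1 + 2 * (R * cos (h - a / 2) - 1)"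
      unfolding x0_square x0_eq by simp
    finally show ?thesis by simp
  next
    case False
    define d where "d = s - (h + (real m - 1) * l)"
    have m: "1 \<le> m" "m \<le> 2 * N" using False assms by auto
    have "\<bar>d\<bar> \<le> l / 2" unfolding d_def by (rule side_angle[OF m s(1,2)])
    then have c: "cos (l / 2) \<le> cos d" using l_le cos_monotone_0_pi_le[of "\<bar>d\<bar>" "l / 2"] by simp
    have "(norm x)\<^sup>2 = R\<^sup>2 + 1 - 2 * R * cos d"
      unfolding power2_norm_eq_inner s(3) unit_dir_side d_def[symmetric] P_eq'[OF m]
      by (simp add: inner_add inner_diff unit_dir_inner power2_eq_square algebra_simps)
    also have "\<dots> \<le> R\<^sup>2 + 1 - 2 * R * cos (l / 2)" using c R by simp
    finally show ?thesis using l(2) by simp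
  qed
  then show "x \<in> cball 0 R" using R by (simp add: abs_le_square_iff[symmetric])
qed

lemma body_subset_cball: "body \<subseteq> cball 0 R"
  unfolding body_def using side_subset_cball by (intro hull_minimal UN_least) auto

lemma cball_subset_body: "cball 0 (1 - R) \<subseteq> body"
  using cw_cball_dual[OF cw_body, of "1 - R" 0] body_subset_cball R by simp

lemma P_in_body: "P m \<in> body"
  using P_in_sides sides_subset_body by blast

text \<open>In this case the axis vertex falls on the outer circle and continues the progression
  \<open>phi\<close>, so all sides become alike.\<close>

lemma h_eq_lD:
  assumes "h = l"
  shows "(2 * real N + 1) * l = pi" "a = l" "P 0 = R *\<^sub>R unit_dir (phi 0)"
proof -
  show 1: "(2 * real N + 1) * l = pi" using h_def assms by (simp add: algebra_simps)
  have "sin l = 2 * sin (l / 2) * cos (l / 2)" using sin_double[of "l / 2"] by simp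
  then have "sin (a / 2) = (2 * R * cos (l / 2)) * sin (l / 2)" using a(3) assms by simp
  then have "sin (a / 2) = sin (l / 2)" using l(2) by simp
  then have "a / 2 = l / 2" using a(1,2) l_le(1) l(1) by (rule_tac sin_inj_pi) simp_all
  then show al: "a = l" by simp
  have "x0 = R * cos h - cos (a / 2)" by (rule x0_def)
  also have "\<dots> = R * cos l - cos (l / 2)" by (simp only: al assms)
  also have "\<dots> = R * (2 * (cos (l / 2))\<^sup>2 - 1) - cos (l / 2)"
    using cos_double_cos[of "l / 2"] by simp
  also have "\<dots> = (2 * R * cos (l / 2)) * cos (l / 2) - R - cos (l / 2)"
    by (simp add: power2_eq_square algebra_simps)
  finally have "x0 = - R" using l(2) by simp
  moreover have "phi 0 + pi = h - l" by (simp add: phi_def)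
  then have "phi 0 + pi = 0" using assms by simp
  then have "unit_dir 0 = - unit_dir (phi 0)" using unit_dir_add_pi[of "phi 0"] by simp
  ultimately show "P 0 = R *\<^sub>R unit_dir (phi 0)" by (simp add: P_0)
qed

text \<open>Three consecutive centres on the outer circle surround 0: with the weights 1,
  \<open>2 * cos l\<close>, 1 they sum to zero. Testing an enclosing disk at these points in their
  own directions eliminates its unknown centre.\<close>

lemma outer_radius:
  assumes "2 \<le> N \<or> h = l" and "body \<subseteq> cball c \<rho>"
  shows "R \<le> \<rho>"
proof -
  \<comment> \<open>\<open>i\<close> starts the triple. Index 0 is taken only when
    \<open>P 0\<close> is on the outer circle, and \<open>l < pi / 2\<close> makes the middle weight
    positive.\<close>
  obtain i where i: "i = 0 \<and> h = l \<or> i = 1" "i + 2 \<le> 2 * N" "l < pi / 2"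
  proof (cases "2 \<le> N")
    case True
    have "3 * l \<le> (2 * real N - 1) * l" using True l by (intro mult_right_mono) auto
    then have "l < pi / 2" using h_def h l by linarith
    then show ?thesis using that[of 1] True by simp
  next
    case False
    then have hl: "h = l" "N = 1" using assms(1) N by auto
    then have "3 * l = pi" using h_def by simp
    then have "l < pi / 2" using pi_gt_zero by linarith
    then show ?thesis using that[of 0] hl by simp
  qed
  have Pi: "P m = R *\<^sub>R unit_dir (phi m)" if "m = i \<or> m = i + 1 \<or> m = i + 2" for m
    using i that P_eq'[of m] h_eq_lD(3) by (cases "m = 0") auto
  define w where "w k = (if k = i + 1 then 2 * cos l else 1)" for k
  have cosl: "cos l > 0" using i(3) l by (intro cos_gt_zero) auto
  have e1: "unit_dir (phi (i + 1)) = - unit_dir (phi i + l)"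
    using unit_dir_add_pi[of "phi i + l"] by (simp add: phi_def algebra_simps)
  have e2: "unit_dir (phi (i + 2)) = unit_dir (phi i + l + l)"
    using unit_dir_add_2pi_int[of "phi i + l + l" 1] by (simp add: phi_def algebra_simps)
  have "unit_dir (phi i + l + l) + unit_dir (phi i) = (2 * cos l) *\<^sub>R unit_dir (phi i + l)"
    using unit_dir_sum[of "phi i + l" l] by simp
  moreover have "P i + P (i + 2) + (2 * cos l) *\<^sub>R P (i + 1) =
      R *\<^sub>R (unit_dir (phi i + l + l) + unit_dir (phi i) - (2 * cos l) *\<^sub>R unit_dir (phi i + l))"
    using Pi e1 e2 by (simp add: scaleR_add_right scaleR_diff_right mult.commute)
  ultimately have zero: "P i + P (i + 2) + (2 * cos l) *\<^sub>R P (i + 1) = 0" by simp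
  have b: "(P m - c) \<bullet> P m \<le> \<rho> * R" if "m = i \<or> m = i + 1 \<or> m = i + 2" for m
  proof -
    have nP: "norm (P m) = R" using Pi[OF that] R by simp
    have "(P m - c) \<bullet> P m \<le> norm (P m - c) * norm (P m)" by (rule norm_cauchy_schwarz)
    also have "\<dots> \<le> \<rho> * norm (P m)"
      using assms(2) P_in_body[of m] by (intro mult_right_mono) (auto simp: dist_norm norm_minus_commute)
    finally show ?thesis using nP by simp
  qed
  have sq: "P m \<bullet> P m = R * R" if "m = i \<or> m = i + 1 \<or> m = i + 2" for m
    using Pi[OF that] R by (simp add: unit_dir_inner)
  have "(P i - c) \<bullet> P i + (P (i + 2) - c) \<bullet> P (i + 2) + (2 * cos l) * ((P (i + 1) - c) \<bullet> P (i + 1))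
      \<le> \<rho> * R + \<rho> * R + (2 * cos l) * (\<rho> * R)"
    using b cosl by (intro add_mono mult_left_mono) auto
  moreover have "(P i - c) \<bullet> P i + (P (i + 2) - c) \<bullet> P (i + 2) + (2 * cos l) * ((P (i + 1) - c) \<bullet> P (i + 1))
      = (2 * cos l + 2) * (R * R) - c \<bullet> (P i + P (i + 2) + (2 * cos l) *\<^sub>R P (i + 1))"
    by (simp add: inner_diff_left inner_add_right sq algebra_simps)
  ultimately have "(2 * cos l + 2) * (R * R) \<le> (2 * cos l + 2) * (\<rho> * R)"
    unfolding zero by (simp add: algebra_simps)
  then show ?thesis using cosl R by simp
qed

lemma outercircle: "2 \<le> N \<or> h = l \<Longrightarrow> is_outercircle body 0 R"
  using outer_radius body_subset_cball unfolding is_outercircle_def by blast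

lemma incircle:
  assumes "2 \<le> N \<or> h = l"
  shows "is_incircle body 0 (1 - R)"
  unfolding is_incircle_def
proof (intro conjI allI impI cball_subset_body)
  show "0 \<le> 1 - R" using R by simp
  fix c \<rho> assume c: "cball c \<rho> \<subseteq> body"
  show "\<rho> \<le> 1 - R"
  proof (cases "0 \<le> \<rho>")
    case True
    have "body \<subseteq> cball c (1 - \<rho>)"
      using cw_cball_dual[OF cw_body True] cw_cball_radius_le[OF cw_body c] c by simp
    then show ?thesis using outer_radius[OF assms] by fastforce
  qed (use R in simp)
qed

text \<open>The angles differ by \<open>(j - i) * (pi + l)\<close>. Equality modulo full turns would
  make \<open>(j - i) * l\<close> a multiple of \<open>pi\<close>, but it lies strictly between 0
  and \<open>pi\<close>.\<close>

lemma phi_inj: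
  assumes "i < j" "(real j - real i) * l < pi"
  shows "unit_dir (phi i) \<noteq> unit_dir (phi j)"
proof
  assume "unit_dir (phi i) = unit_dir (phi j)"
  then obtain k :: int where "phi i = phi j + 2 * pi * of_int k" unfolding unit_dir_eq_iff by blast
  then have "(real j - real i) * l = pi * of_int (int i - int j - 2 * k)"
    by (simp add: phi_def algebra_simps)
  moreover have "0 < (real j - real i) * l" using assms l by simp
  ultimately have "0 < pi * of_int (int i - int j - 2 * k)" "pi * of_int (int i - int j - 2 * k) < pi * 1"
    using assms(2) by simp_all
  then have "0 < (of_int (int i - int j - 2 * k) :: real)" "(of_int (int i - int j - 2 * k) :: real) < 1"
    by (simp_all only: mult_less_cancel_left_pos[OF pi_gt_zero] zero_less_mult_iff) (use pi_gt_zero in auto)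
  then have "0 < int i - int j - 2 * k" "int i - int j - 2 * k < 1" by (simp_all only: of_int_0_less_iff of_int_less_1_iff)
  then show False by linarith
qed

lemma inj_P: "inj_on P {..<2 * N + 1}"
proof (rule linorder_inj_onI')
  fix i j assume ij: "i \<in> {..<2 * N + 1}" "j \<in> {..<2 * N + 1}" "i < j"
  then have j: "P j = R *\<^sub>R unit_dir (phi j)" using P_eq'[of j] by simp
  show "P i \<noteq> P j"
  proof (cases "1 \<le> i")
    case True
    have "(real j - real i) * l \<le> (2 * real N - 1) * l" using ij True l by (intro mult_right_mono) auto
    then have "(real j - real i) * l < pi" using h_def h by linarith
    then show ?thesis using phi_inj[OF ij(3)] P_eq'[of i] True ij R j by auto
  next
    case False
    then have i0: "i = 0" by simp
    show ?thesis
    proof (cases "h = l")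
      case True
      have "(real j - real i) * l < (2 * real N + 1) * l" using ij l by (intro mult_strict_right_mono) auto
      then have "(real j - real i) * l < pi" using h_eq_lD(1)[OF True] by linarith
      then show ?thesis using phi_inj[OF ij(3)] h_eq_lD(3)[OF True] i0 R j by auto
    next
      case False
      then have "norm (P i) < R" using norm_P(2) x0_gt(2) h i0 by simp
      then show ?thesis using j R by auto
    qed
  qed
qed

lemma reuleaux: "reuleaux_polygon body (2 * N + 1) P (\<lambda>m. T m + real m * pi) (\<lambda>m. T (Suc m) - T m)"
  by (rule reuleaux_polygon_body[OF inj_P])

lemma side_lengths:
  shows "T (Suc 0) - T 0 = a" "T (Suc 1) - T 1 = h + (l - a) / 2"
    "T (Suc (2 * N)) - T (2 * N) = h + (l - a) / 2"
    "2 \<le> m \<Longrightarrow> m < 2 * N \<Longrightarrow> T (Suc m) - T m = l"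
  using N h_def by (auto simp: T_eq T0_def field_simps)

lemma regular:
  assumes "h = l"
  shows "regular_reuleaux_polygon body (2 * N + 1)"
proof -
  note e = h_eq_lD[OF assms]
  have "T (Suc m) - T m = l" if "m < 2 * N + 1" for m
  proof -
    have "h + (l - a) / 2 = l" unfolding e(2) using assms by simp
    moreover consider "m = 0" | "m = 1" | "m = 2 * N" | "2 \<le> m" "m < 2 * N"
      using \<open>m < 2 * N + 1\<close> by atomize_elim presburger
    ultimately show ?thesis using side_lengths e(2) by cases (metis One_nat_def)+
  qed
  then show ?thesis unfolding regular_reuleaux_polygon_def
    by (intro exI[of _ P] exI[of _ "\<lambda>m. T m + real m * pi"] exI[of _ "\<lambda>m. T (Suc m) - T m"] conjI reuleaux) simp
qed

lemma tangent:
  assumes "1 \<le> m" "m \<le> 2 * N"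
  shows "tangent_arc_circle (P m) (T m + real m * pi) (T (Suc m) - T m) 0 (1 - R)"
proof -
  let ?s = "h + (real m - 1) * l"
  define x where "x = P m + (-1) ^ m *\<^sub>R unit_dir ?s"
  have x: "x = (R - 1) *\<^sub>R unit_dir (phi m)"
    unfolding x_def P_eq'[OF assms] unit_dir_side by (simp add: scaleR_diff_left)
  have "x \<in> unit_arc (P m) (T m + real m * pi) (T (Suc m) - T m)"
    using side_eq[of m] side_mid[OF assms] unfolding side_def x_def by auto
  moreover have "x \<in> sphere 0 (1 - R)" using R by (simp add: x)
  moreover have "x = ((R - 1) / R) *\<^sub>R P m" using R by (simp add: x P_eq'[OF assms])
  then have "collinear {P m, 0, x}" using collinear_lemma[of "P m" x] by (auto simp: insert_commute)
  ultimately show ?thesis unfolding tangent_arc_circle_def by blast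
qed

text \<open>Tangency would have to occur on the symmetry axis, that is at \<open>s = 0\<close>,
  where the side has distance \<open>x0 + 1 > 1 - R\<close> from the centre.\<close>

lemma not_tangent:
  assumes "h < l"
  shows "\<not> tangent_arc_circle (P 0) (T 0 + real 0 * pi) (T (Suc 0) - T 0) 0 (1 - R)"
proof
  assume "tangent_arc_circle (P 0) (T 0 + real 0 * pi) (T (Suc 0) - T 0) 0 (1 - R)"
  then obtain s where s: "T 0 \<le> s" "s \<le> T (Suc 0)" and x: "norm (P 0 + unit_dir s) = 1 - R"
    "collinear {P 0, 0, P 0 + unit_dir s}"
    unfolding tangent_arc_circle_def unit_arc_def by auto
  have P0: "P 0 \<noteq> 0" using norm_P(2) x0_bound R by auto
  obtain c where "P 0 + unit_dir s = c *\<^sub>R P 0"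
    using x(2) P0 collinear_lemma[of "P 0" "P 0 + unit_dir s"] by (auto simp: insert_commute)
  then have "sin s = 0" unfolding vec_eq_iff forall_2 by (simp add: P_0)
  moreover have "\<bar>s\<bar> < pi" using s a by (auto simp: T_eq T0_def)
  ultimately have "s = 0" using sin_eq_0_pi[of s] by auto
  then have "P 0 + unit_dir s = (x0 + 1) *\<^sub>R unit_dir 0" by (simp add: P_0 scaleR_add_left)
  then have "x0 + 1 \<le> 1 - R" using x(1) by simp
  then show False using x0_gt(2)[OF assms] by simp
qed

end

section \<open>The construction meets the definition of the intermediate shape\<close>

lemma arc_ends_subset: "0 \<le> l \<Longrightarrow> arc_ends p t l \<subseteq> unit_arc p t l"
  by (auto simp: arc_ends_def unit_arc_def)

context omega_shape
begin

abbreviation (input) side_ends :: "nat \<Rightarrow> (real^2) set" where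
  "side_ends m \<equiv> arc_ends (P m) (T m + real m * pi) (T (Suc m) - T m)"

lemma side_ends_eq: "1 \<le> m \<Longrightarrow> side_ends m = {P (m - 1), P (Suc m)}"
  using arc_ends_side_Suc[of "m - 1"] by simp

lemma side_ends_0: "side_ends 0 = {P (2 * N), P 1}"
  using arc_ends_side_0 by simp

lemma side_ends_last: "side_ends (2 * N) = {P (2 * N - 1), P 0}"
  using side_ends_eq[of "2 * N"] N P_shift[of 0] by simp

lemma P_eq_iff: "i < 2 * N + 1 \<Longrightarrow> j < 2 * N + 1 \<Longrightarrow> P i = P j \<longleftrightarrow> i = j"
  using inj_P by (auto simp: inj_on_def)

text \<open>Side 0 plays the role of \<open>k\<close>, its neighbours 1 and \<open>2 * N\<close>
  those of \<open>i\<close> and \<open>j\<close>. With \<open>2 \<le> N\<close> there are three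
  consecutive centres on the outer circle, which fixes both circles.\<close>

lemma intermediate:
  assumes "2 \<le> N" "h < l" "omega_l (1 - R) = l" "omega_a N (1 - R) = a" "omega_h N (1 - R) = h"
  shows "intermediate_omega N (1 - R) body"
proof -
  let ?t = "\<lambda>m. T m + real m * pi" and ?l = "\<lambda>m. T (Suc m) - T m"
  have b: "omega_b N (1 - R) = h + (l - a) / 2" by (simp add: omega_b_def assms)
  \<comment> \<open>A centre is an endpoint only of the two sides next to it in the cyclic order,
    because the centres are distinct.\<close>
  have opposite: "{m. m < 2 * N + 1 \<and> P 0 \<in> side_ends m} = {1, 2 * N}"
  proof (intro equalityI subsetI)
    fix m assume "m \<in> {m. m < 2 * N + 1 \<and> P 0 \<in> side_ends m}"
    then have m: "m < 2 * N + 1" "P 0 \<in> side_ends m" by auto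
    show "m \<in> {1, 2 * N}"
    proof (rule ccontr)
      assume c: "m \<notin> {1, 2 * N}"
      show False
      proof (cases "m = 0")
        case True
        then have "P 0 = P (2 * N) \<or> P 0 = P 1" using m(2) side_ends_0 by simp
        then show False using P_eq_iff[of 0 "2 * N"] P_eq_iff[of 0 1] N by simp
      next
        case False
        then have "P 0 = P (m - 1) \<or> P 0 = P (Suc m)" using m(2) side_ends_eq[of m] by simp
        then show False using P_eq_iff[of 0 "m - 1"] P_eq_iff[of 0 "Suc m"] m(1) c False by auto
      qed
    qed
  next
    fix m assume "m \<in> {1, 2 * N}"
    then show "m \<in> {m. m < 2 * N + 1 \<and> P 0 \<in> side_ends m}"
      using side_ends_eq[of 1] side_ends_last N by auto
  qed
  have outer: "P m \<in> sphere 0 R" if "1 \<le> m" "m \<le> 2 * N" for m using norm_P(1)[OF that] by simp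
  have inner: "P 0 \<notin> sphere 0 R" "1 - R < dist 0 (P 0)" "dist 0 (P 0) < 1 - (1 - R)"
    using norm_P(2) x0_gt(2)[OF assms(2)] x0_bound by auto
  have "side_ends 1 \<inter> sphere 0 R = {P 2}" "side_ends (2 * N) \<inter> sphere 0 R = {P (2 * N - 1)}"
    using side_ends_eq[of 1] side_ends_last outer[of 2] outer[of "2 * N - 1"] inner(1) assms(1)
    by (auto simp: numeral_2_eq_2)
  then have card: "card (side_ends m \<inter> sphere 0 R) = 1" if "m \<in> {1, 2 * N}" for m
    using that by auto
  have meet: "unit_arc (P 1) (?t 1) (?l 1) \<inter> unit_arc (P (2 * N)) (?t (2 * N)) (?l (2 * N)) = {P 0}"
  proof
    have inter: "unit_arc (P i) (?t i) (?l i) \<inter> unit_arc (P j) (?t j) (?l j) \<subseteq> side_ends i \<inter> side_ends j"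
      if "i < 2 * N + 1" "j < 2 * N + 1" "i \<noteq> j" for i j
      using reuleaux that unfolding reuleaux_polygon_def by blast
    have "unit_arc (P 1) (?t 1) (?l 1) \<inter> unit_arc (P (2 * N)) (?t (2 * N)) (?l (2 * N))
        \<subseteq> side_ends 1 \<inter> side_ends (2 * N)"
      using N by (intro inter) auto
    also have "\<dots> \<subseteq> {P 0}"
      using side_ends_eq[of 1] side_ends_last P_eq_iff[of 2 "2 * N - 1"] P_eq_iff[of 0 "2 * N - 1"] assms(1)
      by (auto simp: numeral_2_eq_2)
    finally show "unit_arc (P 1) (?t 1) (?l 1) \<inter> unit_arc (P (2 * N)) (?t (2 * N)) (?l (2 * N)) \<subseteq> {P 0}" .
    have "side_ends 1 \<subseteq> unit_arc (P 1) (?t 1) (?l 1)"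
      "side_ends (2 * N) \<subseteq> unit_arc (P (2 * N)) (?t (2 * N)) (?l (2 * N))"
      using T_less[of 1] T_less[of "2 * N"] by (intro arc_ends_subset; simp)+
    then show "{P 0} \<subseteq> unit_arc (P 1) (?t 1) (?l 1) \<inter> unit_arc (P (2 * N)) (?t (2 * N)) (?l (2 * N))"
      using side_ends_eq[of 1] side_ends_last by auto
  qed
  have N2: "Suc 0 \<noteq> 2 * N" "0 < 2 * N" using N by auto
  have circles: "is_incircle body 0 (1 - R)" "is_outercircle body 0 (1 - (1 - R))"
    using incircle outercircle assms(1) by simp_all
  show ?thesis unfolding intermediate_omega_def
  proof (rule exI[of _ P], rule exI[of _ ?t], rule exI[of _ ?l], rule exI[of _ 0],
      rule conjI[OF reuleaux], rule conjI[OF circles(1)], rule conjI[OF circles(2)],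
      rule exI[of _ 0], rule exI[of _ 1], rule exI[of _ "2 * N"],
      intro conjI exI[of _ "P 0"] allI ballI impI)
    show "\<not> tangent_arc_circle (P 0) (?t 0) (?l 0) 0 (1 - R)" using not_tangent[OF assms(2)] by simp
    show "side_ends 0 \<subseteq> sphere 0 (1 - (1 - R))"
      using side_ends_0 outer[of 1] outer[of "2 * N"] N by simp
    show "?l 0 = omega_a N (1 - R)" using side_lengths(1) assms(4) by simp
  next
    fix m assume m: "m \<in> {1, 2 * N}"
    show "card (side_ends m \<inter> sphere 0 (1 - (1 - R))) = 1" using card[OF m] by simp
    show "?l m = omega_b N (1 - R)" using m side_lengths(2,3) b by auto
  next
    fix m assume m: "m < 2 * N + 1" "m \<noteq> 0"
    show "tangent_arc_circle (P m) (?t m) (?l m) 0 (1 - R)" using m by (intro tangent) auto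
  next
    fix m assume m: "m < 2 * N + 1" "m \<notin> {0, 1, 2 * N}"
    then have m': "2 \<le> m" "m < 2 * N" by auto
    show "side_ends m \<subseteq> sphere 0 (1 - (1 - R))"
      using side_ends_eq[of m] outer[of "m - 1"] outer[of "Suc m"] m' by auto
    show "?l m = omega_l (1 - R)" using side_lengths(4)[OF m'] assms(3) by simp
  qed (use opposite meet inner N2 in auto)
qed

end


section \<open>Parameters\<close>

lemma reuleaux_inradius_props:
  assumes "2 \<le> n"
  shows "reuleaux_inradius n < 1 / 2" "2 * (1 - reuleaux_inradius n) * cos (pi / (2 * real n)) = 1"
proof -
  have "0 < pi / (2 * real n)" "pi / (2 * real n) < pi / 2"
    using assms by (auto simp: field_simps)
  then have c: "0 < cos (pi / (2 * real n))" "cos (pi / (2 * real n)) < 1"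
    using cos_gt_zero cos_monotone_0_pi[of 0 "pi / (2 * real n)"] by auto
  then show "reuleaux_inradius n < 1 / 2" "2 * (1 - reuleaux_inradius n) * cos (pi / (2 * real n)) = 1"
    by (auto simp: reuleaux_inradius_def field_simps)
qed

text \<open>Since \<open>cos (arctan q) = 1 / sqrt (1 + q\<^sup>2)\<close>, the formula for
  \<open>omega_l\<close> is the solution of \<open>2 * R * cos (l / 2) = 1\<close> with
  \<open>R = 1 - r\<close>.\<close>

lemma omega_l_props:
  assumes "r < 1 / 2"
  shows "0 < omega_l r" "omega_l r < pi" "2 * (1 - r) * cos (omega_l r / 2) = 1"
proof -
  define q where "q = sqrt (4 * (1 - r)\<^sup>2 - 1)"
  have "1\<^sup>2 < (2 * (1 - r))\<^sup>2" using assms by (intro power_strict_mono) auto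
  moreover have sq: "(2 * (1 - r))\<^sup>2 = 4 * (1 - r)\<^sup>2" by (simp add: power2_eq_square algebra_simps)
  ultimately have q2: "4 * (1 - r)\<^sup>2 - 1 > 0" by simp
  then have "q > 0" "q\<^sup>2 = 4 * (1 - r)\<^sup>2 - 1" by (auto simp: q_def)
  then have "1 + q\<^sup>2 = (2 * (1 - r))\<^sup>2" unfolding sq by simp
  then have "sqrt (1 + q\<^sup>2) = 2 * (1 - r)" using assms by simp
  moreover have l: "omega_l r / 2 = arctan q" by (simp add: omega_l_def q_def)
  ultimately have "cos (omega_l r / 2) = 1 / (2 * (1 - r))" by (simp add: cos_arctan)
  then show "2 * (1 - r) * cos (omega_l r / 2) = 1" using assms by simp
  show "0 < omega_l r" using l \<open>q > 0\<close> zero_less_arctan_iff[of q] by linarith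
  show "omega_l r < pi" using l arctan_ubound[of q] by linarith
qed

text \<open>The regular polygon has half side length \<open>pi / (2 * n)\<close>, and in both cases
  the inradius is fixed by the cosine of half the side length. Comparing inradii thus amounts to
  comparing \<open>n * omega_l r\<close> with \<open>pi\<close>.\<close>

lemma reuleaux_inradius_iff:
  assumes "2 \<le> n" "r < 1 / 2"
  shows "reuleaux_inradius n \<le> r \<longleftrightarrow> real n * omega_l r \<le> pi"
    "r \<le> reuleaux_inradius n \<longleftrightarrow> pi \<le> real n * omega_l r"
proof -
  note l = omega_l_props[OF assms(2)] and n = reuleaux_inradius_props[OF assms(1)]
  define x where "x = pi / (2 * real n)"
  have x: "0 \<le> x" "x \<le> pi" "real n * (2 * x) = pi" using assms(1) by (auto simp: x_def field_simps)
  have c: "cos x \<le> cos (omega_l r / 2) \<longleftrightarrow> omega_l r / 2 \<le> x"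
    "cos (omega_l r / 2) \<le> cos x \<longleftrightarrow> x \<le> omega_l r / 2"
    using x l by (auto simp: cos_mono_le_eq)
  have "cos x = 1 / (2 * (1 - reuleaux_inradius n))" "cos (omega_l r / 2) = 1 / (2 * (1 - r))"
    using n l(3) assms(2) unfolding x_def by (auto simp: field_simps)
  moreover have "1 / (2 * A) \<le> 1 / (2 * B) \<longleftrightarrow> B \<le> A" if "0 < A" "0 < B" for A B :: real
    using that by (simp add: field_simps)
  from this[of "1 - reuleaux_inradius n" "1 - r"] this[of "1 - r" "1 - reuleaux_inradius n"]
  have "1 / (2 * (1 - reuleaux_inradius n)) \<le> 1 / (2 * (1 - r)) \<longleftrightarrow> reuleaux_inradius n \<le> r"
    "1 / (2 * (1 - r)) \<le> 1 / (2 * (1 - reuleaux_inradius n)) \<longleftrightarrow> r \<le> reuleaux_inradius n"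
    using assms(2) n(1) by linarith+
  ultimately have c': "cos x \<le> cos (omega_l r / 2) \<longleftrightarrow> reuleaux_inradius n \<le> r"
    "cos (omega_l r / 2) \<le> cos x \<longleftrightarrow> r \<le> reuleaux_inradius n"
    by (simp_all only:)
  have "real n * omega_l r \<le> pi \<longleftrightarrow> omega_l r / 2 \<le> x" "pi \<le> real n * omega_l r \<longleftrightarrow> x \<le> omega_l r / 2"
    using x(3) assms(1) mult_le_cancel_left_pos[of "real n" "omega_l r" "2 * x"]
      mult_le_cancel_left_pos[of "real n" "2 * x" "omega_l r"] by auto
  then show "reuleaux_inradius n \<le> r \<longleftrightarrow> real n * omega_l r \<le> pi"
    "r \<le> reuleaux_inradius n \<longleftrightarrow> pi \<le> real n * omega_l r"
    using c c' by blast+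
qed

lemma reuleaux_inradius_less_iff:
  assumes "2 \<le> m" "2 \<le> n"
  shows "reuleaux_inradius m < reuleaux_inradius n \<longleftrightarrow> m < n"
proof -
  let ?l = "omega_l (reuleaux_inradius n)"
  note n = reuleaux_inradius_props(1)[OF assms(2)]
  have "real n * ?l = pi"
    using reuleaux_inradius_iff[OF assms(2) n] by linarith
  then have "pi \<le> real m * ?l \<longleftrightarrow> real n * ?l \<le> real m * ?l" by simp
  also have "\<dots> \<longleftrightarrow> n \<le> m" using omega_l_props(1)[OF n] by simp
  finally show ?thesis using reuleaux_inradius_iff(2)[OF assms(1) n] by linarith
qed

lemma reuleaux_inradius_3: "reuleaux_inradius 3 = 1 - 1 / sqrt 3"
proof -
  have "pi / (2 * real 3) = pi / 6" by simp
  then show ?thesis by (simp add: reuleaux_inradius_def cos_30)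
qed

lemma omega_h_eq: "2 * omega_h N r + (2 * real N - 1) * omega_l r = pi"
  by (simp add: omega_h_def field_simps)

text \<open>In \<open>2 * h + (2 * N - 1) * l = pi\<close>, the value \<open>h = l\<close> means
  \<open>(2 * N + 1) * l = pi\<close> and \<open>h = 0\<close> means
  \<open>(2 * N - 1) * l = pi\<close>: these are the two ends of the parameter interval.\<close>

lemma omega_h_iff:
  assumes "r < 1 / 2" "1 \<le> N"
  shows "omega_h N r \<le> omega_l r \<longleftrightarrow> r \<le> reuleaux_inradius (2 * N + 1)"
    "omega_h N r = omega_l r \<longleftrightarrow> r = reuleaux_inradius (2 * N + 1)"
    "2 \<le> N \<Longrightarrow> 0 < omega_h N r \<longleftrightarrow> reuleaux_inradius (2 * N - 1) < r"
    "2 \<le> N \<Longrightarrow> 0 \<le> omega_h N r \<longleftrightarrow> reuleaux_inradius (2 * N - 1) \<le> r"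
    "2 \<le> N \<Longrightarrow> 0 = omega_h N r \<longleftrightarrow> reuleaux_inradius (2 * N - 1) = r"
proof -
  have e: "real (2 * N + 1) * omega_l r = (2 * real N - 1) * omega_l r + 2 * omega_l r"
    by (simp add: algebra_simps)
  note i = reuleaux_inradius_iff[OF _ assms(1), of "2 * N + 1", unfolded e]
  show "omega_h N r \<le> omega_l r \<longleftrightarrow> r \<le> reuleaux_inradius (2 * N + 1)"
    "omega_h N r = omega_l r \<longleftrightarrow> r = reuleaux_inradius (2 * N + 1)"
    using i assms(2) omega_h_eq[of N r] by auto
  assume "2 \<le> N"
  then have e: "real (2 * N - 1) * omega_l r = (2 * real N - 1) * omega_l r"
    by (simp add: of_nat_diff)
  have N: "2 \<le> 2 * N - 1" using \<open>2 \<le> N\<close> by simp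
  note j = reuleaux_inradius_iff[OF N assms(1), unfolded e]
  show "0 < omega_h N r \<longleftrightarrow> reuleaux_inradius (2 * N - 1) < r"
    "0 \<le> omega_h N r \<longleftrightarrow> reuleaux_inradius (2 * N - 1) \<le> r"
    "0 = omega_h N r \<longleftrightarrow> reuleaux_inradius (2 * N - 1) = r"
    using j omega_h_eq[of N r] by auto
qed

lemma omega_shapeI:
  assumes "1 \<le> N" "0 < r" "r < 1 / 2" "0 < omega_h N r" "omega_h N r \<le> omega_l r"
  shows "omega_shape N (1 - r) (omega_l r) (omega_h N r) (omega_a N r)"
proof
  note l = omega_l_props[OF assms(3)]
  have "1 * omega_l r \<le> (2 * real N - 1) * omega_l r"
    using assms(1) l by (intro mult_right_mono) auto
  then have h: "0 < omega_h N r" "omega_h N r < pi / 2"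
    using omega_h_eq[of N r] assms(4) l by linarith+
  have s: "0 < sin (omega_h N r)" using h by (intro sin_gt_zero) auto
  define y where "y = (1 - r) * sin (omega_h N r)"
  \<comment> \<open>Positivity of \<open>r\<close> keeps the argument of \<open>arcsin\<close> below
    1, so that \<open>a < pi\<close>.\<close>
  have "y < 1 * 1" unfolding y_def
    using assms(2,3) s by (intro mult_less_le_imp_less) auto
  moreover have "0 < y" using assms(3) s by (simp add: y_def)
  ultimately have y: "0 < y" "y < 1" by auto
  have "arcsin 0 < arcsin y" "arcsin y < arcsin 1" using y by (intro arcsin_less_arcsin; simp)+
  then have ab: "0 < arcsin y" "arcsin y < pi / 2" by auto
  have a: "omega_a N r = 2 * arcsin y" by (simp add: omega_a_def y_def)
  show "0 < omega_a N r" "omega_a N r < pi" using ab a by auto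
  show "sin (omega_a N r / 2) = (1 - r) * sin (omega_h N r)"
    using y by (simp add: a y_def[symmetric])
qed (use assms omega_l_props[OF assms(3)] omega_h_eq[of N r] in auto)

lemma r3_pos: "0 < 1 - 1 / sqrt (3::real)"
  by (simp add: real_less_rsqrt)

lemma ex_regular:
  assumes "1 \<le> N"
  obtains K where "regular_reuleaux_polygon K (2 * N + 1)" "is_incircle K 0 (reuleaux_inradius (2 * N + 1))"
proof -
  let ?r = "reuleaux_inradius (2 * N + 1)"
  have r: "?r < 1 / 2" using reuleaux_inradius_props assms by simp
  have "reuleaux_inradius 3 \<le> ?r"
    using reuleaux_inradius_less_iff[of "2 * N + 1" 3] assms by (simp add: not_less[symmetric])
  then have "0 < ?r" using reuleaux_inradius_3 r3_pos by linarith
  moreover have hl: "omega_h N ?r = omega_l ?r" using omega_h_iff(2)[OF r assms] by simp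
  ultimately interpret omega_shape N "1 - ?r" "omega_l ?r" "omega_h N ?r" "omega_a N ?r"
    using assms r omega_l_props(1)[OF r] by (intro omega_shapeI) auto
  have "is_incircle body 0 (1 - (1 - ?r))" by (rule incircle[OF disjI2[OF hl]])
  then have "is_incircle body 0 ?r" by (simp only: diff_diff_eq2 add_diff_cancel_left')
  then show thesis by (rule that[OF regular[OF hl]])
qed

lemma ex_intermediate:
  assumes "2 \<le> N" "reuleaux_inradius (2 * N - 1) < r" "r < reuleaux_inradius (2 * N + 1)"
  obtains K where "intermediate_omega N r K" "is_incircle K 0 r"
proof -
  have r: "r < 1 / 2" using reuleaux_inradius_props(1)[of "2 * N + 1"] assms by simp
  have N: "1 \<le> N" using assms by simp
  have "reuleaux_inradius 3 \<le> reuleaux_inradius (2 * N - 1)"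
    using reuleaux_inradius_less_iff[of "2 * N - 1" 3] assms by (simp add: not_less[symmetric])
  then have "0 < r" using reuleaux_inradius_3 r3_pos assms(2) by linarith
  moreover have hl: "0 < omega_h N r" "omega_h N r < omega_l r"
    using omega_h_iff(1,2)[OF r N] omega_h_iff(3)[OF r N assms(1)] assms(2,3) by auto
  ultimately interpret omega_shape N "1 - r" "omega_l r" "omega_h N r" "omega_a N r"
    using N r by (intro omega_shapeI) auto
  show thesis using that[of body] intermediate[OF assms(1) hl(2)] incircle assms(1) by simp
qed

text \<open>\<open>omega_l r\<close> is positive for \<open>r < 1 / 2\<close>, so a large multiple
  of it exceeds \<open>pi\<close>.\<close>

lemma reuleaux_inradius_tendsto:
  assumes "r < 1 / 2"
  obtains N where "1 \<le> N" "r < reuleaux_inradius (2 * N + 1)"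
proof -
  note l = omega_l_props[OF assms]
  obtain N :: nat where N: "pi / omega_l r < real N" using reals_Archimedean2 by blast
  then have "pi < real N * omega_l r" using l by (simp add: pos_divide_less_eq)
  moreover have "real N * omega_l r \<le> real (2 * N + 1) * omega_l r"
    using l by (intro mult_right_mono) auto
  moreover have "1 \<le> N"
  proof (rule ccontr)
    assume "\<not> 1 \<le> N"
    then have "N = 0" by simp
    then show False using \<open>pi < real N * omega_l r\<close> pi_gt_zero by simp
  qed
  ultimately show thesis using that[of N] reuleaux_inradius_iff(1)[of "2 * N + 1" r] assms by fastforce
qed

lemma ex_omega_index:
  assumes "1 - 1 / sqrt 3 \<le> r" "r < 1 / 2"
  obtains N where "2 \<le> N" "reuleaux_inradius (2 * N - 1) \<le> r" "r < reuleaux_inradius (2 * N + 1)"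
proof -
  define N where "N = (LEAST N. r < reuleaux_inradius (2 * N + 1) \<and> 1 \<le> N)"
  have N: "r < reuleaux_inradius (2 * N + 1) \<and> 1 \<le> N"
    unfolding N_def by (rule LeastI_ex) (use reuleaux_inradius_tendsto[OF assms(2)] in blast)
  have "N \<noteq> 1" using N assms(1) reuleaux_inradius_3 by (auto simp: numeral_3_eq_3)
  then have "2 \<le> N" using N by simp
  then have "\<not> (r < reuleaux_inradius (2 * (N - 1) + 1) \<and> 1 \<le> N - 1)"
    using not_less_Least[of "N - 1" "\<lambda>N. r < reuleaux_inradius (2 * N + 1) \<and> 1 \<le> N"] N_def by auto
  moreover have "2 * (N - 1) + 1 = 2 * N - 1" using \<open>2 \<le> N\<close> by simp
  moreover have "1 \<le> N - 1" using \<open>2 \<le> N\<close> by simp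
  ultimately have "reuleaux_inradius (2 * N - 1) \<le> r" by (simp add: not_less)
  then show thesis using that \<open>2 \<le> N\<close> N by blast
qed

lemma ex_is_Omega:
  assumes "1 - 1 / sqrt 3 \<le> r" "r < 1 / 2"
  shows "\<exists>K. is_Omega r K"
proof -
  obtain N where N: "2 \<le> N" "reuleaux_inradius (2 * N - 1) \<le> r" "r < reuleaux_inradius (2 * N + 1)"
    using ex_omega_index[OF assms] by blast
  show ?thesis
  proof (cases "reuleaux_inradius (2 * N - 1) = r")
    case True
    have e: "2 * (N - 1) + 1 = 2 * N - 1" "1 \<le> N - 1" using N by auto
    obtain K where "regular_reuleaux_polygon K (2 * (N - 1) + 1)" using ex_regular[OF e(2)] by blast
    then have "is_Omega r K" unfolding is_Omega_def using True e by (intro disjI1 exI[of _ "N - 1"]) simp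
    then show ?thesis by blast
  next
    case False
    then have "reuleaux_inradius (2 * N - 1) < r" using N by simp
    then obtain K where "intermediate_omega N r K" using ex_intermediate N by blast
    then show ?thesis unfolding is_Omega_def using N \<open>reuleaux_inradius (2 * N - 1) < r\<close> by blast
  qed
qed

text \<open>Besides the incircle only one vertex and the arc centred at it are recorded; they
  suffice to place a copy through prescribed points in \<open>ex_cw_triangle\<close>.\<close>

lemma ex_reuleaux_triangle:
  obtains K p t where "constant_width_one K" "is_incircle K 0 (1 - 1 / sqrt 3)"
    "p \<in> K" "unit_arc p t (pi / 3) \<subseteq> K"
proof -
  define r :: real where "r = 1 - 1 / sqrt 3"
  have r3: "reuleaux_inradius (2 * 1 + 1) = r" using reuleaux_inradius_3 by (simp add: r_def numeral_3_eq_3)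
  have r: "r < 1 / 2" using reuleaux_inradius_props(1)[of "2 * 1 + 1"] r3 by simp
  have "0 < r" unfolding r_def by (rule r3_pos)
  moreover have hl: "omega_h 1 r = omega_l r" using omega_h_iff(2)[OF r, of 1] r3 by simp
  ultimately interpret omega_shape 1 "1 - r" "omega_l r" "omega_h 1 r" "omega_a 1 r"
    using r omega_l_props(1)[OF r] by (intro omega_shapeI) auto
  have "3 * omega_l r = pi" using h_eq_lD(1)[OF hl] by simp
  then have l3: "omega_l r = pi / 3" by simp
  have len: "T (Suc 0) - T 0 = pi / 3"
    by (rule trans[OF side_lengths(1) trans[OF h_eq_lD(2)[OF hl] l3]])
  have "side 0 = unit_arc (P 0) (T 0) (pi / 3)" unfolding side_def len by simp
  then have "unit_arc (P 0) (T 0) (pi / 3) \<subseteq> body" using side_subset[of 0] sides_subset_body by blast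
  then show thesis using that[OF cw_body _ P_in_body] incircle hl r_def by simp
qed


section \<open>The cyclic order of the sides\<close>

lemma unit_dir_add_int_pi: "unit_dir (s + pi * of_int z) = (if even z then 1 else - 1) *\<^sub>R unit_dir s"
proof (cases "even z")
  case True
  then obtain y where "z = 2 * y" by blast
  then show ?thesis using unit_dir_add_2pi_int[of s y] by (simp add: mult_ac)
next
  case False
  then obtain y where "z = 2 * y + 1" by (auto elim: oddE)
  then have "unit_dir (s + pi * of_int z) = unit_dir ((s + pi) + 2 * pi * of_int y)"
    by (simp add: algebra_simps)
  then show ?thesis using False unfolding unit_dir_add_2pi_int unit_dir_add_pi by simp
qed

locale reuleaux_sides =
  fixes K :: "(real^2) set" and n :: nat and p :: "nat \<Rightarrow> real^2" and t l :: "nat \<Rightarrow> real"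
  assumes polygon: "reuleaux_polygon K n p t l"
begin

lemma cw: "constant_width_one K"
  using polygon unfolding reuleaux_polygon_def by blast

lemma len: "i < n \<Longrightarrow> 0 < l i" "i < n \<Longrightarrow> l i < 2 * pi"
  using polygon unfolding reuleaux_polygon_def by blast+

lemma p_eqD: "i < n \<Longrightarrow> j < n \<Longrightarrow> p i = p j \<Longrightarrow> i = j"
  using polygon unfolding reuleaux_polygon_def inj_on_def by blast

lemma frontier_eq: "frontier K = (\<Union>i<n. unit_arc (p i) (t i) (l i))"
  using polygon unfolding reuleaux_polygon_def by blast

lemma frontier_subset: "frontier K \<subseteq> K"
  using frontier_subset_closed compact_imp_closed cwD(1)[OF cw] by blast

lemma arc_in_K:
  assumes "i < n" "s \<in> {t i..t i + l i}"
  shows "p i + unit_dir s \<in> K"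
proof -
  have "p i + unit_dir s \<in> unit_arc (p i) (t i) (l i)" using assms(2) unfolding unit_arc_def by blast
  then show ?thesis using frontier_eq frontier_subset assms(1) by blast
qed

lemma p_in_K:
  assumes "i < n"
  shows "p i \<in> K"
proof -
  obtain j where j: "j < n" "p i \<in> arc_ends (p j) (t j) (l j)"
    using polygon assms unfolding reuleaux_polygon_def by blast
  then have "p i \<in> unit_arc (p j) (t j) (l j)"
    using arc_ends_subset[of "l j"] len(1)[OF j(1)] by auto
  then show ?thesis using frontier_eq frontier_subset j(1) by blast
qed

text \<open>The centre and the point of the side both lie in \<open>K\<close> at distance 1, which
  is the width, so they lie on the two supporting lines.\<close>

lemma support:
  assumes "i < n" "s \<in> {t i..t i + l i}"
  shows "(p i + unit_dir s) \<bullet> unit_dir s = hsup K (unit_dir s)"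
    "p i \<bullet> (- unit_dir s) = hsup K (- unit_dir s)"
proof -
  have "(p i + unit_dir s) \<bullet> unit_dir s \<le> hsup K (unit_dir s)" "p i \<bullet> (- unit_dir s) \<le> hsup K (- unit_dir s)"
    using hsup_ge[OF cwD(1)[OF cw]] arc_in_K[OF assms] p_in_K[OF assms(1)] by blast+
  moreover have "hsup K (unit_dir s) + hsup K (- unit_dir s) = 1" using cw_hsup[OF cw] by simp
  moreover have "(p i + unit_dir s) \<bullet> unit_dir s = p i \<bullet> unit_dir s + 1"
    by (simp add: inner_add_left unit_dir_inner)
  ultimately show "(p i + unit_dir s) \<bullet> unit_dir s = hsup K (unit_dir s)"
    "p i \<bullet> (- unit_dir s) = hsup K (- unit_dir s)"
    unfolding inner_minus_right by linarith+
qed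

lemma same_direction:
  assumes "i < n" "s \<in> {t i..t i + l i}" "j < n" "s' \<in> {t j..t j + l j}" "unit_dir s = unit_dir s'"
  shows "i = j"
proof -
  have "p i + unit_dir s = p j + unit_dir s"
    using support(1)[OF assms(1,2)] support(1)[OF assms(3,4)] arc_in_K[OF assms(1,2)] arc_in_K[OF assms(3,4)]
    unfolding assms(5) by (intro cw_face_unique[OF cw norm_unit_dir])
  then show ?thesis using p_eqD assms(1,3) by simp
qed

text \<open>The centre of side \<open>j\<close> is the face point opposite to its arc. Where the
  arcs have opposite normals, this face point lies on side \<open>i\<close>.\<close>

lemma opposite_direction:
  assumes "i < n" "s \<in> {t i..t i + l i}" "j < n" "s' \<in> {t j..t j + l j}" "unit_dir s = - unit_dir s'"
  shows "p j = p i + unit_dir s"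
proof -
  have "p j \<bullet> unit_dir s = hsup K (unit_dir s)" using support(2)[OF assms(3,4)] unfolding assms(5) by simp
  then show ?thesis
    using cw_face_unique[OF cw norm_unit_dir p_in_K[OF assms(3)] _ arc_in_K[OF assms(1,2)]
        support(1)[OF assms(1,2)]] by simp
qed

text \<open>Two sides can have opposite normals at an isolated direction only: otherwise the centre
  of one would coincide with two different points of the other.\<close>

lemma opposite_overlap:
  assumes "i < n" "s \<in> {t i..t i + l i}" "s + d \<in> {t i..t i + l i}"
    and "j < n" "s' \<in> {t j..t j + l j}" "s' + d \<in> {t j..t j + l j}"
    and opp: "unit_dir s = - unit_dir s'" and d: "0 < \<bar>d\<bar>" "\<bar>d\<bar> < 2 * pi"
  shows False
proof -
  have "unit_dir s = unit_dir (s' + pi)" using opp unit_dir_add_pi by simp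
  then obtain k :: int where "s = s' + pi + 2 * pi * of_int k" unfolding unit_dir_eq_iff by blast
  then have "s + d = (s' + d + pi) + 2 * pi * of_int k" by simp
  then have "unit_dir (s + d) = - unit_dir (s' + d)" by (simp only: unit_dir_add_2pi_int unit_dir_add_pi)
  then have "p i + unit_dir s = p i + unit_dir (s + d)"
    using opposite_direction[OF assms(1,2,4,5) opp] opposite_direction[OF assms(1,3,4,6)] by simp
  then obtain k :: int where "s + d = s + 2 * pi * of_int k"
    using unit_dir_eq_iff[of "s + d" s] by auto
  then have "\<bar>d\<bar> = 2 * pi * \<bar>of_int k\<bar>" by (simp add: abs_mult)
  then have "\<bar>of_int k\<bar> < (1::real)" "k \<noteq> 0" using d by auto
  moreover from this(1) have "k = 0" by linarith
  ultimately show False by simp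
qed

text \<open>At a direction that is no normal of a side up to sign, both antipodal contact points are
  endpoints of sides, so the direction is a difference of two points of a finite set. The uncovered
  directions form an open set, which would be infinite.\<close>

lemma covering:
  assumes "norm v = 1"
  shows "\<exists>i<n. \<exists>s\<in>{t i..t i + l i}. v = unit_dir s \<or> v = - unit_dir s"
proof -
  define C where "C = (\<Union>i<n. unit_arc 0 (t i) (l i) \<union> uminus ` unit_arc 0 (t i) (l i))"
  have C: "v \<in> C \<longleftrightarrow> (\<exists>i<n. \<exists>s\<in>{t i..t i + l i}. v = unit_dir s \<or> v = - unit_dir s)" for v
    by (auto simp: C_def unit_arc_def)
  have "compact C" unfolding C_def
    by (intro compact_UN finite_lessThan compact_Un compact_unit_arc compact_continuous_image continuous_intros)
  define E where "E = (\<Union>i<n. arc_ends (p i) (t i) (l i))"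
  have "finite E" by (auto simp: E_def arc_ends_def)
  have end_or_covered: "x \<in> E" if x: "x \<in> K" "x \<bullet> v = hsup K v" and v: "norm v = 1" "v \<notin> C" for x v
  proof -
    have "x \<in> frontier K" using cw_frontier_iff[OF cw] x v by blast
    then obtain i s where i: "i < n" "s \<in> {t i..t i + l i}" "x = p i + unit_dir s"
      unfolding frontier_eq unit_arc_def by auto
    obtain w where w: "v = unit_dir w" using ex_unit_dir[OF v(1)] by blast
    have "s = t i \<or> s = t i + l i"
    proof (rule ccontr)
      assume "\<not> (s = t i \<or> s = t i + l i)"
      then have "unit_dir w = unit_dir s"
        using i x w by (intro arc_interior_normal[OF cw arc_in_K[OF i(1)]]) auto
      then have "v \<in> C" unfolding C using i w by blast
      then show False using v by simp
    qed
    then show ?thesis using i by (auto simp: E_def arc_ends_def)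
  qed
  have uncovered: "v \<in> (\<lambda>(x, y). x - y) ` (E \<times> E)" if v: "norm v = 1" "v \<notin> C" for v
  proof -
    obtain x where x: "x \<in> K" "x \<bullet> v = hsup K v" using hsup_attained[OF cwD(1,3)[OF cw], of v] by blast
    have "- v \<notin> C" using v(2) unfolding C by (metis minus_minus)
    then have "x \<in> E" "x - v \<in> E"
      using end_or_covered[OF x v] end_or_covered[OF cw_antipode[OF cw v(1) x]] v(1) by auto
    then have "(x, x - v) \<in> E \<times> E" by simp
    then show ?thesis by (rule rev_image_eqI) simp
  qed
  have "v \<in> C"
  proof (rule ccontr)
    assume nv: "v \<notin> C"
    obtain w where w: "v = unit_dir w" using ex_unit_dir[OF assms] by blast
    have "open (unit_dir -` (- C))"
      using continuous_on_unit_dir compact_imp_closed[OF \<open>compact C\<close>]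
      by (intro open_vimage) (auto simp: open_Compl)
    moreover have "w \<in> unit_dir -` (- C)" using nv w by simp
    ultimately obtain e where e: "e > 0" "ball w e \<subseteq> unit_dir -` (- C)" unfolding open_contains_ball by blast
    \<comment> \<open>An interval of length at most \<open>pi\<close> on which
      \<open>unit_dir\<close> is injective, so that its image is infinite.\<close>
    define d where "d = min e pi"
    have d: "0 < d" "d \<le> e" "d \<le> pi" using e(1) by (auto simp: d_def)
    have "unit_dir ` {w<..<w + d} \<subseteq> (\<lambda>(x, y). x - y) ` (E \<times> E)"
    proof
      fix u assume "u \<in> unit_dir ` {w<..<w + d}"
      then obtain s where s: "w < s" "s < w + d" "u = unit_dir s" by auto
      then have "s \<in> ball w e" using d by (simp add: dist_real_def)
      then have "u \<notin> C" using e(2) s(3) by auto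
      then show "u \<in> (\<lambda>(x, y). x - y) ` (E \<times> E)" using uncovered s(3) norm_unit_dir by blast
    qed
    then have "finite (unit_dir ` {w<..<w + d})" using \<open>finite E\<close> finite_subset by blast
    moreover have "inj_on unit_dir {w<..<w + d}"
    proof (rule inj_onI)
      fix x y assume xy: "x \<in> {w<..<w + d}" "y \<in> {w<..<w + d}" "unit_dir x = unit_dir y"
      then obtain k :: int where k: "x = y + 2 * pi * of_int k" unfolding unit_dir_eq_iff by blast
      then have "2 * pi * \<bar>of_int k\<bar> = \<bar>x - y\<bar>" by (simp add: abs_mult)
      also have "\<dots> < 2 * pi * 1" using xy(1,2) d pi_gt_zero by auto
      finally have "\<bar>of_int k\<bar> < (1::real)" using pi_gt_zero by simp
      then have "k = 0" by linarith
      then show "x = y" using k by simp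
    qed
    ultimately have "finite {w<..<w + d}" using finite_image_iff by blast
    then show False using d by (simp add: infinite_Ioo)
  qed
  then show ?thesis using C by simp
qed

text \<open>Directions just past the end of side \<open>i\<close> are covered by some side up to
  sign. The same sign would give side \<open>i\<close> again, so the sign is opposite, and by
  \<open>opposite_overlap\<close> that side must begin exactly there.\<close>

lemma successor:
  assumes i: "i < n"
  shows "\<exists>j<n. unit_dir (t j) = - unit_dir (t i + l i) \<and> p j = p i + unit_dir (t i + l i)"
proof -
  define u where "u = t i + l i"
  have u: "u \<in> {t i..t i + l i}" using len(1)[OF i] by (simp add: u_def)
  \<comment> \<open>\<open>D (j, b)\<close> collects the angles whose direction, or opposite
    direction if \<open>b\<close> is false, belongs to side \<open>j\<close>. These finitely many
    closed sets cover the line.\<close>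
  define D where "D = (\<lambda>(j, b). {w. (if b then unit_dir w else - unit_dir w) \<in> unit_arc 0 (t j) (l j)})"
  have D_iff: "w \<in> D (j, b) \<longleftrightarrow> (\<exists>s\<in>{t j..t j + l j}. (if b then unit_dir w else - unit_dir w) = unit_dir s)"
    for w j b by (auto simp: D_def unit_arc_def)
  have closed_D: "closed (D jb)" for jb
  proof -
    obtain j b where jb: "jb = (j, b)" by (cases jb)
    have *: "D jb = (\<lambda>w. if b then unit_dir w else - unit_dir w) -` unit_arc 0 (t j) (l j)"
      by (auto simp: D_def jb)
    have "continuous_on UNIV (\<lambda>w. if b then unit_dir w else - unit_dir w)"
      by (cases b) (simp_all add: continuous_on_unit_dir continuous_on_minus)
    then show ?thesis
      unfolding * using compact_imp_closed[OF compact_unit_arc] by (intro closed_vimage)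
  qed
  have cover: "\<exists>jb\<in>{..<n} \<times> UNIV. w \<in> D jb" for w
  proof -
    obtain j s where "j < n" "s \<in> {t j..t j + l j}" "unit_dir w = unit_dir s \<or> unit_dir w = - unit_dir s"
      using covering[OF norm_unit_dir] by blast
    then have "w \<in> D (j, True) \<or> w \<in> D (j, False)" unfolding D_iff by auto
    then show ?thesis using \<open>j < n\<close> by blast
  qed
  \<comment> \<open>Pigeonhole by closures: finitely many sets cover everything to the right of
    \<open>u\<close>, so \<open>u\<close> is a limit from the right of points of one of
    them.\<close>
  have "{u<..} \<subseteq> (\<Union>jb\<in>{..<n} \<times> UNIV. closure (D jb \<inter> {u<..}))"
  proof
    fix w assume "w \<in> {u<..}"
    moreover obtain jb where "jb \<in> {..<n} \<times> UNIV" "w \<in> D jb" using cover by blast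
    ultimately show "w \<in> (\<Union>jb\<in>{..<n} \<times> UNIV. closure (D jb \<inter> {u<..}))"
      using closure_subset[of "D jb \<inter> {u<..}"] by blast
  qed
  then have "closure {u<..} \<subseteq> (\<Union>jb\<in>{..<n} \<times> UNIV. closure (D jb \<inter> {u<..}))"
    by (rule closure_minimal) (intro closed_UN ballI finite_SigmaI; simp)
  moreover have "u \<in> closure {u<..}" by simp
  ultimately obtain j b where j: "j < n" and jb: "u \<in> closure (D (j, b) \<inter> {u<..})" by auto
  have uD: "u \<in> D (j, b)"
    using jb closure_minimal[OF Int_lower1 closed_D] by blast
  then obtain s where s: "s \<in> {t j..t j + l j}" "(if b then unit_dir u else - unit_dir u) = unit_dir s"
    unfolding D_iff by blast
  have "\<not> b"
  proof
    assume b
    then have "i = j" using same_direction[OF i u j s(1)] s(2) by simp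
    \<comment> \<open>Angles just beyond the end of side \<open>i\<close> do not belong to it again,
      because a gap of length \<open>2 * pi - l i\<close> remains before a full turn is
      completed.\<close>
    obtain w where w: "w \<in> D (j, b)" "u < w" "dist w u < 2 * pi - l i"
      using jb len(2)[OF i] unfolding closure_approachable by (metis IntE diff_gt_0_iff_gt greaterThan_iff)
    then obtain s' where s': "s' \<in> {t i..t i + l i}" "unit_dir w = unit_dir s'"
      unfolding D_iff using \<open>b\<close> \<open>i = j\<close> by auto
    then obtain k :: int where k: "w = s' + 2 * pi * of_int k" unfolding unit_dir_eq_iff by blast
    have w': "t i + l i < w" "w < t i + 2 * pi" using w(2,3) by (auto simp: u_def dist_real_def)
    have "t i \<le> s'" "s' \<le> t i + l i" using s'(1) by auto
    then have "0 < 2 * pi * of_int k" "2 * pi * of_int k < 2 * pi * 1" using k w' by linarith+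
    then have "0 < (of_int k :: real)" "(of_int k :: real) < 1"
      using pi_gt_zero by (auto simp: zero_less_mult_iff)
    then have "0 < k" "k < 1" by simp_all
    then show False by linarith
  qed
  then have opp: "unit_dir u = - unit_dir s" using s(2) by (metis minus_minus)
  \<comment> \<open>Otherwise sides \<open>i\<close> and \<open>j\<close> would have opposite
    normals on a whole interval to the left.\<close>
  have "s = t j"
  proof (rule ccontr)
    assume "s \<noteq> t j"
    define d where "d = min (l i) (s - t j)"
    have d: "0 < d" "d < 2 * pi" "u - d \<in> {t i..t i + l i}" "s - d \<in> {t j..t j + l j}"
      using len[OF i] s(1) \<open>s \<noteq> t j\<close> by (auto simp: d_def u_def)
    show False using opposite_overlap[OF i u _ j s(1) _ opp, of "- d"] d by simp
  qed
  then show ?thesis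
    using opp opposite_direction[OF i u j s(1) opp] j unfolding u_def by (metis minus_minus)
qed

section \<open>The cycle generated by the successor map\<close>

definition succ :: "nat \<Rightarrow> nat" where
  "succ i = (SOME j. j < n \<and> unit_dir (t j) = - unit_dir (t i + l i) \<and> p j = p i + unit_dir (t i + l i))"

lemma succ:
  assumes "i < n"
  shows "succ i < n" "unit_dir (t (succ i)) = - unit_dir (t i + l i)"
    "p (succ i) = p i + unit_dir (t i + l i)"
  using someI_ex[OF successor[OF assms]] unfolding succ_def by blast+

lemma succ_inj:
  assumes "i < n" "j < n" "succ i = succ j"
  shows "i = j"
proof (rule same_direction[OF assms(1) _ assms(2)])
  show "unit_dir (t i + l i) = unit_dir (t j + l j)"
    using succ(2)[OF assms(1)] succ(2)[OF assms(2)] assms(3) by simp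
qed (use len(1)[OF assms(1)] len(1)[OF assms(2)] in auto)

primrec idx :: "nat \<Rightarrow> nat \<Rightarrow> nat" where
  "idx k 0 = k"
| "idx k (Suc m) = succ (idx k m)"

text \<open>The start angle of the \<open>m\<close>-th successor with the half turns removed: it
  differs from \<open>t (idx k m)\<close> by \<open>real m * pi\<close> modulo full turns.\<close>

definition ang :: "nat \<Rightarrow> nat \<Rightarrow> real" where
  "ang k m = t k + (\<Sum>i<m. l (idx k i))"

lemma ang_simps [simp]: "ang k 0 = t k" "ang k (Suc m) = ang k m + l (idx k m)"
  by (simp_all add: ang_def)

lemma idx_less: "k < n \<Longrightarrow> idx k m < n"
  by (induction m) (auto simp: succ)

lemma t_idx:
  assumes "k < n"
  shows "\<exists>z::int. t (idx k m) = ang k m + real m * pi + 2 * pi * of_int z"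
proof (induction m)
  case 0
  show ?case by (intro exI[of _ 0]) simp
next
  case (Suc m)
  then obtain z :: int where z: "t (idx k m) = ang k m + real m * pi + 2 * pi * of_int z" by blast
  have "unit_dir (t (idx k (Suc m))) = unit_dir (t (idx k m) + l (idx k m) + pi)"
    using succ(2)[OF idx_less[OF assms]] by (simp add: unit_dir_add_pi)
  then obtain z' :: int where "t (idx k (Suc m)) = t (idx k m) + l (idx k m) + pi + 2 * pi * of_int z'"
    unfolding unit_dir_eq_iff by blast
  then show ?case by (intro exI[of _ "z + z'"]) (simp add: z algebra_simps)
qed

lemma ang_lift:
  assumes "k < n"
  obtains c where "t (idx k m) = ang k m + c" "\<And>s. unit_dir (s + c) = (-1) ^ m *\<^sub>R unit_dir s"
proof -
  obtain z :: int where z: "t (idx k m) = ang k m + real m * pi + 2 * pi * of_int z"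
    using t_idx[OF assms] by blast
  show thesis
  proof (rule that[of "real m * pi + 2 * pi * of_int z"])
    fix s
    have "unit_dir (s + (real m * pi + 2 * pi * of_int z)) = unit_dir ((s + real m * pi) + 2 * pi * of_int z)"
      by (simp add: add.assoc)
    then show "unit_dir (s + (real m * pi + 2 * pi * of_int z)) = (-1) ^ m *\<^sub>R unit_dir s"
      unfolding unit_dir_add_2pi_int unit_dir_add_nat_pi .
  qed (simp add: z)
qed

lemma p_idx_Suc:
  assumes "k < n"
  shows "p (idx k (Suc m)) = p (idx k m) + (-1) ^ m *\<^sub>R unit_dir (ang k (Suc m))"
proof -
  obtain c where c: "t (idx k m) = ang k m + c" "\<And>s. unit_dir (s + c) = (-1) ^ m *\<^sub>R unit_dir s"
    using ang_lift[OF assms] by blast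
  then show ?thesis using succ(3)[OF idx_less[OF assms, of m]] c(2)[of "ang k (Suc m)"]
    by (simp add: algebra_simps)
qed

lemma arc_idx:
  assumes "k < n"
  shows "unit_arc (p (idx k m)) (t (idx k m)) (l (idx k m)) =
    (\<lambda>s. p (idx k m) + (-1) ^ m *\<^sub>R unit_dir s) ` {ang k m..ang k (Suc m)}"
proof -
  obtain c where c: "t (idx k m) = ang k m + c" "\<And>s. unit_dir (s + c) = (-1) ^ m *\<^sub>R unit_dir s"
    using ang_lift[OF assms] by blast
  have "{t (idx k m)..t (idx k m) + l (idx k m)} = (\<lambda>s. s + c) ` {ang k m..ang k (Suc m)}"
    by (simp add: c(1) algebra_simps)
  then show ?thesis unfolding unit_arc_def by (simp only: image_image c(2))
qed

lemma ang_less: "k < n \<Longrightarrow> ang k m < ang k (Suc m)"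
  using len(1)[OF idx_less] by simp

lemma ang_strict_mono: "k < n \<Longrightarrow> strict_mono (ang k)"
  using ang_less by (rule strict_monoI_Suc)

lemma ex_ang_piece:
  assumes "ang k 0 \<le> s" "s < ang k M"
  obtains m where "m < M" "ang k m \<le> s" "s < ang k (Suc m)"
proof -
  have "\<exists>m<M. ang k m \<le> s \<and> s < ang k (Suc m)" using assms
  proof (induction M)
    case (Suc M)
    then show ?case by (cases "s < ang k M") (auto simp: less_Suc_eq)
  qed simp
  then show thesis using that by blast
qed

text \<open>The orbit of \<open>k\<close> under the injective successor map is a cycle that turns
  the normal by at least \<open>pi\<close>, so it meets every direction modulo \<open>pi\<close>. A
  side off the orbit would share directions with one on it, so the orbit contains all sides; a total
  turn above \<open>pi\<close> would make the orbit overlap itself.\<close>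

lemma idx_cycle:
  assumes k: "k < n"
  shows "idx k n = k" "bij_betw (idx k) {..<n} {..<n}" "ang k n = ang k 0 + pi"
proof -
  have "\<not> inj_on (idx k) {..n}"
  proof
    assume "inj_on (idx k) {..n}"
    then have "card {..n} \<le> card {..<n}"
      using idx_less[OF k] by (intro card_inj_on_le) auto
    then show False by simp
  qed
  then obtain i j where ij: "i < j" "idx k i = idx k j"
    unfolding inj_on_def by (metis linorder_neq_iff)
  have "idx k (j - i) = k"
  proof -
    \<comment> \<open>Injectivity cancels the common steps, so any repetition yields a return to
      \<open>k\<close>.\<close>
    have "idx k a = idx k (a + d) \<Longrightarrow> idx k d = k" for a d
    proof (induction a)
      case (Suc a)
      then show ?case using succ_inj[OF idx_less[OF k] idx_less[OF k]] by simp
    qed simp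
    from this[of i "j - i"] show ?thesis using ij by simp
  qed
  then have ex: "\<exists>m. 1 \<le> m \<and> idx k m = k" using ij(1) by (intro exI[of _ "j - i"]) simp
  define M where "M = (LEAST m. 1 \<le> m \<and> idx k m = k)"
  have M: "1 \<le> M" "idx k M = k" using LeastI_ex[OF ex] unfolding M_def by auto
  have least: "idx k m \<noteq> k" if "1 \<le> m" "m < M" for m
    using not_less_Least[of m "\<lambda>m. 1 \<le> m \<and> idx k m = k"] that M_def by simp
  have inj: "inj_on (idx k) {..<M}"
  proof (rule linorder_inj_onI')
    fix i j assume ij: "i \<in> {..<M}" "j \<in> {..<M}" "i < j"
    have "idx k a = idx k (a + d) \<Longrightarrow> idx k d = k" for a d
    proof (induction a)
      case (Suc a)
      then show ?case using succ_inj[OF idx_less[OF k] idx_less[OF k]] by simp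
    qed simp
    from this[of i "j - i"] show "idx k i \<noteq> idx k j" using ij least[of "j - i"] by auto
  qed
  obtain z :: int where "t (idx k M) = ang k M + real M * pi + 2 * pi * of_int z"
    using t_idx[OF k] by blast
  then have z: "ang k M = ang k 0 + pi * of_int (- int M - 2 * z)" using M(2) by (simp add: algebra_simps)
  \<comment> \<open>A return to \<open>k\<close> turns the normal by a positive multiple of
    \<open>pi\<close>, hence by at least \<open>pi\<close>.\<close>
  define c where "c = - int M - 2 * z"
  have c: "ang k M = ang k 0 + pi * of_int c" using z c_def by simp
  have "ang k 0 < ang k M" using strict_monoD[OF ang_strict_mono[OF k], of 0 M] M(1) by simp
  then have "0 < pi * of_int c" using c by simp
  then have c1: "1 \<le> c" using pi_gt_zero by (simp add: zero_less_mult_iff)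
  then have "pi * 1 \<le> pi * of_int c" by (intro mult_left_mono) auto
  then have ang_M: "ang k 0 + pi \<le> ang k M" using c by simp
  have surj: "j \<in> idx k ` {..<M}" if j: "j < n" for j
  proof -
    \<comment> \<open>The middle direction of side \<open>j\<close>, reduced modulo
      \<open>pi\<close> to the angle \<open>w\<close> in the range of the orbit. Starting in the
      middle leaves room to the right, so that opposite normals would persist on an
      interval.\<close>
    define s where "s = t j + l j / 2"
    define y where "y = (s - ang k 0) / pi"
    define w where "w = s + pi * of_int (- \<lfloor>y\<rfloor>)"
    have y: "s = ang k 0 + y * pi" by (simp add: y_def del: ang_simps)
    have "of_int \<lfloor>y\<rfloor> * pi \<le> y * pi" by (intro mult_right_mono) auto
    moreover have "y * pi < (of_int \<lfloor>y\<rfloor> + 1) * pi" by (intro mult_strict_right_mono) auto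
    ultimately have "ang k 0 \<le> w" "w < ang k 0 + pi" by (simp_all add: w_def y algebra_simps del: ang_simps)
    then have "ang k 0 \<le> w" "w < ang k M" using ang_M by linarith+
    then obtain m where m: "m < M" "ang k m \<le> w" "w < ang k (Suc m)"
      using ex_ang_piece[of k w M] by blast
    obtain e where e: "t (idx k m) = ang k m + e" "\<And>s. unit_dir (s + e) = (-1) ^ m *\<^sub>R unit_dir s"
      using ang_lift[OF k] by blast
    have "unit_dir w = unit_dir s \<or> unit_dir w = - unit_dir s"
      unfolding w_def unit_dir_add_int_pi by (cases "even \<lfloor>y\<rfloor>") auto
    then have dir: "unit_dir s = unit_dir (w + e) \<or> unit_dir s = - unit_dir (w + e)"
      unfolding e(2) by (cases "even m") auto
    have J: "s \<in> {t j..t j + l j}" "w + e \<in> {t (idx k m)..t (idx k m) + l (idx k m)}"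
      using len(1)[OF j] m e(1) by (auto simp: s_def)
    define d where "d = min (l j / 2) (ang k (Suc m) - w)"
    have d: "0 < d" "d < 2 * pi" using len[OF j] m by (auto simp: d_def)
    have J': "s + d \<in> {t j..t j + l j}" "w + e + d \<in> {t (idx k m)..t (idx k m) + l (idx k m)}"
      using len(1)[OF j] m e(1) d(1) by (auto simp: s_def d_def)
    have "unit_dir s \<noteq> - unit_dir (w + e)"
      using opposite_overlap[OF j J(1) J'(1) idx_less[OF k] J(2) J'(2)] d by auto
    then have "j = idx k m" using dir same_direction[OF j J(1) idx_less[OF k] J(2)] by blast
    then show ?thesis using m(1) by blast
  qed
  then have im: "idx k ` {..<M} = {..<n}" using idx_less[OF k] by auto
  then have "M = n" using card_image[OF inj] by simp
  then show "idx k n = k" "bij_betw (idx k) {..<n} {..<n}" using M(2) inj im by (auto simp: bij_betw_def)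
  have "ang k M = ang k 0 + pi"
  proof (rule ccontr)
    assume "ang k M \<noteq> ang k 0 + pi"
    then have lt: "ang k 0 + pi < ang k M" using ang_M by simp
    obtain m where m: "m < M" "ang k m \<le> ang k 0 + pi" "ang k 0 + pi < ang k (Suc m)"
      using ex_ang_piece[OF _ lt] pi_ge_zero by auto
    obtain e where e: "t (idx k m) = ang k m + e" "\<And>s. unit_dir (s + e) = (-1) ^ m *\<^sub>R unit_dir s"
      using ang_lift[OF k] by blast
    define w where "w = ang k 0 + pi + e"
    define d where "d = min (l k) (ang k (Suc m) - (ang k 0 + pi))"
    have d: "0 < d" "d < 2 * pi" using len[OF k] m by (auto simp: d_def)
    have J: "t k \<in> {t k..t k + l k}" "w \<in> {t (idx k m)..t (idx k m) + l (idx k m)}"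
      using len(1)[OF k] m e(1) by (auto simp: w_def)
    have J': "t k + d \<in> {t k..t k + l k}" "w + d \<in> {t (idx k m)..t (idx k m) + l (idx k m)}"
      using len(1)[OF k] m e(1) d(1) by (auto simp: w_def d_def)
    have dir: "unit_dir (t k) = unit_dir w \<or> unit_dir (t k) = - unit_dir w"
      unfolding w_def e(2) unit_dir_add_pi by (cases "even m") auto
    have "unit_dir (t k) \<noteq> - unit_dir w"
      using opposite_overlap[OF k J(1) J'(1) idx_less[OF k] J(2) J'(2)] d by auto
    then have "idx k m = k" using dir same_direction[OF k J(1) idx_less[OF k] J(2)] by metis
    then have "m = 0" using least[of m] m(1) by (cases m) auto
    \<comment> \<open>Only side \<open>k\<close> itself can recur half a turn later. It is then
      longer than \<open>pi\<close> and has opposite normals along an interval.\<close>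
    then have long: "pi < l k" using m(3) by simp
    define d where "d = l k - pi"
    have "unit_dir (t k) = - unit_dir (t k + pi)" by (simp add: unit_dir_add_pi)
    then show False
      using opposite_overlap[OF k J(1) _ k, of d "t k + pi"] long len(2)[OF k] pi_gt_zero by (auto simp: d_def)
  qed
  then show "ang k n = ang k 0 + pi" using \<open>M = n\<close> by simp
qed

end


section \<open>Canonical position\<close>

text \<open>\<open>cang\<close>, \<open>cvert\<close>, \<open>cside\<close> and
  \<open>cshape\<close> rebuild the polygon from its lengths alone, with the first centre at 0 and
  the first side starting at angle 0. No closing condition is imposed, and lengths may vanish, so
  degenerate sequences are covered as well.\<close>

definition cang :: "(nat \<Rightarrow> real) \<Rightarrow> nat \<Rightarrow> real" where
  "cang L m = (\<Sum>i<m. L i)"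

definition cvert :: "(nat \<Rightarrow> real) \<Rightarrow> nat \<Rightarrow> real^2" where
  "cvert L m = (\<Sum>i<m. (-1) ^ i *\<^sub>R unit_dir (cang L (Suc i)))"

definition cside :: "(nat \<Rightarrow> real) \<Rightarrow> nat \<Rightarrow> (real^2) set" where
  "cside L m = (\<lambda>s. cvert L m + (-1) ^ m *\<^sub>R unit_dir s) ` {cang L m..cang L (Suc m)}"

definition cshape :: "nat \<Rightarrow> (nat \<Rightarrow> real) \<Rightarrow> (real^2) set" where
  "cshape n L = convex hull (\<Union>m<n. cside L m)"

lemma cang_simps [simp]: "cang L 0 = 0" "cang L (Suc m) = cang L m + L m"
  by (simp_all add: cang_def)

lemma cvert_simps: "cvert L 0 = 0" "cvert L (Suc m) = cvert L m + (-1) ^ m *\<^sub>R unit_dir (cang L (Suc m))"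
  by (simp_all add: cvert_def)

lemma cang_cong: "(\<And>i. i < m \<Longrightarrow> L i = L' i) \<Longrightarrow> cang L m = cang L' m"
  unfolding cang_def by (rule sum.cong) auto

lemma cvert_cong: "(\<And>i. i < m \<Longrightarrow> L i = L' i) \<Longrightarrow> cvert L m = cvert L' m"
  unfolding cvert_def by (intro sum.cong refl arg_cong2[where f = scaleR] arg_cong[where f = unit_dir] cang_cong) auto

lemma cshape_cong:
  assumes "\<And>i. i < n \<Longrightarrow> L i = L' i"
  shows "cshape n L = cshape n L'"
proof -
  have "cside L m = cside L' m" if "m < n" for m
    using cang_cong[of m L L'] cvert_cong[of m L L'] assms that by (simp add: cside_def)
  then show ?thesis unfolding cshape_def by simp
qed

text \<open>\<open>K\<close> is the convex hull of its frontier, and the frontier is rebuilt side by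
  side along successors after moving the centre of side \<open>k\<close> to 0. Hence equal length
  sequences give congruent polygons.\<close>

lemma (in reuleaux_sides) canonical_position:
  assumes k: "k < n"
  obtains f where "rigid_motion f" "f ` K = cshape n (\<lambda>m. l (idx k m))"
    "cvert (\<lambda>m. l (idx k m)) n = 0"
proof -
  define L where "L = (\<lambda>m. l (idx k m))"
  define f where "f = (\<lambda>x. rot (- t k) x + - rot (- t k) (p k))"
  have f: "rigid_motion f" unfolding f_def by (rule rigid_motion_rot)
  have ang: "cang L m = ang k m - t k" for m by (simp add: cang_def ang_def L_def)
  have f_add: "f (x + c *\<^sub>R unit_dir s) = f x + c *\<^sub>R unit_dir (s - t k)" for x c s
    by (simp add: f_def)
  have vert: "f (p (idx k m)) = cvert L m" for m
  proof (induction m)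
    case 0
    show ?case by (simp add: f_def cvert_simps)
  next
    case (Suc m)
    then show ?case unfolding p_idx_Suc[OF k] f_add cvert_simps ang by simp
  qed
  have side: "f ` unit_arc (p (idx k m)) (t (idx k m)) (l (idx k m)) = cside L m" for m
  proof -
    have I: "{cang L m..cang L (Suc m)} = (\<lambda>s. s - t k) ` {ang k m..ang k (Suc m)}"
      unfolding ang by (simp add: diff_conv_add_uminus del: ang_simps add_uminus_conv_diff)
    show ?thesis unfolding arc_idx[OF k] cside_def I image_image f_add vert ..
  qed
  have "f ` frontier K = (\<Union>i<n. f ` unit_arc (p i) (t i) (l i))"
    unfolding frontier_eq by blast
  also have "\<dots> = (\<Union>m<n. cside L m)"
    using idx_cycle(2)[OF k] unfolding side[symmetric] bij_betw_def by (metis (no_types, lifting) SUP_cong image_image)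
  finally have "f ` K = cshape n L"
    using rigid_motion_convex_hull[OF f, of "frontier K"] Krein_Milman_frontier[OF cwD(2,1)[OF cw]]
    unfolding cshape_def by simp
  moreover have "cvert L n = 0" using vert[of n] vert[of 0] idx_cycle(1)[OF k] by (simp add: cvert_simps)
  ultimately show thesis using that f L_def by simp
qed

lemma regular_canonical:
  assumes "regular_reuleaux_polygon K n" "0 < n"
  obtains f where "rigid_motion f" "f ` K = cshape n (\<lambda>_. pi / real n)" "cvert (\<lambda>_. pi / real n) n = 0"
proof -
  obtain p t l where P: "reuleaux_polygon K n p t l" "\<forall>i<n. \<forall>j<n. l i = l j"
    using assms unfolding regular_reuleaux_polygon_def by blast
  interpret reuleaux_sides K n p t l by unfold_locales (rule P)
  have L: "l (idx 0 m) = l 0" for m using P(2) idx_less[OF assms(2)] assms(2) by blast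
  have "real n * l 0 = pi" using idx_cycle(3)[OF assms(2)] by (simp add: ang_def L)
  then have "l 0 = pi / real n" using assms(2) by (simp add: field_simps)
  then have eq: "(\<lambda>m. l (idx 0 m)) = (\<lambda>_. pi / real n)" by (simp add: L)
  show thesis by (rule canonical_position[OF assms(2), unfolded eq]) (rule that)
qed

definition omega_lengths :: "nat \<Rightarrow> real \<Rightarrow> nat \<Rightarrow> real" where
  "omega_lengths N r m = (if m = 0 then omega_a N r
    else if m = 1 \<or> m = 2 * N then omega_b N r else omega_l r)"

text \<open>The sides with endpoint \<open>p k\<close> are its neighbours in the cyclic order, so
  the opposite sides sit at positions 1 and \<open>2 * N\<close>. Both have the same length, so it
  does not matter which of \<open>i\<close> and \<open>j\<close> comes first.\<close>

lemma intermediate_canonical: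
  assumes "intermediate_omega N r K" "1 \<le> N"
  obtains f where "rigid_motion f" "f ` K = cshape (2 * N + 1) (omega_lengths N r)"
proof -
  obtain p t l c k i j where P: "reuleaux_polygon K (2 * N + 1) p t l" and k: "k < 2 * N + 1" "i \<noteq> j"
    and opp: "{m. m < 2 * N + 1 \<and> p k \<in> arc_ends (p m) (t m) (l m)} = {i, j}"
    and lk: "l k = omega_a N r"
    and lij: "\<forall>m\<in>{i, j}. card (arc_ends (p m) (t m) (l m) \<inter> sphere c (1 - r)) = 1 \<and> l m = omega_b N r"
    and lm: "\<forall>m<2 * N + 1. m \<notin> {k, i, j} \<longrightarrow>
      arc_ends (p m) (t m) (l m) \<subseteq> sphere c (1 - r) \<and> l m = omega_l r"
    using assms(1) unfolding intermediate_omega_def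
    by (elim exE conjE) (rule that; assumption)
  define n where "n = 2 * N + 1"
  note k = k[folded n_def] and opp = opp[folded n_def] and lm = lm[folded n_def]
  interpret reuleaux_sides K n p t l by unfold_locales (rule P[folded n_def])
  note idx = idx_cycle[OF k(1)]
  have inj: "idx k a = idx k b \<longleftrightarrow> a = b" if "a < n" "b < n" for a b
    using idx(2) that unfolding bij_betw_def inj_on_def by blast
  have ends: "p (idx k (Suc m)) \<in> arc_ends (p (idx k m)) (t (idx k m)) (l (idx k m))"
    "p (idx k m) \<in> arc_ends (p (idx k (Suc m))) (t (idx k (Suc m))) (l (idx k (Suc m)))" for m
    using succ[OF idx_less[OF k(1)], of m] by (simp_all add: arc_ends_def)
  have "idx k (Suc (2 * N)) = k" using idx(1) by (simp add: n_def)
  then have last: "p k \<in> arc_ends (p (idx k (2 * N))) (t (idx k (2 * N))) (l (idx k (2 * N)))"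
    using ends(1)[of "2 * N"] by (simp only:)
  have first: "p k \<in> arc_ends (p (idx k 1)) (t (idx k 1)) (l (idx k 1))"
    using ends(2)[of 0] by simp
  have "idx k 1 \<in> {i, j}" "idx k (2 * N) \<in> {i, j}"
    unfolding opp[symmetric] using first last idx_less[OF k(1)] by blast+
  moreover have "idx k 1 \<noteq> idx k (2 * N)" using inj[of 1 "2 * N"] assms(2) by (simp add: n_def)
  ultimately have ij: "{idx k 1, idx k (2 * N)} = {i, j}" by auto
  have "l (idx k m) = omega_lengths N r m" if m: "m < n" for m
  proof -
    consider "m = 0" | "m \<in> {1, 2 * N}" | "m \<notin> {0, 1, 2 * N}" by blast
    then show ?thesis
    proof cases
      case 1
      then show ?thesis using lk by (simp add: omega_lengths_def)
    next
      case 2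
      then have "idx k m \<in> {i, j}" using ij by blast
      then show ?thesis using lij 2 assms(2) by (auto simp: omega_lengths_def)
    next
      case 3
      then have "idx k m \<noteq> idx k 0" "idx k m \<noteq> idx k 1" "idx k m \<noteq> idx k (2 * N)"
        using inj[OF m] assms(2) by (auto simp: n_def)
      then have "idx k m \<notin> {k, i, j}" using ij by auto
      then show ?thesis using lm idx_less[OF k(1)] 3 by (auto simp: omega_lengths_def)
    qed
  qed
  then have eq: "cshape n (\<lambda>m. l (idx k m)) = cshape (2 * N + 1) (omega_lengths N r)"
    unfolding n_def[symmetric] by (rule cshape_cong)
  show thesis by (rule canonical_position[OF k(1), unfolded eq]) (rule that)
qed

text \<open>At the left end of its parameter interval the intermediate shape with \<open>n + 2\<close> sides degenerates:
  one side shrinks to a point and its two opposite sides merge into one side of the regular \<open>n\<close>-gon.\<close>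

lemma cshape_regular_split:
  assumes n: "odd n" "2 \<le> n" and z: "cvert (\<lambda>_. pi / real n) n = 0"
    and L: "L 0 = 0" "L 1 = pi / real n / 2" "L (n + 1) = pi / real n / 2"
      "\<And>m. 2 \<le> m \<Longrightarrow> m \<le> n \<Longrightarrow> L m = pi / real n"
  obtains g where "rigid_motion g" "g ` cshape n (\<lambda>_. pi / real n) = cshape (n + 2) L"
proof -
  define w where "w = pi / real n"
  define C where "C = (\<lambda>_::nat. w)"
  have w: "0 < w" "real n * w = pi" using n by (auto simp: w_def)
  \<comment> \<open>The centre of side 0 of the regular polygon becomes vertex 1 of the split one:
    \<open>pi\<close> compensates the sign change caused by this index shift, and
    \<open>w / 2\<close> moves the cut to the middle of that side.\<close>
  define g where "g = (\<lambda>x. rot (pi - w / 2) x + unit_dir 0)"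
  have g: "rigid_motion g" unfolding g_def by (rule rigid_motion_rot)
  have g_add: "g (x + c *\<^sub>R unit_dir s) = g x - c *\<^sub>R unit_dir (s - w / 2)" for x c s
  proof -
    have "unit_dir (s + (pi - w / 2)) = - unit_dir (s - w / 2)"
      using unit_dir_add_pi[of "s - w / 2"] by (simp add: algebra_simps)
    then show ?thesis by (simp add: g_def)
  qed
  have angC: "cang C m = real m * w" for m by (simp add: cang_def C_def)
  have angL: "cang L (Suc m) = real m * w - w / 2" if "1 \<le> m" "m \<le> n" for m
    using that
  proof (induction m rule: dec_induct)
    case base
    show ?case using L(1,2) by (simp add: w_def)
  next
    case (step m)
    then show ?case using L(4)[of "Suc m"] by (simp add: w_def[symmetric] algebra_simps)
  qed
  have angL_last: "cang L (n + 2) = pi"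
    using angL[of n] n w L(3) by (simp add: w_def[symmetric])
  have vert: "cvert L (Suc m) = g (cvert C m)" if "m \<le> n" for m
    using that
  proof (induction m)
    case 0
    show ?case using L(1) by (simp add: cvert_simps g_def rot_def vec_eq_iff forall_2)
  next
    case (Suc m)
    have "cvert L (Suc (Suc m)) = g (cvert C m) + (-1) ^ Suc m *\<^sub>R unit_dir (cang L (Suc (Suc m)))"
      using Suc cvert_simps(2)[of L "Suc m"] by simp
    also have "\<dots> = g (cvert C m) - (-1) ^ m *\<^sub>R unit_dir (cang C (Suc m) - w / 2)"
      using angL[of "Suc m"] Suc angC[of "Suc m"] by simp
    also have "\<dots> = g (cvert C (Suc m))" unfolding cvert_simps g_add ..
    finally show ?case .
  qed
  have gside: "g ` cside C m = (\<lambda>s. cvert L (Suc m) + (-1) ^ Suc m *\<^sub>R unit_dir s) `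
      {real m * w - w / 2..real (Suc m) * w - w / 2}" if "m \<le> n" for m
  proof -
    have I: "{real m * w - w / 2..real (Suc m) * w - w / 2} = (\<lambda>s. s - w / 2) ` {cang C m..cang C (Suc m)}"
      unfolding angC by (simp add: diff_conv_add_uminus del: add_uminus_conv_diff)
    show ?thesis unfolding cside_def I image_image g_add vert[OF that] by simp
  qed
  have mid: "cside L (Suc m) = g ` cside C m" if "1 \<le> m" "m < n" for m
  proof -
    have "cang L (Suc m) = real m * w - w / 2" "cang L (Suc (Suc m)) = real (Suc m) * w - w / 2"
      using that by (intro angL; simp)+
    then show ?thesis unfolding gside[OF less_imp_le[OF that(2)]] cside_def[of L] by (simp only:)
  qed
  have last_vert: "cvert L (Suc n) = cvert L 1"
    using vert[of n] vert[of 0] z by (simp add: C_def w_def cvert_simps)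
  have first_vert: "cvert L 1 = unit_dir 0" using L(1) by (simp add: cvert_simps)
  have s1: "cside L 1 = (\<lambda>s. unit_dir 0 - unit_dir s) ` {0..w / 2}"
    using L(1,2) first_vert by (simp add: cside_def w_def)
  have I: "{cang L (Suc n)..cang L (Suc (Suc n))} = (\<lambda>s. s + pi) ` {- (w / 2)..0}"
    using angL[of n] angL_last n w by (simp del: cang_simps)
  have s2: "cside L (n + 1) = (\<lambda>s. unit_dir 0 - unit_dir s) ` {- (w / 2)..0}"
    unfolding cside_def Suc_eq_plus1[symmetric] I image_image unit_dir_add_pi last_vert first_vert
    using n(1) by simp
  have "g ` cside C 0 = (\<lambda>s. unit_dir 0 - unit_dir s) ` {- (w / 2)..w / 2}"
    using gside[of 0] first_vert by simp
  moreover have "{- (w / 2)..w / 2} = {0..w / 2} \<union> {- (w / 2)..0}" using w by auto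
  ultimately have ends: "g ` cside C 0 = cside L 1 \<union> cside L (n + 1)"
    unfolding s1 s2 by (simp add: image_Un)
  \<comment> \<open>The side of length zero contributes a single point, which already lies on side
    2.\<close>
  have "cside L 0 = {unit_dir 0}" using L(1) by (simp add: cside_def cvert_simps)
  moreover have "unit_dir 0 \<in> cside L 2"
  proof -
    have "cvert L 2 + unit_dir (cang L 2) = unit_dir 0"
      using cvert_simps(2)[of L 1] first_vert by (simp add: numeral_2_eq_2)
    moreover have "0 \<le> L 2" using L(4)[of 2] n w by (cases "n = 2") (auto simp: w_def[symmetric])
    then have "cang L 2 \<in> {cang L 2..cang L (Suc 2)}" unfolding cang_simps by simp
    ultimately show ?thesis unfolding cside_def by (intro image_eqI[of _ _ "cang L 2"]) auto
  qed
  ultimately have zero: "cside L 0 \<subseteq> cside L 2" by simp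
  have "(\<Union>m<n + 2. cside L m) = (\<Union>m<n. g ` cside C m)"
  proof (intro equalityI UN_least)
    fix m assume m: "m \<in> {..<n + 2}"
    consider "m = 0" | "m = 1 \<or> m = n + 1" | "2 \<le> m" "m \<le> n" using m by fastforce
    then show "cside L m \<subseteq> (\<Union>m<n. g ` cside C m)"
    proof cases
      case 1
      have "cside L 2 = g ` cside C 1" using mid[of 1] n by (simp add: numeral_2_eq_2)
      then show ?thesis using zero 1 n by (intro SUP_upper2[of 1]) auto
    next
      case 2
      then show ?thesis using ends n by (intro SUP_upper2[of 0]) auto
    next
      case 3
      then have "cside L m = g ` cside C (m - 1)" using mid[of "m - 1"] by simp
      then show ?thesis using 3 by (intro SUP_upper2[of "m - 1"]) auto
    qed
  next
    fix m assume m: "m \<in> {..<n}"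
    show "g ` cside C m \<subseteq> (\<Union>m<n + 2. cside L m)"
    proof (cases "m = 0")
      case True
      have "cside L 1 \<subseteq> (\<Union>m<n + 2. cside L m)" "cside L (n + 1) \<subseteq> (\<Union>m<n + 2. cside L m)"
        by (intro UN_upper; simp)+
      then show ?thesis using ends True by simp
    next
      case False
      then show ?thesis using mid[of m] m by (intro SUP_upper2[of "Suc m"]) auto
    qed
  qed
  then have "g ` cshape n C = cshape (n + 2) L"
    unfolding cshape_def rigid_motion_convex_hull[OF g] image_UN by simp
  then show thesis using that g by (simp add: C_def w_def)
qed

text \<open>Errors accumulate linearly: angles move by at most \<open>n * d\<close>, hence each
  vertex by at most \<open>n * (n * d)\<close>. The further summand 1 in the denominator of
  \<open>d\<close> keeps it positive for \<open>n = 0\<close>.\<close>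

lemma cshape_close:
  assumes "0 < e"
  shows "\<exists>d>0. \<forall>L L'. (\<forall>m<n. 0 \<le> L m \<and> 0 \<le> L' m \<and> \<bar>L m - L' m\<bar> \<le> d) \<longrightarrow>
    hclose e (cshape n L) (cshape n L')"
proof -
  define d where "d = e / (real n * real n + real n + 1)"
  have d0: "0 < d" using assms by (simp add: d_def add_nonneg_pos)
  have "(real n * real n + real n + 1) * d = e"
    using assms by (simp add: d_def add_nonneg_eq_0_iff)
  then have d1: "real n * (real n * d) + real n * d \<le> e" using d0 by (simp add: algebra_simps)
  have *: "\<forall>x\<in>\<Union>m<n. cside L m. \<exists>y\<in>\<Union>m<n. cside L' m. dist x y \<le> e"
    if A: "\<forall>m<n. 0 \<le> L m \<and> 0 \<le> L' m \<and> \<bar>L m - L' m\<bar> \<le> d" for L L'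
  proof
    have ang: "\<bar>cang L m - cang L' m\<bar> \<le> real n * d" if "m \<le> n" for m
    proof -
      have "\<bar>cang L m - cang L' m\<bar> = \<bar>\<Sum>i<m. L i - L' i\<bar>" by (simp add: cang_def sum_subtractf)
      also have "\<dots> \<le> (\<Sum>i<m. \<bar>L i - L' i\<bar>)" by (rule sum_abs)
      also have "\<dots> \<le> (\<Sum>i<m. d)" using A that by (intro sum_mono) auto
      also have "\<dots> \<le> real n * d" using that d0 by simp
      finally show ?thesis .
    qed
    have vert: "norm (cvert L m - cvert L' m) \<le> real n * (real n * d)" if "m < n" for m
    proof -
      have "norm (cvert L m - cvert L' m) =
          norm (\<Sum>i<m. (-1) ^ i *\<^sub>R (unit_dir (cang L (Suc i)) - unit_dir (cang L' (Suc i))))"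
        unfolding cvert_def by (simp only: sum_subtractf scaleR_diff_right)
      also have "\<dots> \<le> (\<Sum>i<m. norm ((-1) ^ i *\<^sub>R (unit_dir (cang L (Suc i)) - unit_dir (cang L' (Suc i)))))"
        by (rule norm_sum)
      also have "\<dots> \<le> (\<Sum>i<m. real n * d)"
      proof (rule sum_mono)
        fix i assume "i \<in> {..<m}"
        then have "\<bar>cang L (Suc i) - cang L' (Suc i)\<bar> \<le> real n * d" using ang[of "Suc i"] that by simp
        then have "dist (unit_dir (cang L (Suc i))) (unit_dir (cang L' (Suc i))) \<le> real n * d"
          using dist_unit_dir_le order_trans by blast
        then show "norm ((-1) ^ i *\<^sub>R (unit_dir (cang L (Suc i)) - unit_dir (cang L' (Suc i)))) \<le> real n * d"
          unfolding norm_scaleR dist_norm by simp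
      qed
      also have "\<dots> \<le> real n * (real n * d)" using that d0 by (simp add: mult_right_mono)
      finally show ?thesis .
    qed
    fix x assume "x \<in> (\<Union>m<n. cside L m)"
    then obtain m s where m: "m < n" and s: "cang L m \<le> s" "s \<le> cang L (Suc m)"
      and x: "x = cvert L m + (-1) ^ m *\<^sub>R unit_dir s" unfolding cside_def by auto
    \<comment> \<open>Clamping \<open>s\<close> to the angular range of the corresponding side moves
      it no further than the ends of that range are displaced; nonnegative lengths make the range a
      proper interval.\<close>
    define s' where "s' = max (cang L' m) (min s (cang L' (Suc m)))"
    have "0 \<le> L' m" using A m by blast
    then have s': "s' \<in> {cang L' m..cang L' (Suc m)}" by (auto simp: s'_def)
    have "\<bar>s - s'\<bar> \<le> real n * d"
      using s ang[of m] ang[of "Suc m"] m \<open>0 \<le> L' m\<close> unfolding s'_def by (simp add: max_def min_def abs_le_iff)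
    then have "dist (unit_dir s) (unit_dir s') \<le> real n * d" using dist_unit_dir_le order_trans by blast
    then have u: "norm ((-1) ^ m *\<^sub>R (unit_dir s - unit_dir s')) \<le> real n * d"
      unfolding norm_scaleR dist_norm by simp
    define y where "y = cvert L' m + (-1) ^ m *\<^sub>R unit_dir s'"
    have "dist x y = norm ((cvert L m - cvert L' m) + (-1) ^ m *\<^sub>R (unit_dir s - unit_dir s'))"
      unfolding x y_def dist_norm by (simp add: algebra_simps)
    also have "\<dots> \<le> e" using norm_triangle_ineq vert[OF m] u d1 by (smt (verit))
    finally have "dist x y \<le> e" .
    moreover have "y \<in> (\<Union>m<n. cside L' m)" using m s' unfolding y_def cside_def by blast
    ultimately show "\<exists>y\<in>\<Union>m<n. cside L' m. dist x y \<le> e" by blast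
  qed
  show ?thesis
  proof (intro exI[of _ d] conjI d0 allI impI)
    fix L L' assume A: "\<forall>m<n. 0 \<le> L m \<and> 0 \<le> L' m \<and> \<bar>L m - L' m\<bar> \<le> d"
    then have B: "\<forall>m<n. 0 \<le> L' m \<and> 0 \<le> L m \<and> \<bar>L' m - L m\<bar> \<le> d"
      by (simp add: abs_minus_commute)
    have "hclose e (\<Union>m<n. cside L m) (\<Union>m<n. cside L' m)"
      using *[OF A] *[OF B] unfolding hclose_def by (simp add: dist_commute)
    then show "hclose e (cshape n L) (cshape n L')" unfolding cshape_def by (rule hclose_convex_hull)
  qed
qed


section \<open>Continuity of \<open>r \<mapsto> \<Omega>(r)\<close>\<close>

text \<open>As \<open>1 - r \<le> 1\<close>, half of \<open>omega_a\<close> is at most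
  \<open>omega_h\<close>, which keeps \<open>omega_b\<close> nonnegative. The left end of the
  interval is included because the degenerate shape is used there.\<close>

lemma omega_lengths_nonneg:
  assumes "2 \<le> N" "0 < r" "r < 1 / 2" "reuleaux_inradius (2 * N - 1) \<le> r"
  shows "0 \<le> omega_lengths N r m"
proof -
  note l = omega_l_props[OF assms(3)]
  have N: "1 \<le> N" using assms(1) by simp
  have "1 * omega_l r \<le> (2 * real N - 1) * omega_l r"
    using assms(1) l by (intro mult_right_mono) auto
  then have h: "0 \<le> omega_h N r" "omega_h N r \<le> pi / 2"
    using omega_h_iff(4)[OF assms(3) N assms(1)] assms(4) omega_h_eq[of N r] l by linarith+
  have s: "0 \<le> sin (omega_h N r)" using h by (intro sin_ge_zero) auto
  have y: "0 \<le> (1 - r) * sin (omega_h N r)" using s assms(3) by simp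
  have y': "(1 - r) * sin (omega_h N r) \<le> sin (omega_h N r)"
    using mult_right_mono[of "1 - r" 1 "sin (omega_h N r)"] s assms(2) by simp
  have "arcsin 0 \<le> arcsin ((1 - r) * sin (omega_h N r))"
    using y y' sin_le_one[of "omega_h N r"] by (intro arcsin_le_arcsin) linarith+
  then have a: "0 \<le> omega_a N r" by (simp add: omega_a_def)
  have "arcsin ((1 - r) * sin (omega_h N r)) \<le> arcsin (sin (omega_h N r))"
    using y y' sin_le_one[of "omega_h N r"] by (intro arcsin_le_arcsin) linarith+
  also have "\<dots> = omega_h N r" using h by (intro arcsin_sin) auto
  finally have "omega_a N r / 2 \<le> omega_h N r" by (simp add: omega_a_def)
  then have "0 \<le> omega_b N r" using l(1) unfolding omega_b_def diff_divide_distrib by linarith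
  then show ?thesis using a l(1) by (simp add: omega_lengths_def)
qed

lemma isCont_omega_lengths:
  assumes "0 < r" "r < 1"
  shows "isCont (\<lambda>r. omega_lengths N r m) r"
proof -
  have l: "isCont omega_l r" unfolding omega_l_def[abs_def] by (intro continuous_intros)
  then have h: "isCont (omega_h N) r" unfolding omega_h_def[abs_def] by (intro continuous_intros)
  have "\<bar>(1 - r) * sin (omega_h N r)\<bar> \<le> \<bar>1 - r\<bar> * 1"
    unfolding abs_mult by (intro mult_left_mono) auto
  also have "\<dots> < 1" using assms by simp
  finally have y: "\<bar>(1 - r) * sin (omega_h N r)\<bar> < 1" .
  have "isCont (\<lambda>r. (1 - r) * sin (omega_h N r)) r" using h by (intro continuous_intros)
  then have "isCont (\<lambda>r. arcsin ((1 - r) * sin (omega_h N r))) r"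
    by (rule isCont_o2) (use y in \<open>auto intro!: isCont_arcsin\<close>)
  then have a: "isCont (omega_a N) r" unfolding omega_a_def[abs_def] by (intro continuous_intros)
  have "isCont (omega_b N) r" unfolding omega_b_def[abs_def] using l h a by (intro continuous_intros) auto
  then show ?thesis using l a by (cases "m = 0"; cases "m = 1 \<or> m = 2 * N") (auto simp: omega_lengths_def)
qed

text \<open>A single family of length sequences serves the closed parameter interval: inside it
  directly, at the right end because all lengths become \<open>omega_l r\<close>, and at the left
  end after splitting a side of the regular polygon with two sides fewer.\<close>

lemma omega_canonical:
  assumes N: "2 \<le> N" and r: "reuleaux_inradius (2 * N - 1) \<le> r" "r \<le> reuleaux_inradius (2 * N + 1)"
    and K: "is_Omega r K"
  obtains f where "rigid_motion f" "f ` K = cshape (2 * N + 1) (omega_lengths N r)"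
proof -
  have r12: "r < 1 / 2" using reuleaux_inradius_props(1)[of "2 * N + 1"] r(2) N by simp
  note less_iff = reuleaux_inradius_less_iff
  have N1: "1 \<le> N" using N by simp
  consider M where "1 \<le> M" "r = reuleaux_inradius (2 * M + 1)" "regular_reuleaux_polygon K (2 * M + 1)"
    | M where "2 \<le> M" "reuleaux_inradius (2 * M - 1) < r" "r < reuleaux_inradius (2 * M + 1)" "intermediate_omega M r K"
    using K unfolding is_Omega_def by blast
  then show thesis
  proof cases
    case (1 M)
    have "0 < 2 * M + 1" by simp
    from regular_canonical[OF 1(3) this]
    obtain f where f: "rigid_motion f" "f ` K = cshape (2 * M + 1) (\<lambda>_. pi / real (2 * M + 1))"
      "cvert (\<lambda>_. pi / real (2 * M + 1)) (2 * M + 1) = 0"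
      by blast
    have lM: "real (2 * M + 1) * omega_l r = pi"
      using reuleaux_inradius_iff[of "2 * M + 1" r] 1 r12 by simp
    then have l: "omega_l r = pi / real (2 * M + 1)" by (simp add: field_simps)
    have "\<not> reuleaux_inradius (2 * N + 1) < reuleaux_inradius (2 * M + 1)"
      "\<not> reuleaux_inradius (2 * M + 1) < reuleaux_inradius (2 * N - 1)"
      using r 1(2) by auto
    moreover have "2 \<le> 2 * N - 1" "2 \<le> 2 * N + 1" "2 \<le> 2 * M + 1" using N 1(1) by auto
    ultimately have "\<not> 2 * N + 1 < 2 * M + 1" "\<not> 2 * M + 1 < 2 * N - 1"
      using less_iff[of "2 * N + 1" "2 * M + 1"] less_iff[of "2 * M + 1" "2 * N - 1"] by blast+
    then have "M \<le> N" "N \<le> M + 1" by linarith+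
    then consider "M = N" | "N = M + 1" by linarith
    then show thesis
    proof cases
      case 1
      have h: "omega_h N r = omega_l r"
        using omega_h_iff(2)[OF r12 N1] \<open>r = reuleaux_inradius (2 * M + 1)\<close> 1 by simp
      have "0 < r"
      proof -
        have "reuleaux_inradius 3 \<le> r"
          using less_iff[of "2 * N + 1" 3] \<open>r = reuleaux_inradius (2 * M + 1)\<close> 1 N
          by (simp add: not_less[symmetric])
        then show ?thesis using reuleaux_inradius_3 r3_pos by linarith
      qed
      then have shape: "omega_shape N (1 - r) (omega_l r) (omega_h N r) (omega_a N r)"
        using N1 r12 h omega_l_props(1)[OF r12] by (intro omega_shapeI) auto
      have a: "omega_a N r = omega_l r" by (rule omega_shape.h_eq_lD(2)[OF shape h])
      then have len: "omega_lengths N r = (\<lambda>_. omega_l r)"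
        by (auto simp: omega_lengths_def omega_b_def h fun_eq_iff)
      have "f ` K = cshape (2 * M + 1) (\<lambda>_. omega_l r)" using f(2) by (simp only: l)
      then have "f ` K = cshape (2 * N + 1) (omega_lengths N r)" by (simp only: len 1)
      then show thesis by (rule that[OF f(1)])
    next
      case 2
      define n where "n = 2 * M + 1"
      have n: "odd n" "2 \<le> n" "n + 2 = 2 * N + 1" "n + 1 = 2 * N"
        using \<open>1 \<le> M\<close> 2 by (auto simp: n_def)
      have h: "omega_h N r = 0"
        using omega_h_iff(5)[OF r12 N1 N] \<open>r = reuleaux_inradius (2 * M + 1)\<close> 2 by simp
      have a: "omega_a N r = 0" by (simp add: omega_a_def h)
      obtain g where g: "rigid_motion g" "g ` cshape n (\<lambda>_. pi / real n) = cshape (n + 2) (omega_lengths N r)"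
      proof (rule cshape_regular_split[OF n(1,2)])
        show "cvert (\<lambda>_. pi / real n) n = 0" unfolding n_def by (rule f(3))
        show "omega_lengths N r 0 = 0" by (simp add: omega_lengths_def a)
        show "omega_lengths N r 1 = pi / real n / 2" "omega_lengths N r (n + 1) = pi / real n / 2"
          using l n(4) unfolding n_def[symmetric] by (simp_all add: omega_lengths_def omega_b_def h a)
        show "omega_lengths N r m = pi / real n" if "2 \<le> m" "m \<le> n" for m
          using that l n(4) unfolding n_def[symmetric] by (simp add: omega_lengths_def)
      qed
      have "(g \<circ> f) ` K = cshape (2 * N + 1) (omega_lengths N r)"
        by (simp only: image_comp[symmetric] f(2)[folded n_def] g(2) n(3))
      then show thesis using that rigid_motion_compose[OF g(1) f(1)] by blast
    qed
  next
    case (2 M)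
    have "reuleaux_inradius (2 * M - 1) < reuleaux_inradius (2 * N + 1)"
      "reuleaux_inradius (2 * N - 1) < reuleaux_inradius (2 * M + 1)"
      using 2 r by auto
    moreover have "2 \<le> 2 * M - 1" "2 \<le> 2 * M + 1" "2 \<le> 2 * N - 1" "2 \<le> 2 * N + 1"
      using N 2(1) by auto
    ultimately have "2 * M - 1 < 2 * N + 1" "2 * N - 1 < 2 * M + 1"
      using less_iff[of "2 * M - 1" "2 * N + 1"] less_iff[of "2 * N - 1" "2 * M + 1"] by blast+
    then have "M = N" by linarith
    moreover have "1 \<le> M" using 2(1) by simp
    ultimately show thesis using intermediate_canonical[OF 2(4)] that by blast
  qed
qed

lemma is_Omega_cw: "is_Omega r K \<Longrightarrow> constant_width_one K"
  unfolding is_Omega_def regular_reuleaux_polygon_def intermediate_omega_def reuleaux_polygon_def by blast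

lemma omega_close_within:
  assumes N: "2 \<le> N" and r0: "reuleaux_inradius (2 * N - 1) \<le> r0" "r0 \<le> reuleaux_inradius (2 * N + 1)"
    and K0: "is_Omega r0 K0" and e: "0 < e"
  shows "\<exists>d>0. \<forall>r K. reuleaux_inradius (2 * N - 1) \<le> r \<longrightarrow> r \<le> reuleaux_inradius (2 * N + 1) \<longrightarrow>
    \<bar>r - r0\<bar> < d \<longrightarrow> is_Omega r K \<longrightarrow> (\<exists>f. rigid_motion f \<and> hclose e (f ` K) K0)"
proof -
  let ?n = "2 * N + 1"
  have bnd: "0 < r" "r < 1 / 2"
    if "reuleaux_inradius (2 * N - 1) \<le> r" "r \<le> reuleaux_inradius (2 * N + 1)" for r
  proof -
    show "r < 1 / 2" using reuleaux_inradius_props(1)[of "2 * N + 1"] that N by simp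
    have "reuleaux_inradius 3 \<le> reuleaux_inradius (2 * N - 1)"
      using reuleaux_inradius_less_iff[of "2 * N - 1" 3] N by (simp add: not_less[symmetric])
    then show "0 < r" using reuleaux_inradius_3 r3_pos that by linarith
  qed
  obtain f0 where f0: "rigid_motion f0" "f0 ` K0 = cshape ?n (omega_lengths N r0)"
    using omega_canonical[OF N r0 K0] by blast
  obtain g0 where g0: "rigid_motion g0" "\<forall>x. g0 (f0 x) = x"
    using rigid_motion_left_inverse[OF f0(1)] by blast
  have K0_eq: "K0 = g0 ` cshape ?n (omega_lengths N r0)"
    unfolding f0(2)[symmetric] by (simp add: image_image g0)
  obtain c where c: "0 < c" "\<forall>L L'. (\<forall>m<?n. 0 \<le> L m \<and> 0 \<le> L' m \<and> \<bar>L m - L' m\<bar> \<le> c) \<longrightarrow>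
      hclose e (cshape ?n L) (cshape ?n L')"
    using cshape_close[OF e, of ?n] by blast
  have "\<forall>\<^sub>F r in at r0. \<bar>omega_lengths N r m - omega_lengths N r0 m\<bar> < c" for m
  proof -
    have "isCont (\<lambda>r. omega_lengths N r m) r0" using bnd[OF r0] by (intro isCont_omega_lengths) auto
    then show ?thesis using c(1) unfolding isCont_def tendsto_iff dist_real_def by blast
  qed
  then have "\<forall>\<^sub>F r in at r0. \<forall>m\<in>{..<?n}. \<bar>omega_lengths N r m - omega_lengths N r0 m\<bar> < c"
    by (intro eventually_ball_finite) auto
  then obtain d where d: "0 < d"
    "\<And>r. r \<noteq> r0 \<Longrightarrow> dist r r0 < d \<Longrightarrow> \<forall>m\<in>{..<?n}. \<bar>omega_lengths N r m - omega_lengths N r0 m\<bar> < c"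
    unfolding eventually_at by auto
  show ?thesis
  proof (intro exI[of _ d] conjI d(1) allI impI)
    fix r K assume r: "reuleaux_inradius (2 * N - 1) \<le> r" "r \<le> reuleaux_inradius (2 * N + 1)"
      "\<bar>r - r0\<bar> < d" and K: "is_Omega r K"
    obtain f where f: "rigid_motion f" "f ` K = cshape ?n (omega_lengths N r)"
      using omega_canonical[OF N r(1,2) K] by blast
    have "\<bar>omega_lengths N r m - omega_lengths N r0 m\<bar> \<le> c" if "m < ?n" for m
      using d(2)[of r] r(3) that c(1) by (cases "r = r0") (auto simp: dist_real_def less_imp_le)
    then have "hclose e (f ` K) (cshape ?n (omega_lengths N r0))" unfolding f(2)
      using omega_lengths_nonneg[OF N bnd[OF r(1,2)] r(1)] omega_lengths_nonneg[OF N bnd[OF r0] r0(1)]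
      by (intro c(2)[rule_format]) auto
    then have "hclose e (g0 ` f ` K) K0"
      unfolding K0_eq by (intro hclose_image rigid_motion_dist[OF g0(1)])
    then show "\<exists>f. rigid_motion f \<and> hclose e (f ` K) K0"
      using rigid_motion_compose[OF g0(1) f(1)] by (intro exI[of _ "g0 \<circ> f"]) (simp add: image_comp)
  qed
qed

text \<open>\<open>r0\<close> is taken in a parameter interval that excludes its right end, so
  parameters above \<open>r0\<close> stay in the same interval. Below \<open>r0\<close> the
  preceding interval may be needed.\<close>

lemma omega_close_pointwise:
  assumes r0: "1 - 1 / sqrt 3 \<le> r0" "r0 < 1 / 2" and e: "0 < e"
  shows "\<exists>d>0. \<exists>C. \<forall>r K. 1 - 1 / sqrt 3 \<le> r \<longrightarrow> \<bar>r - r0\<bar> < d \<longrightarrow> is_Omega r K \<longrightarrow>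
    (\<exists>f. rigid_motion f \<and> hclose e (f ` K) C)"
proof -
  obtain N where N: "2 \<le> N" "reuleaux_inradius (2 * N - 1) \<le> r0" "r0 < reuleaux_inradius (2 * N + 1)"
    using ex_omega_index[OF r0] by blast
  obtain K0 where K0: "is_Omega r0 K0" using ex_is_Omega[OF r0] by blast
  obtain d1 where d1: "0 < d1" "\<forall>r K. reuleaux_inradius (2 * N - 1) \<le> r \<longrightarrow> r \<le> reuleaux_inradius (2 * N + 1) \<longrightarrow>
    \<bar>r - r0\<bar> < d1 \<longrightarrow> is_Omega r K \<longrightarrow> (\<exists>f. rigid_motion f \<and> hclose e (f ` K) K0)"
    using omega_close_within[OF N(1,2) less_imp_le[OF N(3)] K0 e] by (elim exE conjE) (rule that)
  have "\<exists>d2>0. \<forall>r K. 1 - 1 / sqrt 3 \<le> r \<longrightarrow> r < reuleaux_inradius (2 * N - 1) \<longrightarrow> \<bar>r - r0\<bar> < d2 \<longrightarrow>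
      is_Omega r K \<longrightarrow> (\<exists>f. rigid_motion f \<and> hclose e (f ` K) K0)"
  proof (cases "reuleaux_inradius (2 * N - 1) < r0 \<or> N = 2")
    case True
    then show ?thesis
    proof
      assume "reuleaux_inradius (2 * N - 1) < r0"
      then show ?thesis by (intro exI[of _ "r0 - reuleaux_inradius (2 * N - 1)"]) auto
    next
      assume "N = 2"
      then have "reuleaux_inradius (2 * N - 1) = 1 - 1 / sqrt 3" using reuleaux_inradius_3 by simp
      then show ?thesis by (intro exI[of _ 1]) auto
    qed
  next
    \<comment> \<open>Here \<open>r0\<close> is also the right end of the preceding interval, and
      the shapes from there approach the same reference body \<open>K0\<close>.\<close>
    case False
    define M where "M = N - 1"
    have M: "2 \<le> M" "2 * M + 1 = 2 * N - 1" "2 * M - 1 < 2 * N - 1" "2 \<le> 2 * M - 1"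
      using False N(1) by (auto simp: M_def)
    have r0': "r0 = reuleaux_inradius (2 * M + 1)" using False N(2) M(2) by simp
    have lt: "reuleaux_inradius (2 * M - 1) < r0"
      unfolding r0' using M reuleaux_inradius_less_iff[of "2 * M - 1" "2 * M + 1"] by simp
    obtain d2 where d2: "0 < d2" "\<forall>r K. reuleaux_inradius (2 * M - 1) \<le> r \<longrightarrow> r \<le> reuleaux_inradius (2 * M + 1) \<longrightarrow>
      \<bar>r - r0\<bar> < d2 \<longrightarrow> is_Omega r K \<longrightarrow> (\<exists>f. rigid_motion f \<and> hclose e (f ` K) K0)"
      using omega_close_within[OF M(1) less_imp_le[OF lt] eq_refl[OF r0'] K0 e]
      by (elim exE conjE) (rule that)
    show ?thesis
    proof (intro exI[of _ "min d2 (r0 - reuleaux_inradius (2 * M - 1))"] conjI allI impI)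
      show "0 < min d2 (r0 - reuleaux_inradius (2 * M - 1))" using d2(1) lt by simp
      fix r K assume "r < reuleaux_inradius (2 * N - 1)"
        "\<bar>r - r0\<bar> < min d2 (r0 - reuleaux_inradius (2 * M - 1))" "is_Omega r K"
      then show "\<exists>f. rigid_motion f \<and> hclose e (f ` K) K0" using M(2) by (intro d2(2)[rule_format]) auto
    qed
  qed
  then obtain d2 where d2: "0 < d2" "\<forall>r K. 1 - 1 / sqrt 3 \<le> r \<longrightarrow> r < reuleaux_inradius (2 * N - 1) \<longrightarrow>
      \<bar>r - r0\<bar> < d2 \<longrightarrow> is_Omega r K \<longrightarrow> (\<exists>f. rigid_motion f \<and> hclose e (f ` K) K0)"
    by (elim exE conjE) (rule that)
  show ?thesis
  proof (intro exI[of _ "min (min d1 d2) (reuleaux_inradius (2 * N + 1) - r0)"] exI[of _ K0] conjI allI impI)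
    show "0 < min (min d1 d2) (reuleaux_inradius (2 * N + 1) - r0)" using d1(1) d2(1) N(3) by simp
    fix r K assume r: "1 - 1 / sqrt 3 \<le> r" "is_Omega r K"
      "\<bar>r - r0\<bar> < min (min d1 d2) (reuleaux_inradius (2 * N + 1) - r0)"
    then have "r \<le> reuleaux_inradius (2 * N + 1)" by (simp add: abs_less_iff)
    then show "\<exists>f. rigid_motion f \<and> hclose e (f ` K) K0"
      using d1(2)[rule_format, of r K] d2(2)[rule_format, of r K] r by (cases "r < reuleaux_inradius (2 * N - 1)") auto
  qed
qed

text \<open>Intermediate shapes carry their incircle in the definition. For regular polygons it is
  transported from the constructed example through the common canonical position.\<close>

lemma is_Omega_incircle:
  assumes "is_Omega r K"
  obtains c where "cball c r \<subseteq> K"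
  using assms unfolding is_Omega_def
proof (elim disjE exE conjE)
  fix N assume N: "1 \<le> N" "r = reuleaux_inradius (2 * N + 1)" "regular_reuleaux_polygon K (2 * N + 1)"
  obtain K' where K': "regular_reuleaux_polygon K' (2 * N + 1)" "is_incircle K' 0 r"
    using ex_regular[OF N(1)] N(2) by blast
  have n: "0 < 2 * N + 1" by simp
  obtain f where f: "rigid_motion f" "f ` K = cshape (2 * N + 1) (\<lambda>_. pi / real (2 * N + 1))"
    by (rule regular_canonical[OF N(3) n])
  obtain f' where f': "rigid_motion f'" "f' ` K' = cshape (2 * N + 1) (\<lambda>_. pi / real (2 * N + 1))"
    by (rule regular_canonical[OF K'(1) n])
  obtain g where g: "rigid_motion g" "\<forall>x. g (f x) = x"
    using rigid_motion_left_inverse[OF f(1)] by blast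
  have "K = g ` f' ` K'" unfolding f'(2) f(2)[symmetric] by (simp add: image_image g)
  moreover have "g ` f' ` cball 0 r \<subseteq> g ` f' ` K'"
    using K'(2) unfolding is_incircle_def by (intro image_mono) simp
  ultimately have "cball (g (f' 0)) r \<subseteq> K"
    by (simp add: rigid_motion_cball[OF f'(1)] rigid_motion_cball[OF g(1)])
  then show thesis by (rule that)
next
  fix N assume "intermediate_omega N r K"
  then have "\<exists>c. is_incircle K c r" unfolding intermediate_omega_def by (elim exE conjE) (rule exI)
  then show thesis using that unfolding is_incircle_def by blast
qed

lemma omega_close_disk:
  assumes K: "is_Omega r K" and r: "0 \<le> r" "r < 1 / 2"
  obtains f where "rigid_motion f" "hclose (1 / 2 - r) (f ` K) (cball 0 (1 / 2))"
proof -
  obtain c where c: "cball c r \<subseteq> K" using is_Omega_incircle[OF K] by blast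
  have cw: "constant_width_one K" by (rule is_Omega_cw[OF K])
  have c': "K \<subseteq> cball c (1 - r)" using cw_cball_dual[OF cw, of r c] c r by simp
  define f where "f = (\<lambda>x. x + - c)"
  have f: "rigid_motion f" unfolding f_def by (rule rigid_motion_translation)
  have "f ` cball c r \<subseteq> f ` K" "f ` K \<subseteq> f ` cball c (1 - r)" using c c' by (intro image_mono; simp)+
  then have b: "cball 0 r \<subseteq> f ` K" "f ` K \<subseteq> cball 0 (1 - r)"
    unfolding rigid_motion_cball[OF f] by (simp_all add: f_def)
  have "hclose (1 / 2 - r) (f ` K) (cball 0 (1 / 2))"
    unfolding hclose_def
  proof (intro conjI ballI)
    fix x assume "x \<in> f ` K"
    then have x: "norm x \<le> 1 - r" using b(2) by auto
    \<comment> \<open>Scaling by \<open>q\<close> maps the outer disk of radius \<open>1 - r\<close>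
      onto the disk of radius 1/2; below, scaling by \<open>2 * r\<close> maps the latter onto the
      inner disk.\<close>
    define q where "q = 1 / (2 * (1 - r))"
    have q: "0 < q" "q < 1" "(1 - r) * q = 1 / 2" using r by (auto simp: q_def field_simps)
    have "norm x * q \<le> (1 - r) * q" using x q by (intro mult_right_mono) auto
    then have "q * norm x \<le> 1 / 2" unfolding q(3) by (simp only: mult.commute)
    then have "q *\<^sub>R x \<in> cball 0 (1 / 2)" using q(1) by simp
    moreover have "dist x (q *\<^sub>R x) \<le> 1 / 2 - r"
    proof -
      have "x - q *\<^sub>R x = (1 - q) *\<^sub>R x" by (simp add: algebra_simps)
      then have "dist x (q *\<^sub>R x) = (1 - q) * norm x" using q by (simp add: dist_norm)
      also have "\<dots> \<le> (1 - q) * (1 - r)" using x q by (intro mult_left_mono) auto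
      also have "\<dots> = 1 / 2 - r" using q(3) by (simp add: algebra_simps)
      finally show ?thesis .
    qed
    ultimately show "\<exists>y\<in>cball 0 (1 / 2). dist x y \<le> 1 / 2 - r" by blast
  next
    fix y :: "real^2" assume y: "y \<in> cball 0 (1 / 2)"
    define x where "x = (2 * r) *\<^sub>R y"
    have "r * norm y \<le> r * (1 / 2)" using y r by (intro mult_left_mono) auto
    then have "x \<in> f ` K" using b(1) r by (auto simp: x_def)
    moreover have "dist x y \<le> 1 / 2 - r"
    proof -
      have "y - x = (1 - 2 * r) *\<^sub>R y" by (simp add: x_def algebra_simps)
      moreover have "dist x y = norm (y - x)" by (simp add: dist_norm norm_minus_commute)
      ultimately have "dist x y = (1 - 2 * r) * norm y" using r by simp
      also have "\<dots> \<le> (1 - 2 * r) * (1 / 2)" using y r by (intro mult_left_mono) auto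
      finally show ?thesis by simp
    qed
    ultimately show "\<exists>x\<in>f ` K. dist x y \<le> 1 / 2 - r" by blast
  qed
  then show thesis using that f by blast
qed

text \<open>A Lebesgue number for a cover of the closed interval gives uniformity. The value
  \<open>e / 3\<close> leaves strict room after two triangle steps.\<close>

lemma omega_uniformly_close:
  assumes "0 < e"
  shows "\<exists>\<delta>>0. \<forall>r\<^sub>1\<in>{1 - 1 / sqrt 3..<1/2}. \<forall>r\<^sub>2\<in>{1 - 1 / sqrt 3..<1/2}. \<bar>r\<^sub>1 - r\<^sub>2\<bar> < \<delta> \<longrightarrow>
    (\<forall>K\<^sub>1 K\<^sub>2. is_Omega r\<^sub>1 K\<^sub>1 \<longrightarrow> is_Omega r\<^sub>2 K\<^sub>2 \<longrightarrow>
      (\<exists>f g. rigid_motion f \<and> rigid_motion g \<and> hausdorff_dist (f ` K\<^sub>1) (g ` K\<^sub>2) < e))"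
proof -
  define e' where "e' = e / 3"
  have e': "0 < e'" using assms by (simp add: e'_def)
  \<comment> \<open>Open sets of parameters on which all shapes are within \<open>e'\<close> of one
    common set \<open>C\<close>, up to rigid motions. At \<open>1 / 2\<close>, where no shape is
    defined, \<open>C\<close> is the disk.\<close>
  define \<G> where "\<G> = {G. open G \<and> (\<exists>C. \<forall>r K. r \<in> G \<longrightarrow> 1 - 1 / sqrt 3 \<le> r \<longrightarrow> r < 1 / 2 \<longrightarrow> is_Omega r K \<longrightarrow>
    (\<exists>f. rigid_motion f \<and> hclose e' (f ` K) C))}"
  have "{1 - 1 / sqrt 3..1 / 2} \<subseteq> \<Union>\<G>"
  proof
    fix r0 :: real assume r0: "r0 \<in> {1 - 1 / sqrt 3..1 / 2}"
    show "r0 \<in> \<Union>\<G>"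
    proof (cases "r0 < 1 / 2")
      case True
      then have "1 - 1 / sqrt 3 \<le> r0" "r0 < 1 / 2" using r0 by auto
      from omega_close_pointwise[OF this e']
      obtain d C where d: "0 < d" "\<forall>r K. 1 - 1 / sqrt 3 \<le> r \<longrightarrow> \<bar>r - r0\<bar> < d \<longrightarrow> is_Omega r K \<longrightarrow>
        (\<exists>f. rigid_motion f \<and> hclose e' (f ` K) C)"
        by (elim exE conjE) (rule that)
      have "ball r0 d \<in> \<G>" unfolding \<G>_def
        by (intro CollectI conjI open_ball exI[of _ C] allI impI d(2)[rule_format]) (auto simp: dist_real_def abs_minus_commute)
      then show ?thesis using d(1) by (intro UnionI[of "ball r0 d"]) auto
    next
      case False
      have "{1 / 2 - e'<..} \<in> \<G>" unfolding \<G>_def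
      proof (intro CollectI conjI exI[of _ "cball 0 (1 / 2)"] allI impI)
        fix r K assume r: "r \<in> {1 / 2 - e'<..}" "1 - 1 / sqrt 3 \<le> r" "r < 1 / 2" and K: "is_Omega r K"
        have "0 \<le> r" using r(2) r3_pos by linarith
        then obtain f where "rigid_motion f" "hclose (1 / 2 - r) (f ` K) (cball 0 (1 / 2))"
          using omega_close_disk[OF K _ r(3)] by blast
        then show "\<exists>f. rigid_motion f \<and> hclose e' (f ` K) (cball 0 (1 / 2))"
          using hclose_mono[of "1 / 2 - r" _ _ e'] r(1) by force
      qed simp
      then show ?thesis using False r0 e' by (intro UnionI[of "{1 / 2 - e'<..}"]) auto
    qed
  qed
  then obtain d where d: "0 < d" "\<And>x. x \<in> {1 - 1 / sqrt 3..1 / 2} \<Longrightarrow> \<exists>G\<in>\<G>. ball x d \<subseteq> G"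
    by (rule Heine_Borel_lemma[OF compact_Icc]) (auto simp: \<G>_def)
  show ?thesis
  proof (intro exI[of _ d] conjI d(1) ballI allI impI)
    fix r1 r2 :: real and K1 K2
    assume r: "r1 \<in> {1 - 1 / sqrt 3..<1/2}" "r2 \<in> {1 - 1 / sqrt 3..<1/2}" "\<bar>r1 - r2\<bar> < d"
      and K: "is_Omega r1 K1" "is_Omega r2 K2"
    obtain G where G: "G \<in> \<G>" "ball r1 d \<subseteq> G" using d(2)[of r1] r(1) by auto
    have "r1 \<in> G" "r2 \<in> G" using G(2) r(3) d(1) by (auto simp: dist_real_def subset_iff)
    moreover have r': "1 - 1 / sqrt 3 \<le> r1" "r1 < 1 / 2" "1 - 1 / sqrt 3 \<le> r2" "r2 < 1 / 2"
      using r(1,2) by auto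
    moreover obtain C where C: "\<forall>r K. r \<in> G \<longrightarrow> 1 - 1 / sqrt 3 \<le> r \<longrightarrow> r < 1 / 2 \<longrightarrow> is_Omega r K \<longrightarrow>
      (\<exists>f. rigid_motion f \<and> hclose e' (f ` K) C)"
      using G(1) unfolding \<G>_def mem_Collect_eq by (elim exE conjE) (rule that)
    ultimately have "\<exists>f. rigid_motion f \<and> hclose e' (f ` K1) C" "\<exists>g. rigid_motion g \<and> hclose e' (g ` K2) C"
      using K by blast+
    then obtain f g where fg: "rigid_motion f" "hclose e' (f ` K1) C" "rigid_motion g" "hclose e' (g ` K2) C"
      by blast
    have "hclose (e' + e') (f ` K1) (g ` K2)" using hclose_trans[OF fg(2) hclose_sym[OF fg(4)]] .
    then have "hausdorff_dist (f ` K1) (g ` K2) \<le> e' + e'"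
      using cwD(3)[OF is_Omega_cw[OF K(1)]] cwD(3)[OF is_Omega_cw[OF K(2)]]
      by (intro hclose_hausdorff_dist) auto
    then have "hausdorff_dist (f ` K1) (g ` K2) < e" using assms by (simp add: e'_def)
    then show "\<exists>f g. rigid_motion f \<and> rigid_motion g \<and> hausdorff_dist (f ` K1) (g ` K2) < e"
      using fg by blast
  qed
qed


section \<open>Contact points with the outercircle\<close>

text \<open>Otherwise a line separates 0 from all contact points, and shifting the centre slightly
  towards them gives a smaller enclosing disk, hence by duality a larger inscribed one.\<close>

lemma contact_points_balanced:
  assumes K: "constant_width_one K" and inc: "is_incircle K 0 r" and r: "r < 1 / 2"
  shows "0 \<in> convex hull (K \<inter> sphere 0 (1 - r))"
proof (rule ccontr)
  define R where "R = 1 - r"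
  assume "0 \<notin> convex hull (K \<inter> sphere 0 (1 - r))"
  then have n0: "0 \<notin> convex hull (K \<inter> sphere 0 R)" by (simp add: R_def)
  note k = cwD[OF K]
  have r0: "0 \<le> r" "cball 0 r \<subseteq> K" using inc by (auto simp: is_incircle_def)
  have KR: "K \<subseteq> cball 0 R" using cw_cball_dual[OF K, of r 0] r0 r by (simp add: R_def)
  have "compact (K \<inter> sphere 0 R)" using k(1) by (intro compact_Int_closed) auto
  then have "closed (convex hull (K \<inter> sphere 0 R))"
    by (intro compact_imp_closed compact_convex_hull)
  then obtain a b where ab: "a \<noteq> 0" "0 < b" "\<forall>x\<in>convex hull (K \<inter> sphere 0 R). a \<bullet> x > b"
    using separating_hyperplane_closed_0[OF convex_convex_hull _ n0] by blast
  \<comment> \<open>The part of \<open>K\<close> beyond the separating line misses the outercircle,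
    so by compactness its norms are bounded by some \<open>q < R\<close>.\<close>
  define Y where "Y = K \<inter> {x. a \<bullet> x \<le> b}"
  have Y: "compact Y" unfolding Y_def using k(1) by (intro compact_Int_closed closed_halfspace_le)
  have Yless: "norm x < R" if "x \<in> Y" for x
  proof -
    have "x \<in> K" "a \<bullet> x \<le> b" using that by (auto simp: Y_def)
    moreover have "a \<bullet> x > b" if "norm x = R"
      using ab(3)[rule_format, OF hull_inc, of x] that \<open>x \<in> K\<close> by simp
    ultimately have "norm x \<le> R" "norm x \<noteq> R" using KR by auto
    then show ?thesis by simp
  qed
  have "\<exists>q<R. \<forall>x\<in>Y. norm x \<le> q"
  proof (cases "Y = {}")
    case False
    have "continuous_on Y (\<lambda>x. norm x)" by (intro continuous_intros)
    from continuous_attains_sup[OF Y False this]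
    obtain y where "y \<in> Y" "\<forall>x\<in>Y. norm x \<le> norm y" by blast
    then show ?thesis using Yless by blast
  qed (auto intro: exI[of _ "R - 1"])
  then obtain q where q: "q < R" "\<forall>x\<in>Y. norm x \<le> q" by blast
  \<comment> \<open>The first bound makes the linear gain outweigh the quadratic term on the side of
    the contact points; the second keeps the points of \<open>Y\<close> within a smaller
    radius.\<close>
  define \<eta> where "\<eta> = min (b / (norm a)\<^sup>2) ((R - q) / (2 * norm a))"
  have na: "0 < norm a" using ab(1) by simp
  have \<eta>: "0 < \<eta>" using ab(2) q(1) na by (simp add: \<eta>_def)
  have "\<eta> * (norm a)\<^sup>2 \<le> b / (norm a)\<^sup>2 * (norm a)\<^sup>2" "\<eta> * (2 * norm a) \<le> (R - q) / (2 * norm a) * (2 * norm a)"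
    using na by (intro mult_right_mono; simp add: \<eta>_def)+
  then have \<eta>1: "\<eta> * (norm a)\<^sup>2 \<le> b" and \<eta>2: "2 * (\<eta> * norm a) \<le> R - q" using na by auto
  have "continuous_on K (\<lambda>x. dist (\<eta> *\<^sub>R a) x)" by (intro continuous_intros)
  from continuous_attains_sup[OF k(1,3) this]
  obtain y where y: "y \<in> K" "\<forall>x\<in>K. dist (\<eta> *\<^sub>R a) x \<le> dist (\<eta> *\<^sub>R a) y" by blast
  define R' where "R' = dist (\<eta> *\<^sub>R a) y"
  have "R' < R"
  proof (cases "y \<in> Y")
    case True
    have "R' \<le> norm (\<eta> *\<^sub>R a) + norm y" unfolding R'_def dist_norm by (rule norm_triangle_ineq4)
    also have "\<dots> \<le> \<eta> * norm a + q" using \<eta> q(2) True by simp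
    finally show ?thesis using \<eta>2 q(1) by linarith
  next
    case False
    then have ay: "a \<bullet> y > b" using y(1) by (auto simp: Y_def)
    have "R'\<^sup>2 = (norm y)\<^sup>2 - 2 * (\<eta> * (a \<bullet> y)) + \<eta> * (\<eta> * (norm a)\<^sup>2)"
      unfolding R'_def dist_norm power2_norm_eq_inner
      by (simp add: inner_diff inner_commute algebra_simps power2_eq_square)
    also have "\<dots> < R\<^sup>2 - 2 * (\<eta> * b) + \<eta> * b"
    proof -
      have "norm y \<le> R" using KR y(1) by auto
      then have "(norm y)\<^sup>2 \<le> R\<^sup>2" by (rule power_mono) simp
      moreover have "\<eta> * b < \<eta> * (a \<bullet> y)" using \<eta> ay by simp
      moreover have "\<eta> * (\<eta> * (norm a)\<^sup>2) \<le> \<eta> * b" using \<eta> \<eta>1 by simp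
      ultimately show ?thesis by linarith
    qed
    also have "\<dots> \<le> R\<^sup>2" using \<eta> ab(2) by simp
    finally show ?thesis using r power2_less_imp_less[of R' R] by (simp add: R_def)
  qed
  moreover have "K \<subseteq> cball (\<eta> *\<^sub>R a) R'" using y(2) by (auto simp: R'_def)
  moreover have "0 \<le> R'" by (simp add: R'_def)
  ultimately have "cball (\<eta> *\<^sub>R a) (1 - R') \<subseteq> K"
    using cw_cball_dual[OF K, of "1 - R'" "\<eta> *\<^sub>R a"] r0(1) by (simp add: R_def)
  then have "1 - R' \<le> r" using inc unfolding is_incircle_def by blast
  then show False using \<open>R' < R\<close> by (simp add: R_def)
qed

text \<open>Caratheodory gives at most three points with positive weights. A single one cannot
  balance, and two would be antipodal, at distance \<open>2 * (1 - r) > 1\<close>.\<close>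

lemma three_contact_points:
  assumes K: "constant_width_one K" and inc: "is_incircle K 0 r" and r: "r < 1 / 2"
  obtains v1 v2 v3 m1 m2 m3 where
    "norm v1 = 1" "norm v2 = 1" "norm v3 = 1" "v1 \<noteq> v2" "v1 \<noteq> v3" "v2 \<noteq> v3"
    "0 < m1" "0 < m2" "0 < m3" "m1 + m2 + m3 = 1" "m1 *\<^sub>R v1 + m2 *\<^sub>R v2 + m3 *\<^sub>R v3 = (0::real^2)"
    "(1 - r) *\<^sub>R v1 \<in> K" "(1 - r) *\<^sub>R v2 \<in> K" "(1 - r) *\<^sub>R v3 \<in> K"
proof -
  define R where "R = 1 - r"
  have R: "1 / 2 < R" using r by (simp add: R_def)
  obtain S u where S: "finite S" "S \<subseteq> K \<inter> sphere 0 R" "card S \<le> DIM(real^2) + 1" "\<forall>x\<in>S. 0 \<le> u x"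
    "sum u S = 1" "(\<Sum>v\<in>S. u v *\<^sub>R v) = 0"
    using contact_points_balanced[OF assms] unfolding R_def[symmetric] convex_hull_caratheodory mem_Collect_eq
    by (elim exE conjE) (rule that; assumption)
  define X where "X = {x \<in> S. u x \<noteq> 0}"
  have X: "finite X" "X \<subseteq> S" using S(1) by (auto simp: X_def)
  have pos: "0 < u x" if "x \<in> X" for x using that S(4) by (auto simp: X_def less_le)
  have sum: "sum u X = 1" "(\<Sum>v\<in>X. u v *\<^sub>R v) = 0"
    using S(5,6) sum.mono_neutral_left[OF S(1) X(2), of u]
      sum.mono_neutral_left[OF S(1) X(2), of "\<lambda>v. u v *\<^sub>R v"] by (auto simp: X_def)
  have nX: "norm x = R" "x \<in> K" if "x \<in> X" for x using that X(2) S(2) by auto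
  have "card X \<le> 3" using card_mono[OF S(1) X(2)] S(3) by simp
  moreover have "card X \<noteq> 0" using sum(1) X(1) by auto
  moreover have "card X \<noteq> 1"
  proof
    assume "card X = 1"
    then obtain x where "X = {x}" by (auto simp: card_1_singleton_iff)
    then show False using sum nX(1)[of x] R by auto
  qed
  moreover have "card X \<noteq> 2"
  proof
    assume "card X = 2"
    then obtain x y where xy: "X = {x, y}" "x \<noteq> y" by (auto simp: card_2_iff)
    have e: "u x *\<^sub>R x = - (u y *\<^sub>R y)" using sum(2) xy by (simp add: add_eq_0_iff)
    have "norm (u x *\<^sub>R x) = norm (u y *\<^sub>R y)" unfolding e by simp
    then have "u x = u y" using nX(1)[of x] nX(1)[of y] pos[of x] pos[of y] xy R by simp
    then have "x = - y" using e pos[of y] xy by (simp flip: scaleR_minus_right)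
    then have "x - y = - (2 *\<^sub>R y)" unfolding scaleR_2 by simp
    then have "dist x y = norm (2 *\<^sub>R y)" by (simp only: dist_norm norm_minus_cancel)
    then have "dist x y = 2 * R" using nX(1)[of y] xy by (simp only: norm_scaleR) simp
    then show False using cw_diam[OF K, of x y] nX(2) xy R by simp
  qed
  ultimately have "card X = 3" by simp
  then obtain x y z where xyz: "X = {x, y, z}" "x \<noteq> y" "x \<noteq> z" "y \<noteq> z" by (auto simp: card_3_iff)
  have m: "x \<in> X" "y \<in> X" "z \<in> X" using xyz by auto
  have s: "u x + u y + u z = 1" "u x *\<^sub>R x + u y *\<^sub>R y + u z *\<^sub>R z = 0"
    using sum xyz by (simp_all add: add.assoc)
  show thesis
  proof (rule that[of "(1 / R) *\<^sub>R x" "(1 / R) *\<^sub>R y" "(1 / R) *\<^sub>R z" "u x" "u y" "u z"])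
    have "u x *\<^sub>R (1 / R) *\<^sub>R x + u y *\<^sub>R (1 / R) *\<^sub>R y + u z *\<^sub>R (1 / R) *\<^sub>R z =
        (1 / R) *\<^sub>R (u x *\<^sub>R x + u y *\<^sub>R y + u z *\<^sub>R z)"
      by (simp add: scaleR_add_right)
    then show "u x *\<^sub>R (1 / R) *\<^sub>R x + u y *\<^sub>R (1 / R) *\<^sub>R y + u z *\<^sub>R (1 / R) *\<^sub>R z = 0" unfolding s by simp
  qed (use m xyz nX pos R s R_def in auto)
qed

text \<open>The two directions are at most 60 degrees apart, so a Reuleaux triangle with a vertex at
  0 can be turned until the arc about that vertex contains both.\<close>

lemma ex_cw_triangle:
  assumes w: "norm w2 = 1" "norm w3 = 1" "1 / 2 \<le> w2 \<bullet> (w3::real^2)"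
  shows "\<exists>L. constant_width_one L \<and> 0 \<in> L \<and> w2 \<in> L \<and> w3 \<in> L"
proof -
  obtain K p t where K: "constant_width_one K" "p \<in> K" "unit_arc p t (pi / 3) \<subseteq> K"
    using ex_reuleaux_triangle by blast
  obtain \<alpha> where \<alpha>: "w2 = unit_dir \<alpha>" using ex_unit_dir[OF w(1)] by blast
  \<comment> \<open>The window of angles is centred at \<alpha>, so
    \<open>\<bar>\<alpha> - \<beta>\<bar>\<close> is at most \<open>pi\<close> and its cosine
    determines it.\<close>
  obtain \<beta> where \<beta>: "\<alpha> - pi \<le> \<beta>" "\<beta> < \<alpha> - pi + 2 * pi" "w3 = unit_dir \<beta>" using ex_unit_dir[OF w(2)] by blast
  have c: "1 / 2 \<le> cos \<bar>\<alpha> - \<beta>\<bar>" using w(3) unfolding \<alpha> \<beta>(3) unit_dir_inner by simp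
  have "\<bar>\<alpha> - \<beta>\<bar> \<le> pi / 3"
  proof (rule ccontr)
    assume "\<not> \<bar>\<alpha> - \<beta>\<bar> \<le> pi / 3"
    moreover have "\<bar>\<alpha> - \<beta>\<bar> \<le> pi" using \<beta>(1,2) by linarith
    ultimately have "cos \<bar>\<alpha> - \<beta>\<bar> < cos (pi / 3)" by (intro cos_monotone_0_pi) auto
    then show False using c by (simp add: cos_60)
  qed
  then have ab: "\<alpha> \<le> min \<alpha> \<beta> + pi / 3" "\<beta> \<le> min \<alpha> \<beta> + pi / 3" by linarith+
  define g where "g = min \<alpha> \<beta>"
  define f where "f = (\<lambda>x. rot (g - t) x + - rot (g - t) p)"
  have f: "rigid_motion f" unfolding f_def by (rule rigid_motion_rot)
  have "unit_dir s \<in> f ` K" if "g \<le> s" "s \<le> g + pi / 3" for s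
  proof -
    have "p + unit_dir (s - g + t) \<in> unit_arc p t (pi / 3)" unfolding unit_arc_def using that by (intro imageI) auto
    then have "f (p + unit_dir (s - g + t)) \<in> f ` K" using K(3) by blast
    then show ?thesis by (simp add: f_def)
  qed
  then have "w2 \<in> f ` K" "w3 \<in> f ` K" using ab unfolding \<alpha> \<beta>(3) g_def[symmetric] by (auto simp: g_def)
  moreover have "0 \<in> f ` K" using K(2) by (intro image_eqI[of _ _ p]) (simp add: f_def)
  ultimately show ?thesis using rigid_motion_cw[OF f K(1)] by blast
qed

text \<open>Normalising \<open>d + x\<close> times \<open>v\<close> for small positive
  \<open>x\<close> turns \<open>d\<close> towards \<open>v\<close>; the strict inequality for
  \<open>z\<close> survives by continuity.\<close>

lemma ex_turned_unit_vector:
  fixes d v z :: "'a::real_inner"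
  assumes d: "norm d = 1" and v: "norm v = 1" and dv: "0 < d \<bullet> v" "d \<noteq> v" and z: "q < d \<bullet> z"
  obtains w where "norm w = 1" "d \<bullet> v < w \<bullet> v" "q \<le> w \<bullet> z"
proof -
  define c where "c = d \<bullet> v"
  have c: "0 < c" "c < 1"
  proof -
    have "c \<noteq> 1" using norm_le_1_inner_eq_1[of d v] d v dv(2) by (auto simp: c_def)
    moreover have "c \<le> 1" using norm_cauchy_schwarz[of d v] d v by (simp add: c_def)
    ultimately show "c < 1" "0 < c" using dv(1) by (auto simp: c_def)
  qed
  define D where "D x = d + x *\<^sub>R v" for x
  have n2: "(norm (D x))\<^sup>2 = 1 + 2 * x * c + x\<^sup>2" for x
    using d v unfolding power2_norm_eq_inner D_def
    by (simp add: inner_add inner_commute c_def norm_eq_1 power2_eq_square algebra_simps)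
  have "((\<lambda>x. D x \<bullet> z / norm (D x)) \<longlongrightarrow> D 0 \<bullet> z / norm (D 0)) (at_right 0)"
    unfolding D_def using d by (intro tendsto_intros) auto
  moreover have "q < D 0 \<bullet> z / norm (D 0)" using z d by (simp add: D_def)
  ultimately have "\<forall>\<^sub>F x in at_right 0. q < D x \<bullet> z / norm (D x)" by (rule order_tendstoD)
  moreover have "\<forall>\<^sub>F x in at_right (0::real). 0 < x" by (simp add: eventually_at_right_less)
  ultimately have "\<forall>\<^sub>F x in at_right 0. q < D x \<bullet> z / norm (D x) \<and> 0 < x" by (rule eventually_conj)
  then obtain x where x: "q < D x \<bullet> z / norm (D x)" "0 < x"
    using eventually_happens trivial_limit_at_right_real by blast
  have nx: "0 < norm (D x)"
  proof -
    have "0 < 1 + 2 * x * c + x\<^sup>2" using x(2) c by (simp add: add_pos_pos)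
    then show ?thesis using n2[of x] by (metis norm_eq_zero power_zero_numeral less_irrefl zero_less_norm_iff)
  qed
  \<comment> \<open>The component along \<open>v\<close> grows faster than the norm: the difference
    of the squares is \<open>(1 - c\<^sup>2) * (2 * c * x + x\<^sup>2)\<close>, positive as
    \<open>0 < c < 1\<close>.\<close>
  have "(c * norm (D x))\<^sup>2 < (c + x)\<^sup>2"
  proof -
    have "c\<^sup>2 < 1" using c by (simp add: power2_less_1_iff abs_if)
    then have "0 < (1 - c\<^sup>2) * (2 * c * x + x\<^sup>2)" using c x(2) by (intro mult_pos_pos add_pos_pos) auto
    moreover have "(c + x)\<^sup>2 - (c * norm (D x))\<^sup>2 = (1 - c\<^sup>2) * (2 * c * x + x\<^sup>2)"
      unfolding power_mult_distrib n2 by (simp add: power2_eq_square algebra_simps)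
    ultimately show ?thesis by linarith
  qed
  then have "c * norm (D x) < c + x" using c x(2) by (auto dest: power2_less_imp_less)
  moreover have "D x \<bullet> v = c + x" using v by (simp add: D_def inner_add_left c_def norm_eq_1)
  ultimately have "c < D x \<bullet> v / norm (D x)" using nx by (simp add: pos_less_divide_eq)
  then show thesis
    using x nx by (intro that[of "(1 / norm (D x)) *\<^sub>R D x"]) (auto simp: c_def)
qed

text \<open>A Reuleaux triangle with one vertex at the contact point opposite to the shortest side of the contact
  triangle and suitably turned has larger support values at the contact directions, on average.\<close>

lemma ex_larger_average_support:
  fixes v1 v2 v3 :: "real^2"
  assumes v: "norm v1 = 1" "norm v2 = 1" "norm v3 = 1" "v1 \<noteq> v2" "v1 \<noteq> v3"
    and m: "0 < m1" "0 < m2" "0 < m3" "m1 + m2 + m3 = 1" "m1 *\<^sub>R v1 + m2 *\<^sub>R v2 + m3 *\<^sub>R v3 = 0"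
    and R: "1 / 2 < R" "3 * R\<^sup>2 < 1" and d: "R * dist v1 v2 \<le> 1" "R * dist v1 v3 \<le> 1"
    and short: "dist v2 v3 \<le> dist v1 v2" "dist v2 v3 \<le> dist v1 v3"
  shows "\<exists>L. constant_width_one L \<and> R < m1 * hsup L v1 + m2 * hsup L v2 + m3 * hsup L v3"
proof -
  \<comment> \<open>The edges of the contact triangle that start at the contact point in direction
    \<open>v1\<close>, which is moved to the origin.\<close>
  define d2 where "d2 = R *\<^sub>R (v2 - v1)"
  define d3 where "d3 = R *\<^sub>R (v3 - v1)"
  have R0: "0 < R" using R by simp
  have n: "norm d2 = R * dist v1 v2" "norm d3 = R * dist v1 v3" "norm (d2 - d3) = R * dist v2 v3"
    using R0 by (simp_all add: d2_def d3_def dist_norm norm_minus_commute flip: scaleR_diff_right)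
  have n_pos: "0 < norm d2" "0 < norm d3" using R0 v by (auto simp: d2_def d3_def)
  have n_le: "norm d2 \<le> 1" "norm d3 \<le> 1" "norm (d2 - d3) \<le> norm d2" "norm (d2 - d3) \<le> norm d3"
    using d short R0 by (auto simp: n)
  have inner_less: "x \<bullet> y < 1" if "norm x = 1" "norm y = 1" "x \<noteq> y" for x y :: "real^2"
    using norm_le_1_inner_eq_1[of x y] that by force
  have dv: "0 < d2 \<bullet> v2" "0 < d3 \<bullet> v3"
    using inner_less[OF v(1,2,4)] inner_less[OF v(1,3,5)] v R0
    by (simp_all add: d2_def d3_def inner_diff_left norm_eq_1)
  \<comment> \<open>The contact triangle itself has average \<open>R\<close>; the vertex in
    direction \<open>v1\<close>, being at the origin, contributes 0.\<close>
  have avg: "m2 * (d2 \<bullet> v2) + m3 * (d3 \<bullet> v3) = R"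
  proof -
    have "m2 * (d2 \<bullet> v2) + m3 * (d3 \<bullet> v3) =
        R * (m1 + m2 + m3 - v1 \<bullet> (m1 *\<^sub>R v1 + m2 *\<^sub>R v2 + m3 *\<^sub>R v3))"
      using v by (simp add: d2_def d3_def inner_diff_left inner_add_right norm_eq_1 algebra_simps)
    then show ?thesis unfolding m by simp
  qed
  \<comment> \<open>It is enough to replace the edges by unit vectors at most 60 degrees apart that
    lose in no contact direction and gain in one.\<close>
  have suffices: ?thesis
    if w: "norm w2 = 1" "norm w3 = 1" "1 / 2 \<le> w2 \<bullet> w3"
      and gain: "d2 \<bullet> v2 \<le> w2 \<bullet> v2" "d3 \<bullet> v3 \<le> w3 \<bullet> v3" "d2 \<bullet> v2 < w2 \<bullet> v2 \<or> d3 \<bullet> v3 < w3 \<bullet> v3" for w2 w3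
  proof -
    obtain L where L: "constant_width_one L" "0 \<in> L" "w2 \<in> L" "w3 \<in> L"
      using ex_cw_triangle[OF w] by blast
    have h: "0 \<le> hsup L v1" "w2 \<bullet> v2 \<le> hsup L v2" "w3 \<bullet> v3 \<le> hsup L v3"
      using hsup_ge[OF cwD(1)[OF L(1)] L(2), of v1] hsup_ge[OF cwD(1)[OF L(1)] L(3), of v2]
        hsup_ge[OF cwD(1)[OF L(1)] L(4), of v3] by simp_all
    have "m2 * (d2 \<bullet> v2) + m3 * (d3 \<bullet> v3) < m2 * (w2 \<bullet> v2) + m3 * (w3 \<bullet> v3)"
      using gain m by (auto intro: add_less_le_mono add_le_less_mono simp: mult_left_mono)
    also have "\<dots> \<le> m2 * hsup L v2 + m3 * hsup L v3"
      using h m by (intro add_mono mult_left_mono) auto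
    also have "\<dots> \<le> m1 * hsup L v1 + m2 * hsup L v2 + m3 * hsup L v3"
      using h(1) m(1) mult_nonneg_nonneg[of m1 "hsup L v1"] by simp
    finally show ?thesis using L(1) unfolding avg by blast
  qed
  \<comment> \<open>The edge opposite to the origin is a shortest one, so the angle between
    \<open>d2\<close> and \<open>d3\<close> is at most 60 degrees.\<close>
  have cs: "norm d2 * norm d3 \<le> 2 * (d2 \<bullet> d3)"
  proof -
    have "(norm (d2 - d3))\<^sup>2 \<le> norm d2 * norm d3"
      unfolding power2_eq_square using n_le(3,4) by (intro mult_mono) auto
    moreover have "(norm (d2 - d3))\<^sup>2 = (norm d2)\<^sup>2 + (norm d3)\<^sup>2 - 2 * (d2 \<bullet> d3)"
      by (simp add: power2_norm_eq_inner inner_diff inner_commute)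
    moreover have "2 * (norm d2 * norm d3) \<le> (norm d2)\<^sup>2 + (norm d3)\<^sup>2"
      using sum_squares_bound[of "norm d2" "norm d3"] by simp
    ultimately show ?thesis by linarith
  qed
  show ?thesis
  proof (cases "norm d2 = 1 \<and> norm d3 = 1")
    \<comment> \<open>Some edge is shorter than 1. Stretching both to unit length keeps the angle
      and gains along the shorter edge.\<close>
    case False
    define e2 where "e2 = (1 / norm d2) *\<^sub>R d2"
    define e3 where "e3 = (1 / norm d3) *\<^sub>R d3"
    have e: "d2 \<bullet> v2 = norm d2 * (e2 \<bullet> v2)" "d3 \<bullet> v3 = norm d3 * (e3 \<bullet> v3)"
      using n_pos by (simp_all add: e2_def e3_def)
    have ev: "0 < e2 \<bullet> v2" "0 < e3 \<bullet> v3" using dv n_pos unfolding e by (simp_all add: zero_less_mult_iff)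
    show ?thesis
    proof (rule suffices[of e2 e3])
      show "norm e2 = 1" "norm e3 = 1" using n_pos by (auto simp: e2_def e3_def)
      have "e2 \<bullet> e3 = d2 \<bullet> d3 / (norm d2 * norm d3)" by (simp add: e2_def e3_def)
      then show "1 / 2 \<le> e2 \<bullet> e3" using cs n_pos by (simp add: pos_le_divide_eq)
      show "d2 \<bullet> v2 \<le> e2 \<bullet> v2" "d3 \<bullet> v3 \<le> e3 \<bullet> v3" unfolding e using ev n_le by simp_all
      show "d2 \<bullet> v2 < e2 \<bullet> v2 \<or> d3 \<bullet> v3 < e3 \<bullet> v3" unfolding e using ev n_le False by auto
    qed
  next
    case True
    \<comment> \<open>Both edges already have length 1, so one has to be turned, which needs an
      angle strictly below 60 degrees. Exactly 60 degrees would make the triangle equilateral with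
      unit sides, and then \<open>3 * R\<^sup>2 < 1\<close> would give \<open>v1 + v2 + v3\<close> a
      negative squared norm.\<close>
    have half: "1 / 2 < d2 \<bullet> d3"
    proof (rule ccontr)
      assume "\<not> 1 / 2 < d2 \<bullet> d3"
      then have h: "d2 \<bullet> d3 = 1 / 2" using cs True by simp
      have "(R * dist v1 v2)\<^sup>2 = 1" "(R * dist v1 v3)\<^sup>2 = 1" "(R * dist v2 v3)\<^sup>2 = 1"
        using True h unfolding n[symmetric]
        by (simp_all add: power2_norm_eq_inner inner_diff inner_commute norm_eq_1)
      moreover have sq: "(R * dist x y)\<^sup>2 = R\<^sup>2 * (2 - 2 * (x \<bullet> y))"
        if "norm x = 1" "norm y = 1" for x y :: "real^2"
        using that by (simp add: power_mult_distrib dist_norm power2_norm_eq_inner inner_diff inner_commute norm_eq_1)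
      ultimately have "R\<^sup>2 * (2 - 2 * (v1 \<bullet> v2)) = 1" "R\<^sup>2 * (2 - 2 * (v1 \<bullet> v3)) = 1" "R\<^sup>2 * (2 - 2 * (v2 \<bullet> v3)) = 1"
        using v sq[OF v(1,2)] sq[OF v(1,3)] sq[OF v(2,3)] by simp_all
      then have "R\<^sup>2 * (3 + 2 * (v1 \<bullet> v2) + 2 * (v1 \<bullet> v3) + 2 * (v2 \<bullet> v3)) = 9 * R\<^sup>2 - 3"
        by (simp add: algebra_simps)
      moreover have "(norm (v1 + v2 + v3))\<^sup>2 = 3 + 2 * (v1 \<bullet> v2) + 2 * (v1 \<bullet> v3) + 2 * (v2 \<bullet> v3)"
        using v by (simp add: power2_norm_eq_inner inner_add inner_commute norm_eq_1)
      ultimately have "R\<^sup>2 * (norm (v1 + v2 + v3))\<^sup>2 < 0" using R(2) by simp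
      moreover have "0 \<le> R\<^sup>2 * (norm (v1 + v2 + v3))\<^sup>2" by simp
      ultimately show False by linarith
    qed
    have "d2 \<noteq> v2"
    proof
      assume "d2 = v2"
      then have "R *\<^sub>R v1 = (R - 1) *\<^sub>R v2" by (simp add: d2_def algebra_simps)
      then have "norm (R *\<^sub>R v1) = norm ((R - 1) *\<^sub>R v2)" by simp
      then show False using v R by simp
    qed
    then obtain w where w: "norm w = 1" "d2 \<bullet> v2 < w \<bullet> v2" "1 / 2 \<le> w \<bullet> d3"
      using ex_turned_unit_vector[of d2 v2 "1 / 2" d3] True v dv half by auto
    then show ?thesis using True by (intro suffices[of w d3]) auto
  qed
qed

lemma ex_larger_average_support':
  fixes v1 v2 v3 :: "real^2"
  assumes v: "norm v1 = 1" "norm v2 = 1" "norm v3 = 1" "v1 \<noteq> v2" "v1 \<noteq> v3" "v2 \<noteq> v3"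
    and m: "0 < m1" "0 < m2" "0 < m3" "m1 + m2 + m3 = 1" "m1 *\<^sub>R v1 + m2 *\<^sub>R v2 + m3 *\<^sub>R v3 = 0"
    and R: "1 / 2 < R" "3 * R\<^sup>2 < 1"
    and d: "R * dist v1 v2 \<le> 1" "R * dist v1 v3 \<le> 1" "R * dist v2 v3 \<le> 1"
  shows "\<exists>L. constant_width_one L \<and> R < m1 * hsup L v1 + m2 * hsup L v2 + m3 * hsup L v3"
proof -
  consider "dist v2 v3 \<le> dist v1 v2" "dist v2 v3 \<le> dist v1 v3"
    | "dist v1 v3 \<le> dist v1 v2" "dist v1 v3 \<le> dist v2 v3"
    | "dist v1 v2 \<le> dist v1 v3" "dist v1 v2 \<le> dist v2 v3" by linarith
  then show ?thesis
  proof cases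
    case 1
    then show ?thesis using ex_larger_average_support[OF v(1-5) m R d(1,2)] by blast
  next
    case 2
    have "m2 + m1 + m3 = 1" "m2 *\<^sub>R v2 + m1 *\<^sub>R v1 + m3 *\<^sub>R v3 = 0"
      using m(4,5) by (simp_all add: add_ac)
    then have "\<exists>L. constant_width_one L \<and> R < m2 * hsup L v2 + m1 * hsup L v1 + m3 * hsup L v3"
      using v m(1-3) R d 2 by (intro ex_larger_average_support) (auto simp: dist_commute)
    then show ?thesis by (simp add: add_ac)
  next
    case 3
    have "m3 + m1 + m2 = 1" "m3 *\<^sub>R v3 + m1 *\<^sub>R v1 + m2 *\<^sub>R v2 = 0"
      using m(4,5) by (simp_all add: add_ac)
    then have "\<exists>L. constant_width_one L \<and> R < m3 * hsup L v3 + m1 * hsup L v1 + m2 * hsup L v2"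
      using v m(1-3) R d 3 by (intro ex_larger_average_support) (auto simp: dist_commute)
    then show ?thesis by (simp add: add_ac)
  qed
qed

text \<open>The incentre \<open>q\<close> of \<open>M\<close> enters the weighted sum only through
  its product with the zero combination of the directions, so its position is irrelevant.\<close>

lemma inradius_le_of_balanced:
  assumes M: "constant_width_one M" and v: "norm v1 = 1" "norm v2 = 1" "norm v3 = 1"
    and m: "0 < m1" "0 < m2" "0 < m3" "m1 + m2 + m3 = 1" "m1 *\<^sub>R v1 + m2 *\<^sub>R v2 + m3 *\<^sub>R v3 = 0"
  shows "inradius M \<le> 1 - (m1 * hsup M v1 + m2 * hsup M v2 + m3 * hsup M v3)"
proof -
  obtain q where q: "is_incircle M q (inradius M)" using cw_incircle_exists[OF M] by blast
  define \<rho> where "\<rho> = inradius M"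
  have \<rho>: "0 \<le> \<rho>" "cball q \<rho> \<subseteq> M" using q by (auto simp: is_incircle_def \<rho>_def)
  have \<rho>1: "\<rho> \<le> 1 / 2" using cw_cball_radius_le[OF M \<rho>(2)] .
  then have "M \<subseteq> cball q (1 - \<rho>)" using cw_cball_dual[OF M \<rho>(1)] \<rho>(2) by simp
  then have h: "hsup M v \<le> q \<bullet> v + (1 - \<rho>)" if "norm v = 1" for v
    using subset_cball_iff_hsup[OF cwD(1,3)[OF M], of "1 - \<rho>" q] \<rho>1 that by simp
  have "m1 * hsup M v1 + m2 * hsup M v2 + m3 * hsup M v3 \<le>
      m1 * (q \<bullet> v1 + (1 - \<rho>)) + m2 * (q \<bullet> v2 + (1 - \<rho>)) + m3 * (q \<bullet> v3 + (1 - \<rho>))"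
    using h v m by (intro add_mono mult_left_mono) auto
  also have "\<dots> = q \<bullet> (m1 *\<^sub>R v1 + m2 *\<^sub>R v2 + m3 *\<^sub>R v3) + (m1 + m2 + m3) * (1 - \<rho>)"
    by (simp add: inner_add_right algebra_simps)
  finally show ?thesis unfolding m by (simp add: \<rho>_def)
qed

lemma contact_directions:
  assumes K: "constant_width_one K" and r: "inradius K < 1 / 2"
  obtains v1 v2 v3 m1 m2 m3 and c :: "real^2" where
    "norm v1 = 1" "norm v2 = 1" "norm v3 = 1" "v1 \<noteq> v2" "v1 \<noteq> v3" "v2 \<noteq> v3"
    "0 < m1" "0 < m2" "0 < m3" "m1 + m2 + m3 = 1" "m1 *\<^sub>R v1 + m2 *\<^sub>R v2 + m3 *\<^sub>R v3 = (0::real^2)"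
    "c + (1 - inradius K) *\<^sub>R v1 \<in> K" "c + (1 - inradius K) *\<^sub>R v2 \<in> K" "c + (1 - inradius K) *\<^sub>R v3 \<in> K"
proof -
  obtain c where c: "is_incircle K c (inradius K)" using cw_incircle_exists[OF K] by blast
  have "is_incircle ((\<lambda>x. x + - c) ` K) (c + - c) (inradius K)" by (rule translation_incircle[OF c])
  then have inc: "is_incircle ((\<lambda>x. x + - c) ` K) 0 (inradius K)" by simp
  have cw: "constant_width_one ((\<lambda>x. x + - c) ` K)"
    by (rule rigid_motion_cw[OF rigid_motion_translation K])
  show thesis
  proof (rule three_contact_points[OF cw inc r])
    fix v1 v2 v3 :: "real^2" and m1 m2 m3 :: real
    assume a: "norm v1 = 1" "norm v2 = 1" "norm v3 = 1" "v1 \<noteq> v2" "v1 \<noteq> v3" "v2 \<noteq> v3"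
      "0 < m1" "0 < m2" "0 < m3" "m1 + m2 + m3 = 1" "m1 *\<^sub>R v1 + m2 *\<^sub>R v2 + m3 *\<^sub>R v3 = 0"
      and b: "(1 - inradius K) *\<^sub>R v1 \<in> (\<lambda>x. x + - c) ` K" "(1 - inradius K) *\<^sub>R v2 \<in> (\<lambda>x. x + - c) ` K"
        "(1 - inradius K) *\<^sub>R v3 \<in> (\<lambda>x. x + - c) ` K"
    have *: "c + y \<in> K" if "y \<in> (\<lambda>x. x + - c) ` K" for y using that by auto
    show thesis by (rule that[OF a *[OF b(1)] *[OF b(2)] *[OF b(3)]])
  qed
qed

lemma hsup_contact:
  assumes "constant_width_one K" "norm v = 1" "c + R *\<^sub>R v \<in> K"
  shows "c \<bullet> v + R \<le> hsup K v"
  using hsup_ge[OF cwD(1)[OF assms(1)] assms(3), of v] assms(2)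
  by (simp add: inner_add_left norm_eq_1)

text \<open>The weighted support sum is affine along the segment, so the inradius falls at least at
  a linear rate, namely the excess of this sum for \<open>L\<close> over the circumradius of
  \<open>K\<close>.\<close>

lemma ex_shrinking_direction:
  assumes K: "constant_width_one K" and r: "1 - 1 / sqrt 3 < inradius K"
  shows "\<exists>L s. constant_width_one L \<and> 0 < s \<and>
    (\<forall>t. 0 \<le> t \<longrightarrow> t \<le> 1 \<longrightarrow> inradius (mix t K L) \<le> inradius K - t * s)"
proof -
  have main: ?thesis
    if v: "norm v1 = 1" "norm v2 = 1" "norm v3 = 1"
      and m: "0 < m1" "0 < m2" "0 < m3" "m1 + m2 + m3 = 1" "m1 *\<^sub>R v1 + m2 *\<^sub>R v2 + m3 *\<^sub>R v3 = 0"
      and h: "c \<bullet> v1 + (1 - inradius K) \<le> hsup K v1" "c \<bullet> v2 + (1 - inradius K) \<le> hsup K v2"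
        "c \<bullet> v3 + (1 - inradius K) \<le> hsup K v3"
      and L: "constant_width_one L" "1 - inradius K < m1 * hsup L v1 + m2 * hsup L v2 + m3 * hsup L v3"
    for v1 v2 v3 :: "real^2" and m1 m2 m3 c L
  proof -
    define S where "S A = m1 * hsup A v1 + m2 * hsup A v2 + m3 * hsup A v3" for A
    define s where "s = S L - (1 - inradius K)"
    have "m1 * (c \<bullet> v1 + (1 - inradius K)) + m2 * (c \<bullet> v2 + (1 - inradius K)) + m3 * (c \<bullet> v3 + (1 - inradius K))
        = c \<bullet> (m1 *\<^sub>R v1 + m2 *\<^sub>R v2 + m3 *\<^sub>R v3) + (m1 + m2 + m3) * (1 - inradius K)"
      by (simp add: inner_add_right algebra_simps)
    moreover have "m1 * (c \<bullet> v1 + (1 - inradius K)) + m2 * (c \<bullet> v2 + (1 - inradius K)) + m3 * (c \<bullet> v3 + (1 - inradius K)) \<le> S K"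
      unfolding S_def using h m by (intro add_mono mult_left_mono) auto
    ultimately have SK: "1 - inradius K \<le> S K" unfolding m by simp
    have "inradius (mix t K L) \<le> inradius K - t * s" if t: "0 \<le> t" "t \<le> 1" for t
    proof -
      have "S (mix t K L) = (1 - t) * S K + t * S L"
        unfolding S_def hsup_mix(2)[OF cwD(1,3)[OF K] cwD(1,3)[OF L(1)] t] by (simp add: algebra_simps)
      moreover have "(1 - t) * (1 - inradius K) \<le> (1 - t) * S K" using SK t by (intro mult_left_mono) auto
      moreover have "inradius (mix t K L) \<le> 1 - S (mix t K L)"
        unfolding S_def by (rule inradius_le_of_balanced[OF mix_cw[OF K L(1) t] v m])
      ultimately have "inradius (mix t K L) \<le> 1 - ((1 - t) * (1 - inradius K) + t * S L)" by linarith
      then show ?thesis by (simp add: s_def algebra_simps)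
    qed
    moreover have "0 < s" using L(2) by (simp add: s_def S_def)
    ultimately show ?thesis using L(1) by blast
  qed
  obtain c where c: "is_incircle K c (inradius K)" using cw_incircle_exists[OF K] by blast
  have "inradius K \<le> 1 / 2" using c cw_cball_radius_le[OF K] by (auto simp: is_incircle_def)
  then consider "inradius K < 1 / 2" | "inradius K = 1 / 2" by linarith
  then show ?thesis
  proof cases
    case 1
    show ?thesis
    proof (rule contact_directions[OF K 1])
      fix v1 v2 v3 c :: "real^2" and m1 m2 m3 :: real
      assume v: "norm v1 = 1" "norm v2 = 1" "norm v3 = 1" "v1 \<noteq> v2" "v1 \<noteq> v3" "v2 \<noteq> v3"
        and m: "0 < m1" "0 < m2" "0 < m3" "m1 + m2 + m3 = 1" "m1 *\<^sub>R v1 + m2 *\<^sub>R v2 + m3 *\<^sub>R v3 = 0"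
        and x: "c + (1 - inradius K) *\<^sub>R v1 \<in> K" "c + (1 - inradius K) *\<^sub>R v2 \<in> K" "c + (1 - inradius K) *\<^sub>R v3 \<in> K"
      define R where "R = 1 - inradius K"
      have R: "1 / 2 < R" "R < 1 / sqrt 3" using 1 r by (auto simp: R_def)
      have "R\<^sup>2 < (1 / sqrt 3)\<^sup>2" using R by (intro power_strict_mono) auto
      then have R2: "3 * R\<^sup>2 < 1" by (simp add: power_divide)
      have d: "R * dist v w \<le> 1" if "c + R *\<^sub>R v \<in> K" "c + R *\<^sub>R w \<in> K" for v w
      proof -
        have "dist (c + R *\<^sub>R v) (c + R *\<^sub>R w) = R * dist v w"
          using R by (simp add: dist_norm flip: scaleR_diff_right)
        then show ?thesis using cw_diam[OF K that] by simp
      qed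
      note x' = x[folded R_def]
      obtain L where "constant_width_one L" "R < m1 * hsup L v1 + m2 * hsup L v2 + m3 * hsup L v3"
        using ex_larger_average_support'[OF v m R(1) R2 d[OF x'(1,2)] d[OF x'(1,3)] d[OF x'(2,3)]] by blast
      then show ?thesis
        using main[OF v(1-3) m hsup_contact[OF K v(1) x(1)] hsup_contact[OF K v(2) x(2)] hsup_contact[OF K v(3) x(3)]]
        by (simp add: R_def)
    qed
  next
    case 2
    \<comment> \<open>When the inradius is 1/2, the outercircle is touched in every direction, so
      any balanced triple will do. The contact directions of a Reuleaux triangle are chosen, because
      for them this triangle has the larger sum.\<close>
    obtain T where T: "constant_width_one T" "is_incircle T 0 (1 - 1 / sqrt 3)"
      using ex_reuleaux_triangle by blast
    have iT: "inradius T = 1 - 1 / sqrt 3" by (rule inradius_eqI[OF T(2)])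
    then have "inradius T < 1 / 2" using r 2 by simp
    show ?thesis
    proof (rule contact_directions[OF T(1) \<open>inradius T < 1 / 2\<close>])
      fix v1 v2 v3 q :: "real^2" and m1 m2 m3 :: real
      assume v: "norm v1 = 1" "norm v2 = 1" "norm v3 = 1" "v1 \<noteq> v2" "v1 \<noteq> v3" "v2 \<noteq> v3"
        and m: "0 < m1" "0 < m2" "0 < m3" "m1 + m2 + m3 = 1" "m1 *\<^sub>R v1 + m2 *\<^sub>R v2 + m3 *\<^sub>R v3 = 0"
        and x: "q + (1 - inradius T) *\<^sub>R v1 \<in> T" "q + (1 - inradius T) *\<^sub>R v2 \<in> T" "q + (1 - inradius T) *\<^sub>R v3 \<in> T"
      have h: "c \<bullet> v + (1 - inradius K) \<le> hsup K v" if "norm v = 1" for v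
      proof -
        have "c \<bullet> v + inradius K \<le> hsup K v"
          using cball_subset_iff_hsup[OF cwD[OF K], of "inradius K" c] c that by (simp add: is_incircle_def)
        then show ?thesis using 2 by simp
      qed
      have "m1 * (q \<bullet> v1 + (1 - inradius T)) + m2 * (q \<bullet> v2 + (1 - inradius T)) + m3 * (q \<bullet> v3 + (1 - inradius T))
          = q \<bullet> (m1 *\<^sub>R v1 + m2 *\<^sub>R v2 + m3 *\<^sub>R v3) + (m1 + m2 + m3) * (1 - inradius T)"
        by (simp add: inner_add_right algebra_simps)
      moreover have "m1 * (q \<bullet> v1 + (1 - inradius T)) + m2 * (q \<bullet> v2 + (1 - inradius T)) + m3 * (q \<bullet> v3 + (1 - inradius T))
          \<le> m1 * hsup T v1 + m2 * hsup T v2 + m3 * hsup T v3"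
        using m hsup_contact[OF T(1) v(1) x(1)] hsup_contact[OF T(1) v(2) x(2)] hsup_contact[OF T(1) v(3) x(3)]
        by (intro add_mono mult_left_mono) auto
      ultimately have "1 - inradius K < m1 * hsup T v1 + m2 * hsup T v2 + m3 * hsup T v3"
        unfolding m using iT r by simp
      then show ?thesis by (rule main[OF v(1-3) m h[OF v(1)] h[OF v(2)] h[OF v(3)] T(1)])
    qed
  qed
qed

section \<open>Prescribing the inradius along Minkowski segments\<close>

lemma cw_disk: "constant_width_one (cball 0 (1 / 2))"
proof (rule cwI)
  fix u :: "real^2" assume u: "norm u = 1"
  have *: "hsup (cball 0 (1 / 2)) v = 1 / 2" if "norm v = 1" for v
  proof -
    have "hsup (cball 0 (1 / 2)) v = ((1 / 2) *\<^sub>R v) \<bullet> v"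
    proof (rule hsup_eqI)
      fix y assume "y \<in> cball (0::real^2) (1 / 2)"
      then show "y \<bullet> v \<le> ((1 / 2) *\<^sub>R v) \<bullet> v"
        using norm_cauchy_schwarz[of y v] that by (simp add: norm_eq_1)
    qed (use that in auto)
    then show ?thesis using that by (simp add: norm_eq_1)
  qed
  have "hsup (cball 0 (1 / 2)) (- u) = 1 / 2" by (rule *) (simp add: u)
  then show "hsup (cball 0 (1 / 2)) u + hsup (cball 0 (1 / 2)) (- u) = 1" using *[OF u] by linarith
qed auto

lemma inradius_mix_disk:
  assumes K: "constant_width_one K" and t: "0 \<le> t" "t \<le> 1"
  shows "inradius K + t * (1 / 2 - inradius K) \<le> inradius (mix t K (cball 0 (1 / 2)))"
proof -
  let ?B = "cball (0::real^2) (1 / 2)"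
  have M: "constant_width_one (mix t K ?B)" by (rule mix_cw[OF K cw_disk t])
  obtain c where c: "is_incircle K c (inradius K)" using cw_incircle_exists[OF K] by blast
  obtain q where q: "is_incircle (mix t K ?B) q (inradius (mix t K ?B))" using cw_incircle_exists[OF M] by blast
  have c0: "0 \<le> inradius K" using c by (simp add: is_incircle_def)
  define \<rho> where "\<rho> = (1 - t) * inradius K + t * (1 / 2)"
  have \<rho>: "0 \<le> \<rho>" using c0 t by (simp add: \<rho>_def)
  have "((1 - t) *\<^sub>R c) \<bullet> u + \<rho> \<le> hsup (mix t K ?B) u" if u: "norm u = 1" for u
  proof -
    have "c \<bullet> u + inradius K \<le> hsup K u"
      using cball_subset_iff_hsup[OF cwD[OF K] c0, of c] c u by (simp add: is_incircle_def)
    then have "(1 - t) * (c \<bullet> u + inradius K) \<le> (1 - t) * hsup K u" using t by (intro mult_left_mono) auto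
    moreover have "0 \<bullet> u + 1 / 2 \<le> hsup ?B u"
      using cball_subset_iff_hsup[OF cwD[OF cw_disk], of "1 / 2" 0] u by simp
    then have "t * (1 / 2) \<le> t * hsup ?B u" using t by (intro mult_left_mono) auto
    ultimately show ?thesis
      unfolding hsup_mix(2)[OF cwD(1,3)[OF K] cwD(1,3)[OF cw_disk] t] by (simp add: \<rho>_def algebra_simps)
  qed
  then have "cball ((1 - t) *\<^sub>R c) \<rho> \<subseteq> mix t K ?B" using cball_subset_iff_hsup[OF cwD[OF M] \<rho>] by blast
  then have "\<rho> \<le> inradius (mix t K ?B)" using q unfolding is_incircle_def by blast
  then show ?thesis by (simp add: \<rho>_def algebra_simps)
qed

lemma mix_path:
  assumes K: "constant_width_one K" and L: "constant_width_one L"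
  shows "\<exists>D>0. \<forall>s t. hclose (\<bar>s - t\<bar> * D) (mix s K L) (mix t K L)"
proof -
  obtain a b where ab: "a \<in> K" "b \<in> L" using cwD(3)[OF K] cwD(3)[OF L] by blast
  define D where "D = dist a b + 2"
  have D: "0 < D" by (simp add: D_def add_nonneg_pos)
  have "dist x y \<le> D" if "x \<in> K" "y \<in> L" for x y
  proof -
    have "dist x y \<le> dist x a + dist a b + dist b y"
      using dist_triangle[of x y a] dist_triangle[of a y b] by linarith
    then show ?thesis using cw_diam[OF K that(1) ab(1)] cw_diam[OF L ab(2) that(2)] by (simp add: D_def)
  qed
  then have "hclose (\<bar>s - t\<bar> * D) (mix s K L) (mix t K L)" for s t by (intro mix_hclose)
  then show ?thesis using D by blast
qed

lemma continuous_on_inradius_mix: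
  assumes K: "constant_width_one K" and L: "constant_width_one L"
  shows "continuous_on {0..1} (\<lambda>t. inradius (mix t K L))"
proof (rule continuous_onI)
  obtain D where D: "0 < D" and close: "\<forall>s t. hclose (\<bar>s - t\<bar> * D) (mix s K L) (mix t K L)"
    using mix_path[OF K L] by blast
  fix t e :: real assume t: "t \<in> {0..1}" "0 < e"
  show "\<exists>d>0. \<forall>s\<in>{0..1}. dist s t < d \<longrightarrow> dist (inradius (mix s K L)) (inradius (mix t K L)) \<le> e"
  proof (intro exI[of _ "e / D"] conjI ballI impI)
    fix s assume s: "s \<in> {0..1}" "dist s t < e / D"
    have "\<bar>inradius (mix s K L) - inradius (mix t K L)\<bar> \<le> \<bar>s - t\<bar> * D"
      using s(1) t(1) by (intro hclose_inradius mix_cw K L close[rule_format]) auto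
    also have "\<dots> \<le> e" using s(2) D by (simp add: dist_real_def pos_less_divide_eq)
    finally show "dist (inradius (mix s K L)) (inradius (mix t K L)) \<le> e" by (simp add: dist_real_def)
  qed (use t D in auto)
qed

text \<open>The sign \<open>\<sigma>\<close> selects whether the inradius is increased or decreased along the Minkowski segment.\<close>

lemma perturb_inradius:
  assumes K: "constant_width_one K" and L: "constant_width_one L" and s: "0 < s"
    and grow: "\<And>t. 0 \<le> t \<Longrightarrow> t \<le> 1 \<Longrightarrow> t * s \<le> \<sigma> * (inradius (mix t K L) - inradius K)"
    and \<sigma>: "\<sigma> = 1 \<or> \<sigma> = - 1" and e: "0 < e"
  shows "\<exists>d>0. \<forall>r. 0 \<le> \<sigma> * (r - inradius K) \<and> \<sigma> * (r - inradius K) < d \<longrightarrow>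
    (\<exists>K'\<in>cw_bodies r. hclose e K' K)"
proof -
  obtain D where D: "0 < D" "\<forall>s t. hclose (\<bar>s - t\<bar> * D) (mix s K L) (mix t K L)"
    using mix_path[OF K L] by blast
  note cont = continuous_on_inradius_mix[OF K L]
  \<comment> \<open>A change of the inradius by \<open>y\<close> needs at most the parameter
    \<open>t = y / s\<close>. The first bound keeps \<open>t\<close> at most 1, the second keeps the
    displacement \<open>t * D\<close> at most \<open>e\<close>.\<close>
  define d where "d = min s (e * s / D)"
  have mix0: "mix 0 K L = K" by (rule mix_0[OF cwD(3)[OF L]])
  show ?thesis
  proof (intro exI[of _ d] conjI allI impI)
    show "0 < d" using s e D by (simp add: d_def)
    fix r assume r: "0 \<le> \<sigma> * (r - inradius K) \<and> \<sigma> * (r - inradius K) < d"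
    define y where "y = \<sigma> * (r - inradius K)"
    have y: "0 \<le> y" "y < s" "y < e * s / D" using r by (auto simp: y_def d_def)
    define t where "t = y / s"
    have t: "0 \<le> t" "t \<le> 1" "t * s = y" using y s by (auto simp: t_def)
    have tD: "t * D \<le> e"
    proof -
      have "y * D \<le> e * s" using y(3) D(1) by (simp add: pos_less_divide_eq)
      then show ?thesis using s by (simp add: t_def pos_divide_le_eq)
    qed
    \<comment> \<open>At \<open>t\<close> the inradius has changed by at least \<open>y\<close>, so
      the exact value is attained no later than that.\<close>
    have "\<exists>x\<ge>0. x \<le> t \<and> \<sigma> * (inradius (mix x K L) - inradius K) = y"
    proof (rule IVT')
      show "\<sigma> * (inradius (mix 0 K L) - inradius K) \<le> y" using y(1) by (simp add: mix0)
      show "y \<le> \<sigma> * (inradius (mix t K L) - inradius K)" using grow[OF t(1,2)] t(3) by simp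
      show "continuous_on {0..t} (\<lambda>x. \<sigma> * (inradius (mix x K L) - inradius K))"
        using t(2) by (intro continuous_intros continuous_on_subset[OF cont]) auto
    qed (rule t)
    then obtain x where x: "0 \<le> x" "x \<le> t" "\<sigma> * (inradius (mix x K L) - inradius K) = y" by blast
    have "inradius (mix x K L) = r" using x(3) \<sigma> by (auto simp: y_def)
    moreover have "constant_width_one (mix x K L)" using x t by (intro mix_cw K L) auto
    moreover have "hclose (\<bar>x - 0\<bar> * D) (mix x K L) K" using D(2) mix0 by metis
    then have "hclose e (mix x K L) K"
    proof (rule hclose_mono)
      have "x * D \<le> t * D" using x D(1) by (intro mult_right_mono) auto
      then show "\<bar>x - 0\<bar> * D \<le> e" using tD x(1) by simp
    qed
    ultimately show "\<exists>K'\<in>cw_bodies r. hclose e K' K" by (auto simp: cw_bodies_def)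
  qed
qed

lemma cw_bodies_inradius_le:
  assumes "K \<in> cw_bodies r"
  shows "r \<le> 1 / 2"
proof -
  have K: "constant_width_one K" "inradius K = r" using assms by (auto simp: cw_bodies_def)
  obtain c where "is_incircle K c (inradius K)" using cw_incircle_exists[OF K(1)] by blast
  then show ?thesis using cw_cball_radius_le[OF K(1), of c r] by (simp add: is_incircle_def K(2))
qed

text \<open>Each side of \<open>r\<close> has its own segment: towards the disk above, towards a
  suitably turned body below. At an extreme value there is no admissible parameter on the far
  side.\<close>

lemma cw_bodies_approx:
  assumes K: "K \<in> cw_bodies r" and e: "0 < e"
  shows "\<exists>d>0. \<forall>r'\<in>{1 - 1 / sqrt 3..1 / 2}. \<bar>r' - r\<bar> < d \<longrightarrow> (\<exists>K'\<in>cw_bodies r'. hclose e K' K)"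
proof -
  have cw: "constant_width_one K" and i: "inradius K = r" using K by (auto simp: cw_bodies_def)
  have "\<exists>d1>0. \<forall>r'. r \<le> r' \<and> r' < r + d1 \<and> r' \<le> 1 / 2 \<longrightarrow> (\<exists>K'\<in>cw_bodies r'. hclose e K' K)"
  proof (cases "r < 1 / 2")
    case True
    have "\<exists>d>0. \<forall>r'. 0 \<le> 1 * (r' - inradius K) \<and> 1 * (r' - inradius K) < d \<longrightarrow> (\<exists>K'\<in>cw_bodies r'. hclose e K' K)"
      using inradius_mix_disk[OF cw] True i
      by (intro perturb_inradius[OF cw cw_disk, of "1 / 2 - r" 1] e) (auto simp: algebra_simps)
    then obtain d where d: "0 < d"
      "\<forall>r'. 0 \<le> 1 * (r' - inradius K) \<and> 1 * (r' - inradius K) < d \<longrightarrow> (\<exists>K'\<in>cw_bodies r'. hclose e K' K)"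
      by (elim exE conjE) (rule that)
    then show ?thesis unfolding i by (intro exI[of _ d] conjI allI impI) (auto simp: algebra_simps)
  next
    case False
    then have "r = 1 / 2" using cw_bodies_inradius_le[OF K] by simp
    then have "r' = r" if "r \<le> r' \<and> r' < r + 1 \<and> r' \<le> 1 / 2" for r' using that by simp
    moreover have "hclose e K K" using e by (auto simp: hclose_def intro!: bexI)
    ultimately show ?thesis using K by (intro exI[of _ 1]) auto
  qed
  then obtain d1 where d1: "0 < d1"
    "\<forall>r'. r \<le> r' \<and> r' < r + d1 \<and> r' \<le> 1 / 2 \<longrightarrow> (\<exists>K'\<in>cw_bodies r'. hclose e K' K)" by blast
  have "\<exists>d2>0. \<forall>r'. r - d2 < r' \<and> r' < r \<and> 1 - 1 / sqrt 3 \<le> r' \<longrightarrow> (\<exists>K'\<in>cw_bodies r'. hclose e K' K)"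
  proof (cases "1 - 1 / sqrt 3 < r")
    case True
    obtain L s where L: "constant_width_one L" "0 < s"
      "\<forall>t. 0 \<le> t \<longrightarrow> t \<le> 1 \<longrightarrow> inradius (mix t K L) \<le> inradius K - t * s"
      using ex_shrinking_direction[OF cw] True i by blast
    have "\<exists>d>0. \<forall>r'. 0 \<le> - 1 * (r' - inradius K) \<and> - 1 * (r' - inradius K) < d \<longrightarrow> (\<exists>K'\<in>cw_bodies r'. hclose e K' K)"
      using L(3) by (intro perturb_inradius[OF cw L(1,2), of "- 1"] e) auto
    then obtain d where d: "0 < d"
      "\<forall>r'. 0 \<le> - 1 * (r' - inradius K) \<and> - 1 * (r' - inradius K) < d \<longrightarrow> (\<exists>K'\<in>cw_bodies r'. hclose e K' K)"
      by (elim exE conjE) (rule that)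
    then show ?thesis unfolding i by (intro exI[of _ d] conjI allI impI) (auto simp: algebra_simps)
  next
    case False
    then show ?thesis by (intro exI[of _ 1]) auto
  qed
  then obtain d2 where d2: "0 < d2"
    "\<forall>r'. r - d2 < r' \<and> r' < r \<and> 1 - 1 / sqrt 3 \<le> r' \<longrightarrow> (\<exists>K'\<in>cw_bodies r'. hclose e K' K)" by blast
  show ?thesis
  proof (intro exI[of _ "min d1 d2"] conjI ballI impI)
    fix r' assume r': "r' \<in> {1 - 1 / sqrt 3..1 / 2}" "\<bar>r' - r\<bar> < min d1 d2"
    show "\<exists>K'\<in>cw_bodies r'. hclose e K' K"
    proof (cases "r \<le> r'")
      case True
      then show ?thesis using d1(2) r' by auto
    next
      case False
      then show ?thesis using d2(2) r' by auto
    qed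
  qed (use d1 d2 in auto)
qed

text \<open>On the segment from the Reuleaux triangle to the disk the inradius runs continuously
  through the whole range.\<close>

lemma cw_bodies_nonempty:
  assumes "1 - 1 / sqrt 3 \<le> r" "r \<le> 1 / 2"
  shows "cw_bodies r \<noteq> {}"
proof -
  obtain T where T: "constant_width_one T" "is_incircle T 0 (1 - 1 / sqrt 3)"
    using ex_reuleaux_triangle by blast
  let ?g = "\<lambda>t. inradius (mix t T (cball 0 (1 / 2)))"
  have cont: "continuous_on {0..1} ?g" by (rule continuous_on_inradius_mix[OF T(1) cw_disk])
  have "\<exists>t\<ge>0. t \<le> 1 \<and> ?g t = r"
  proof (rule IVT')
    show "?g 0 \<le> r" using inradius_eqI[OF T(2)] assms(1) by (simp add: mix_0)
    show "r \<le> ?g 1" using inradius_mix_disk[OF T(1), of 1] assms(2) by simp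
  qed (use cont in auto)
  then obtain t where "0 \<le> t" "t \<le> 1" "?g t = r" by blast
  then have "mix t T (cball 0 (1 / 2)) \<in> cw_bodies r"
    using mix_cw[OF T(1) cw_disk] by (simp add: cw_bodies_def)
  then show ?thesis by blast
qed


section \<open>Minimal area\<close>

lemma hclose_measure_small:
  assumes "0 < \<rho>" "0 < \<eta>"
  shows "\<exists>e>0. \<forall>K L. constant_width_one K \<longrightarrow> constant_width_one L \<longrightarrow> \<rho> \<le> inradius K \<longrightarrow> \<rho> \<le> inradius L \<longrightarrow>
    hclose e K L \<longrightarrow> \<bar>measure lebesgue K - measure lebesgue L\<bar> < \<eta>"
proof -
  let ?A = "measure lebesgue (cball (0::real^2) 1)"
  have "((\<lambda>e. ((1 + e / \<rho>)\<^sup>2 - 1) * ?A) \<longlongrightarrow> ((1 + 0 / \<rho>)\<^sup>2 - 1) * ?A) (at_right 0)"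
    using assms(1) by (intro tendsto_intros) auto
  then have "\<forall>\<^sub>F e in at_right 0. ((1 + e / \<rho>)\<^sup>2 - 1) * ?A < \<eta>"
    by (rule order_tendstoD) (use assms in simp)
  moreover have "\<forall>\<^sub>F e in at_right (0::real). 0 < e" by (simp add: eventually_at_right_less)
  ultimately have "\<forall>\<^sub>F e in at_right 0. ((1 + e / \<rho>)\<^sup>2 - 1) * ?A < \<eta> \<and> 0 < e" by (rule eventually_conj)
  then obtain e where e: "((1 + e / \<rho>)\<^sup>2 - 1) * ?A < \<eta>" "0 < e"
    using eventually_happens trivial_limit_at_right_real by blast
  have "\<bar>measure lebesgue K - measure lebesgue L\<bar> < \<eta>"
    if "constant_width_one K" "constant_width_one L" "\<rho> \<le> inradius K" "\<rho> \<le> inradius L" "hclose e K L" for K L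
    using hclose_measure[OF that(1,3) that(2,4) assms(1) less_imp_le[OF e(2)] that(5)] e(1) by linarith
  then show ?thesis using e(2) by blast
qed

lemma cw_bodies_limit:
  assumes K: "\<And>n::nat. K n \<in> cw_bodies (\<rho> n)" and \<rho>: "\<rho> \<longlonglongrightarrow> r" "\<And>n. 1 - 1 / sqrt 3 \<le> \<rho> n"
  shows "\<exists>k L. strict_mono (k :: nat \<Rightarrow> nat) \<and> L \<in> cw_bodies r \<and>
    (\<lambda>n. measure lebesgue (K (k n))) \<longlonglongrightarrow> measure lebesgue L"
proof -
  have cw: "constant_width_one (K n)" for n using K[of n] by (simp add: cw_bodies_def)
  have "\<exists>x. x \<in> K n" for n using cwD(3)[OF cw] by blast
  then obtain x where x: "\<And>n. x n \<in> K n" by metis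
  \<comment> \<open>Translated to contain 0, a body of diameter at most 1 lies in the unit disk, as
    Blaschke selection requires.\<close>
  define F where "F n = (\<lambda>y. y + - x n) ` K n" for n
  have F: "F n \<in> cw_bodies (\<rho> n)" "measure lebesgue (F n) = measure lebesgue (K n)" for n
    unfolding F_def using translation_cw_bodies[OF K] by blast+
  have Fcw: "constant_width_one (F n)" and Fi: "inradius (F n) = \<rho> n" for n
    using F(1)[of n] by (auto simp: cw_bodies_def)
  have sub: "F n \<subseteq> cball 0 1" for n
    unfolding F_def using cw_diam[OF cw x] by (auto simp: dist_norm norm_minus_commute)
  have "\<exists>k L. strict_mono (k :: nat \<Rightarrow> nat) \<and> constant_width_one L \<and>
      (\<forall>e>0. \<exists>N. \<forall>n\<ge>N. hclose e (F (k n)) L)"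
  proof (rule cw_selection[of F, OF Fcw sub])
    fix k :: "nat \<Rightarrow> nat" and L
    assume *: "strict_mono k" "constant_width_one L" "\<And>e. 0 < e \<Longrightarrow> \<exists>N. \<forall>n\<ge>N. hclose e (F (k n)) L"
    show ?thesis by (intro exI[of _ k] exI[of _ L] conjI allI impI *)
  qed
  then obtain k :: "nat \<Rightarrow> nat" and L where k: "strict_mono k" and L: "constant_width_one L"
    and close: "\<forall>e>0. \<exists>N. \<forall>n\<ge>N. hclose e (F (k n)) L"
    by (elim exE conjE) (rule that)
  have "(\<lambda>n. \<rho> (k n)) \<longlonglongrightarrow> inradius L"
  proof (rule LIMSEQ_I)
    fix e :: real assume "0 < e"
    then obtain N where "\<forall>n\<ge>N. hclose (e / 2) (F (k n)) L" using close half_gt_zero by blast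
    then have "\<bar>\<rho> (k n) - inradius L\<bar> \<le> e / 2" if "n \<ge> N" for n
      using hclose_inradius[OF Fcw L, of "e / 2" "k n"] that Fi by simp
    then show "\<exists>N. \<forall>n\<ge>N. norm (\<rho> (k n) - inradius L) < e"
      using \<open>0 < e\<close> by (intro exI[of _ N]) fastforce
  qed
  moreover have "(\<lambda>n. \<rho> (k n)) \<longlonglongrightarrow> r" using LIMSEQ_subseq_LIMSEQ[OF \<rho>(1) k] by (simp add: o_def)
  ultimately have iL: "inradius L = r" by (rule LIMSEQ_unique)
  \<comment> \<open>The lower bound survives in the limit and gives all bodies, including
    \<open>L\<close>, a common positive inscribed radius for the area estimate.\<close>
  have r: "1 - 1 / sqrt 3 \<le> r" using \<rho> by (intro LIMSEQ_le_const) auto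
  have "(\<lambda>n. measure lebesgue (F (k n))) \<longlonglongrightarrow> measure lebesgue L"
  proof (rule LIMSEQ_I)
    fix \<eta> :: real assume "0 < \<eta>"
    obtain e where e: "0 < e" "\<forall>K L. constant_width_one K \<longrightarrow> constant_width_one L \<longrightarrow>
      1 - 1 / sqrt 3 \<le> inradius K \<longrightarrow> 1 - 1 / sqrt 3 \<le> inradius L \<longrightarrow>
      hclose e K L \<longrightarrow> \<bar>measure lebesgue K - measure lebesgue L\<bar> < \<eta>"
      using hclose_measure_small[OF r3_pos \<open>0 < \<eta>\<close>] by (elim exE conjE) (rule that)
    obtain N where "\<forall>n\<ge>N. hclose e (F (k n)) L" using close e(1) by blast
    then show "\<exists>N. \<forall>n\<ge>N. norm (measure lebesgue (F (k n)) - measure lebesgue L) < \<eta>"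
      using e(2) Fcw L Fi iL r \<rho>(2) by (intro exI[of _ N]) simp
  qed
  then show ?thesis using k L iL unfolding F(2) by (intro exI[of _ k] exI[of _ L]) (simp add: cw_bodies_def)
qed

lemma min_area_le: "K \<in> cw_bodies r \<Longrightarrow> min_area r \<le> measure lebesgue K"
  unfolding min_area_def by (rule cINF_lower) (auto intro: bdd_belowI[of _ 0])

text \<open>Direct method: a minimizing sequence of constant inradius has a limit body in the same
  class.\<close>

lemma min_area_attained:
  assumes r: "1 - 1 / sqrt 3 \<le> r" "r \<le> 1 / 2"
  shows "\<exists>K\<in>cw_bodies r. measure lebesgue K = min_area r"
proof -
  have "\<exists>K\<in>cw_bodies r. measure lebesgue K < min_area r + 1 / real (Suc n)" for n
  proof -
    have "Inf (measure lebesgue ` cw_bodies r) < min_area r + 1 / real (Suc n)"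
      by (simp add: min_area_def)
    then show ?thesis
      using cInf_lessD[of "measure lebesgue ` cw_bodies r"] cw_bodies_nonempty[OF r] by blast
  qed
  then obtain K where K: "\<And>n. K n \<in> cw_bodies r" "\<And>n. measure lebesgue (K n) < min_area r + 1 / real (Suc n)"
    by metis
  obtain k L where k: "strict_mono (k :: nat \<Rightarrow> nat)" and L: "L \<in> cw_bodies r"
    and lim: "(\<lambda>n. measure lebesgue (K (k n))) \<longlonglongrightarrow> measure lebesgue L"
    using cw_bodies_limit[of K "\<lambda>_. r" r, OF K(1) tendsto_const r(1)] by blast
  have "(\<lambda>n. min_area r + 1 / real (Suc n)) \<longlonglongrightarrow> min_area r + 0"
    using LIMSEQ_inverse_real_of_nat by (intro tendsto_intros) (simp add: inverse_eq_divide)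
  from LIMSEQ_subseq_LIMSEQ[OF this k]
  have "(\<lambda>n. min_area r + 1 / real (Suc (k n))) \<longlonglongrightarrow> min_area r" by (simp add: o_def)
  then have "measure lebesgue L \<le> min_area r"
    by (rule LIMSEQ_le[OF lim]) (use K(2) less_imp_le in blast)
  then show ?thesis using min_area_le[OF L] L by (intro bexI[of _ L]) auto
qed

lemma min_area_upper:
  assumes r: "1 - 1 / sqrt 3 \<le> r" "r \<le> 1 / 2" and \<eta>: "0 < \<eta>"
  shows "\<exists>d>0. \<forall>r'\<in>{1 - 1 / sqrt 3..1 / 2}. \<bar>r' - r\<bar> < d \<longrightarrow> min_area r' < min_area r + \<eta>"
proof -
  obtain K where K: "K \<in> cw_bodies r" "measure lebesgue K = min_area r" using min_area_attained[OF r] by blast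
  obtain e where e: "0 < e" "\<forall>K L. constant_width_one K \<longrightarrow> constant_width_one L \<longrightarrow>
      1 - 1 / sqrt 3 \<le> inradius K \<longrightarrow> 1 - 1 / sqrt 3 \<le> inradius L \<longrightarrow>
      hclose e K L \<longrightarrow> \<bar>measure lebesgue K - measure lebesgue L\<bar> < \<eta>"
    using hclose_measure_small[OF r3_pos \<eta>] by (elim exE conjE) (rule that)
  obtain d where d: "0 < d" "\<forall>r'\<in>{1 - 1 / sqrt 3..1 / 2}. \<bar>r' - r\<bar> < d \<longrightarrow> (\<exists>K'\<in>cw_bodies r'. hclose e K' K)"
    using cw_bodies_approx[OF K(1) e(1)] by blast
  show ?thesis
  proof (intro exI[of _ d] conjI ballI impI d(1))
    fix r' assume r': "r' \<in> {1 - 1 / sqrt 3..1 / 2}" "\<bar>r' - r\<bar> < d"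
    then obtain K' where K': "K' \<in> cw_bodies r'" "hclose e K' K" using d(2) by blast
    have "\<bar>measure lebesgue K' - measure lebesgue K\<bar> < \<eta>"
      using e(2)[rule_format, of K' K] K(1) K' r r' by (simp add: cw_bodies_def)
    then show "min_area r' < min_area r + \<eta>" using min_area_le[OF K'(1)] K(2) by linarith
  qed
qed

text \<open>If the minimum dropped along parameters tending to \<open>r\<close>, the corresponding
  minimizers would have a limit body of inradius \<open>r\<close> with area below the
  minimum.\<close>

lemma min_area_lower:
  assumes r: "1 - 1 / sqrt 3 \<le> r" "r \<le> 1 / 2" and \<eta>: "0 < \<eta>"
  shows "\<exists>d>0. \<forall>r'\<in>{1 - 1 / sqrt 3..1 / 2}. \<bar>r' - r\<bar> < d \<longrightarrow> min_area r - \<eta> < min_area r'"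
proof (rule ccontr)
  assume neg: "\<not> ?thesis"
  have "\<exists>s K. K \<in> cw_bodies s \<and> 1 - 1 / sqrt 3 \<le> s \<and> \<bar>s - r\<bar> < 1 / real (Suc n) \<and>
      measure lebesgue K \<le> min_area r - \<eta>" for n
  proof -
    obtain s where s: "s \<in> {1 - 1 / sqrt 3..1 / 2}" "\<bar>s - r\<bar> < 1 / real (Suc n)" "min_area s \<le> min_area r - \<eta>"
      using neg[unfolded not_ex, rule_format, of "1 / real (Suc n)"] by (auto simp: not_less)
    then obtain K where "K \<in> cw_bodies s" "measure lebesgue K = min_area s"
      using min_area_attained[of s] by auto
    then show ?thesis using s by (intro exI[of _ s] exI[of _ K]) auto
  qed
  then obtain s K where sK: "\<And>n. K n \<in> cw_bodies (s n)" "\<And>n. 1 - 1 / sqrt 3 \<le> s n"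
    "\<And>n. \<bar>s n - r\<bar> < 1 / real (Suc n)" "\<And>n. measure lebesgue (K n) \<le> min_area r - \<eta>"
    by metis
  have "(\<lambda>n. s n - r) \<longlonglongrightarrow> 0"
    by (rule Lim_null_comparison[OF _ LIMSEQ_inverse_real_of_nat])
      (use sK(3) in \<open>auto simp: inverse_eq_divide intro!: always_eventually less_imp_le\<close>)
  then have "s \<longlonglongrightarrow> r" by (rule LIM_zero_cancel)
  from cw_bodies_limit[of K s r, OF sK(1) this sK(2)]
  obtain k L where L: "L \<in> cw_bodies r"
    and lim: "(\<lambda>n. measure lebesgue (K (k n))) \<longlonglongrightarrow> measure lebesgue L"
    by blast
  have "measure lebesgue L \<le> min_area r - \<eta>" using sK(4) by (intro LIMSEQ_le_const2[OF lim]) auto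
  then show False using min_area_le[OF L] \<eta> by linarith
qed

lemma continuous_on_min_area: "continuous_on {1 - 1 / sqrt 3..1 / 2} min_area"
proof (rule continuous_onI)
  fix r e :: real assume r: "r \<in> {1 - 1 / sqrt 3..1 / 2}" and e: "0 < e"
  obtain d1 where d1: "0 < d1" "\<forall>r'\<in>{1 - 1 / sqrt 3..1 / 2}. \<bar>r' - r\<bar> < d1 \<longrightarrow> min_area r' < min_area r + e"
    using min_area_upper[of r e] r e by auto
  obtain d2 where d2: "0 < d2" "\<forall>r'\<in>{1 - 1 / sqrt 3..1 / 2}. \<bar>r' - r\<bar> < d2 \<longrightarrow> min_area r - e < min_area r'"
    using min_area_lower[of r e] r e by auto
  show "\<exists>d>0. \<forall>r'\<in>{1 - 1 / sqrt 3..1 / 2}. dist r' r < d \<longrightarrow> dist (min_area r') (min_area r) \<le> e"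
  proof (intro exI[of _ "min d1 d2"] conjI ballI impI)
    fix r' assume r': "r' \<in> {1 - 1 / sqrt 3..1 / 2}" "dist r' r < min d1 d2"
    then have "min_area r' < min_area r + e" "min_area r - e < min_area r'"
      using d1(2)[rule_format, OF r'(1)] d2(2)[rule_format, OF r'(1)] by (auto simp: dist_real_def)
    then show "dist (min_area r') (min_area r) \<le> e" by (simp add: dist_real_def abs_le_iff)
  qed (use d1 d2 in auto)
qed

theorem proposition1p4:
  shows "(\<forall>r\<in>{1 - 1 / sqrt 3..1/2}. \<exists>K\<in>cw_bodies r. measure lebesgue K = min_area r) \<and>
    continuous_on {1 - 1 / sqrt 3..1/2} min_area \<and>
    (\<forall>r\<in>{1 - 1 / sqrt 3..<1/2}. \<exists>K. is_Omega r K) \<and>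
    (\<forall>\<epsilon>>0. \<exists>\<delta>>0. \<forall>r\<^sub>1\<in>{1 - 1 / sqrt 3..<1/2}. \<forall>r\<^sub>2\<in>{1 - 1 / sqrt 3..<1/2}.
       \<bar>r\<^sub>1 - r\<^sub>2\<bar> < \<delta> \<longrightarrow>
       (\<forall>K\<^sub>1 K\<^sub>2. is_Omega r\<^sub>1 K\<^sub>1 \<longrightarrow> is_Omega r\<^sub>2 K\<^sub>2 \<longrightarrow>
          (\<exists>f g. rigid_motion f \<and> rigid_motion g \<and>
             hausdorff_dist (f ` K\<^sub>1) (g ` K\<^sub>2) < \<epsilon>)))"
proof (intro conjI ballI allI impI)
  show "\<exists>K\<in>cw_bodies r. measure lebesgue K = min_area r" if "r \<in> {1 - 1 / sqrt 3..1/2}" for r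
    using that min_area_attained by simp
  show "continuous_on {1 - 1 / sqrt 3..1/2} min_area" by (rule continuous_on_min_area)
  show "\<exists>K. is_Omega r K" if "r \<in> {1 - 1 / sqrt 3..<1/2}" for r
    using that ex_is_Omega by simp
qed (rule omega_uniformly_close)

end
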